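(* Let $\lambda<9$. Then there exists a constant $C_{\lambda}>0$ such that for all $u\in C^{\infty}_{0}(\mathbb{B}^{4})$ with \[ \int_{\mathbb{B}^{4}}|\Delta u|^{2}dx-\lambda\int_{\mathbb{B}^{4}}\frac{u^{2}}{(1-|x|^{2})^{4}}dx\leq1, \] there holds \[ \int_{\mathbb{B}^{4}}\left(e^{32\pi^{2}u^{2}}-1\right)dV=16\int_{\mathbb{B}^{4}}\frac{e^{32\pi^{2}u^{2}}-1}{(1-|x|^{2})^{4}}\,dx\leq C_{\lambda}. \]
   Context: $\mathbb{B}^{4}=\{x\in\mathbb{R}^{4}:|x|<1\}$, $dx$ is Lebesgue measure, $dV=\left(\frac{2}{1-|x|^{2}}\right)^{4}dx$ is the hyperbolic volume element of the Poincaré ball model, and $\Delta=\sum_{i=1}^{4}\frac{\partial^{2}}{\partial x_i^{2}}$ is the Euclidean Laplacian. $C_0^\infty(\mathbb{B}^4)$ denotes the real-valued smooth functions with compact support in $\mathbb{B}^4$. *)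

theory Defs
  imports "HOL-Analysis.Analysis"
begin

definition partial_deriv :: "'n::finite \<Rightarrow> (real ^ 'n \<Rightarrow> real) \<Rightarrow> real ^ 'n \<Rightarrow> real" where
  "partial_deriv i f x = deriv (\<lambda>t. f (x + t *\<^sub>R axis i 1)) 0"

primrec C_k :: "nat \<Rightarrow> (real ^ 'n::finite \<Rightarrow> real) \<Rightarrow> bool" where
  "C_k 0 f \<longleftrightarrow> continuous_on UNIV f"
| "C_k (Suc k) f \<longleftrightarrow> continuous_on UNIV f \<and>
     (\<forall>i. (\<forall>x. (\<lambda>t. f (x + t *\<^sub>R axis i 1)) differentiable (at 0)) \<and> C_k k (partial_deriv i f))"

text \<open>
  A compactly supported smooth function on an open set \<open>U\<close> is identified with its
  extension by zero to the whole space, which is again smooth.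
\<close>

definition test_functions :: "(real ^ 'n::finite) set \<Rightarrow> (real ^ 'n \<Rightarrow> real) set" where
  "test_functions U =
     {u. (\<forall>k. C_k k u) \<and> compact (closure {x. u x \<noteq> 0}) \<and> closure {x. u x \<noteq> 0} \<subseteq> U}"

definition laplacian :: "(real ^ 'n::finite \<Rightarrow> real) \<Rightarrow> real ^ 'n \<Rightarrow> real" where
  "laplacian f x = (\<Sum>i\<in>UNIV. partial_deriv i (partial_deriv i f) x)"

abbreviation B4 :: "(real ^ 4) set" where
  "B4 \<equiv> ball 0 1"

definition hyperbolic_volume :: "(real ^ 4) measure" where
  "hyperbolic_volume =
     density (restrict_space lborel B4) (\<lambda>x. ennreal ((2 / (1 - (norm x)\<^sup>2)) ^ 4))"

end

theory Submission
  imports Defs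
begin

text \<open>
  Write \<open>\<phi> = 2 / (1 - |x|^2)\<close>, so that \<open>dV = \<phi>^4 dx\<close>, and let \<open>A\<close> be minus the
  Laplace--Beltrami operator of the Poincare ball. The functional on the left is the quadratic form of
  \<open>A (A - 2) - lam / 16\<close> in \<open>L^2(dV)\<close>, and
    \<open>A (A - 2) - lam / 16 = (A - 9/4)^2 + (5/2) (A - 2) - (1 + lam) / 16\<close>.
  The bottom of the spectrum of \<open>A - 2\<close> is \<open>1/4\<close>, so for \<open>lam < 9\<close> the last two terms dominate a small
  multiple \<open>del\<close> of the square \<open>h^2\<close> of an \<open>H^1\<close> norm of \<open>u\<close>. With \<open>f = (A - 9/4) u\<close> the hypothesis thus becomes
  \<open>\<parallel>f\<parallel>^2 + del * h^2 \<le> 1\<close>. The substitution \<open>w = \<phi> u\<close> turns \<open>A - 2\<close> into the Euclidean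
  Laplacian, \<open>(A - 2) u = - \<phi>^(-3) \<Delta> w\<close>, so that all of this is integration by parts for the compactly
  supported function \<open>w\<close> (\<open>energy_identity\<close>, \<open>energy_splitting\<close>).

  Since \<open>(A - 2) u = f + u / 4\<close>, the explicit Green function of the Laplacian of the ball gives
  \<open>|u| \<le> G |f| + G |u| / 4\<close> (\<open>newton_pointwise\<close>). The second term is at most a constant times \<open>h\<close>, uniformly in
  the point, by Hardy's inequality (\<open>lower_order_bound\<close>); the slack \<open>del * h^2\<close> pays for it.

  The sharp exponent comes from duality instead of rearrangement. For a set \<open>E\<close> of hyperbolic volume \<open>t\<close>, pairing
  \<open>|u|\<close> with the normalised indicator of \<open>E\<close> costs the \<open>L^2\<close> norm of its Green potential, that is, an average
  over \<open>E \<times> E\<close> of the kernel of \<open>G G\<close>. That kernel has the singularity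
  \<open>(1 / 8\<pi>^2) ln (1 / distance)\<close> (\<open>kern_composition\<close>), whose average is at most
  \<open>(1 / 32\<pi>^2) (ln (1 / t) + C)\<close> for \<open>t \<le> 1\<close>, whatever the shape of \<open>E\<close> (\<open>kern_composition_average\<close>). With \<open>E\<close> a level
  set this only yields the weak estimate \<open>|{|u| > s}| \<le> C exp (- 32\<pi>^2 s^2)\<close>, which misses the claim by a
  logarithmic divergence. Pairing with a combination of the indicators of two level sets (\<open>two_level_test\<close>) shows more:
  the levels \<open>n\<close> at which \<open>exp n * |{32\<pi>^2 u^2 > n}|\<close> is not small lie in a short window, because the square
  norm of \<open>f\<close> cannot be spent twice. This is the mechanism of Moser's one-dimensional inequality
  (\<open>moser_sum_bound\<close>), and it makes \<open>\<Sum>n. exp n * |{32\<pi>^2 u^2 > n}|\<close> bounded.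
\<close>

section \<open>Partial derivatives and integration by parts\<close>

text \<open>
  Derivative along a coordinate line only. Regularity in the theorem is expressed by partial derivatives, and
  integration by parts and the exchange of mixed derivatives need nothing stronger.
\<close>

definition has_pd :: "'n::finite \<Rightarrow> (real^'n \<Rightarrow> real) \<Rightarrow> real \<Rightarrow> real^'n \<Rightarrow> bool" where
  "has_pd i f D x \<longleftrightarrow> ((\<lambda>t. f (x + t *\<^sub>R axis i 1)) has_real_derivative D) (at 0)"

lemma has_pd_const: "has_pd i (\<lambda>x. c) 0 x"
  by (simp add: has_pd_def)

lemma has_pd_nth: "has_pd i (\<lambda>x. x $ j) (if i = j then 1 else 0) x"
  unfolding has_pd_def by (auto intro!: derivative_eq_intros simp: axis_def)

lemma has_pd_add: "has_pd i f a x \<Longrightarrow> has_pd i g b x \<Longrightarrow> has_pd i (\<lambda>x. f x + g x) (a + b) x"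
  unfolding has_pd_def by (rule DERIV_add)

lemma has_pd_diff: "has_pd i f a x \<Longrightarrow> has_pd i g b x \<Longrightarrow> has_pd i (\<lambda>x. f x - g x) (a - b) x"
  unfolding has_pd_def by (rule DERIV_diff)

lemma has_pd_minus: "has_pd i f a x \<Longrightarrow> has_pd i (\<lambda>x. - f x) (- a) x"
  unfolding has_pd_def by (rule DERIV_minus)

lemma has_pd_mult: "has_pd i f a x \<Longrightarrow> has_pd i g b x \<Longrightarrow> has_pd i (\<lambda>x. f x * g x) (a * g x + f x * b) x"
  unfolding has_pd_def by (drule (1) DERIV_mult') (simp add: algebra_simps)

lemma has_pd_power2: "has_pd i f a x \<Longrightarrow> has_pd i (\<lambda>x. (f x)\<^sup>2) (2 * a * f x) x"
  using has_pd_mult[of i f a x f a] by (simp add: power2_eq_square algebra_simps)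

lemma has_pd_sum: "(\<And>j. j \<in> A \<Longrightarrow> has_pd i (f j) (a j) x) \<Longrightarrow> has_pd i (\<lambda>x. \<Sum>j\<in>A. f j x) (\<Sum>j\<in>A. a j) x"
  unfolding has_pd_def by (rule DERIV_sum)

lemma has_pd_inverse: "has_pd i f a x \<Longrightarrow> f x \<noteq> 0 \<Longrightarrow> has_pd i (\<lambda>x. 1 / f x) (- a / (f x)\<^sup>2) x"
  unfolding has_pd_def
  by (auto intro!: derivative_eq_intros simp: power2_eq_square divide_simps)

lemma has_pd_cong: "has_pd i f a x \<Longrightarrow> (\<And>y. f y = g y) \<Longrightarrow> a = b \<Longrightarrow> has_pd i g b x"
  by (simp add: has_pd_def)

lemma has_pd_unique: "has_pd i f a x \<Longrightarrow> has_pd i f b x \<Longrightarrow> a = b"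
  unfolding has_pd_def by (rule DERIV_unique)

lemma has_pd_line:
  assumes "has_pd i f a (x + t *\<^sub>R axis i 1)"
  shows "((\<lambda>t. f (x + t *\<^sub>R axis i 1)) has_real_derivative a) (at t)"
proof -
  have "((\<lambda>s. f (x + (s + t) *\<^sub>R axis i 1)) has_real_derivative a) (at 0)"
    using assms unfolding has_pd_def by (simp add: scaleR_add_left algebra_simps)
  then show ?thesis using DERIV_shift[of "\<lambda>t. f (x + t *\<^sub>R axis i 1)" a 0 t] by simp
qed

lemma has_pd_transform:
  assumes "has_pd i f a x" "open S" "x \<in> S" "\<And>y. y \<in> S \<Longrightarrow> f y = g y"
  shows "has_pd i g a x"
proof -
  have "((\<lambda>t. x + t *\<^sub>R axis i 1) \<longlongrightarrow> x + 0 *\<^sub>R axis i 1) (at (0::real))"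
    by (intro tendsto_intros)
  then have "\<forall>\<^sub>F t in at (0::real). x + t *\<^sub>R axis i 1 \<in> S"
    using assms(2,3) by (simp add: topological_tendstoD)
  then have "\<forall>\<^sub>F t in nhds (0::real). x + t *\<^sub>R axis i 1 \<in> S"
    using assms(3) by (simp add: eventually_nhds_conv_at)
  then have "\<forall>\<^sub>F t in nhds (0::real). f (x + t *\<^sub>R axis i 1) = g (x + t *\<^sub>R axis i 1)"
    by eventually_elim (use assms(4) in auto)
  then show ?thesis using assms(1) unfolding has_pd_def by (subst (asm) DERIV_cong_ev) auto
qed

lemma has_pd_off_support:
  assumes "closed K" "\<And>y. y \<notin> K \<Longrightarrow> f y = 0" "x \<notin> K"
  shows "has_pd i f 0 x"
  by (rule has_pd_transform[where f="\<lambda>_. 0" and S="-K"]) (use assms in \<open>auto simp: has_pd_const\<close>)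

text \<open>
  The factor \<open>h\<close> may be singular outside \<open>U\<close>: off the support of \<open>w\<close> the product vanishes identically, whatever the
  values of \<open>h\<close> there. This is how the conformal factor and the image term of the Green function enter although they
  blow up on or outside the unit sphere.
\<close>

lemma has_pd_mult_support:
  assumes K: "closed K" "K \<subseteq> U" and w0: "\<And>y. y \<notin> K \<Longrightarrow> w y = 0"
    and w: "has_pd i w a x" and h: "x \<in> U \<Longrightarrow> has_pd i h b x"
  shows "has_pd i (\<lambda>x. w x * h x) (a * h x + w x * b) x"
proof (cases "x \<in> K")
  case True
  then show ?thesis using K by (intro has_pd_mult w h) auto
next
  case False
  have "a = 0" using has_pd_unique[OF w has_pd_off_support[OF K(1) w0 False]] by simp
  then show ?thesis using has_pd_off_support[OF K(1) _ False, of "\<lambda>x. w x * h x"] w0 False by auto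
qed

lemma continuous_mult_support:
  fixes w h :: "'a::topological_space \<Rightarrow> real"
  assumes K: "closed K" "K \<subseteq> U" "open U" and w0: "\<And>y. y \<notin> K \<Longrightarrow> w y = 0"
    and w: "continuous_on UNIV w" and h: "continuous_on U h"
  shows "continuous_on UNIV (\<lambda>x. w x * h x)"
proof -
  have "continuous_on U (\<lambda>x. w x * h x)"
    by (intro continuous_intros h continuous_on_subset[OF w]) auto
  moreover have "continuous_on (-K) (\<lambda>x. w x * h x)"
    by (rule continuous_on_eq[where f="\<lambda>_. 0"]) (auto simp: w0)
  ultimately have "continuous_on (U \<union> -K) (\<lambda>x. w x * h x)"
    using K by (intro continuous_on_open_Un) auto
  moreover have "U \<union> - K = UNIV" using K by auto
  ultimately show ?thesis by simp
qed

lemma integrable_compact_support: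
  fixes f :: "'a::euclidean_space \<Rightarrow> real"
  assumes "continuous_on UNIV f" "compact K" "\<And>y. y \<notin> K \<Longrightarrow> f y = 0"
  shows "integrable lborel f"
proof -
  have "integrable lborel (\<lambda>x. indicator K x *\<^sub>R f x)"
    using assms by (intro borel_integrable_compact) (auto intro: continuous_on_subset)
  also have "(\<lambda>x. indicator K x *\<^sub>R f x) = f"
    using assms(3) by (auto simp: fun_eq_iff split: split_indicator)
  finally show ?thesis .
qed

lemma integral_lborel_translate:
  fixes f :: "'a::euclidean_space \<Rightarrow> real"
  assumes [measurable]: "f \<in> borel_measurable borel"
  shows "(LINT x|lborel. f (x + c)) = (LINT x|lborel. f x)"
proof -
  have "(LINT x|lborel. f x) = (LINT x|distr lborel borel ((+) c). f x)"
    by (simp add: lborel_distr_plus)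
  also have "\<dots> = (LINT x|lborel. f (c + x))"
    by (subst integral_distr) auto
  finally show ?thesis by (simp add: add.commute)
qed

text \<open>
  The integral of the difference quotient vanishes by translation invariance, and the difference quotients converge
  boundedly on a fixed ball.
\<close>

lemma integral_partial_deriv_zero:
  fixes g g' :: "real^'n::finite \<Rightarrow> real"
  assumes g: "continuous_on UNIV g" and g': "continuous_on UNIV g'"
    and pd: "\<And>x. has_pd i g (g' x) x"
    and K: "compact K" and g0: "\<And>y. y \<notin> K \<Longrightarrow> g y = 0"
  shows "(LINT x|lborel. g' x) = 0"
proof -
  define e :: "real^'n" where "e = axis i 1"
  define s where "s n = inverse (real (Suc n))" for n
  have s: "0 < s n" "s n \<le> 1" for n by (auto simp: s_def field_simps)
  have [measurable]: "g \<in> borel_measurable borel" "g' \<in> borel_measurable borel"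
    using g g' by (auto intro: borel_measurable_continuous_onI)
  have g'0: "g' y = 0" if "y \<notin> K" for y
    using has_pd_unique[OF pd has_pd_off_support[OF compact_imp_closed[OF K] g0 that]] .
  obtain M where M: "\<And>x. \<bar>g' x\<bar> \<le> M" "0 \<le> M"
  proof -
    have "compact (g' ` K)"
      by (intro compact_continuous_image K continuous_on_subset[OF g']) auto
    then obtain B where "\<And>y. y \<in> g' ` K \<Longrightarrow> norm y \<le> B" "0 < B"
      using compact_imp_bounded bounded_pos by metis
    then have "\<bar>g' x\<bar> \<le> B" for x using g'0[of x] by (cases "x \<in> K") auto
    then show thesis using that \<open>0 < B\<close> by fastforce
  qed
  obtain r where r: "\<And>x. x \<in> K \<Longrightarrow> norm x \<le> r"
    using compact_imp_bounded[OF K] by (auto simp: bounded_iff)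
  have int: "integrable lborel g" by (rule integrable_compact_support[OF g K g0])
  have intT: "integrable lborel (\<lambda>x. g (x + c))" for c
  proof (rule integrable_compact_support[where K="(\<lambda>x. x - c) ` K"])
    show "continuous_on UNIV (\<lambda>x. g (x + c))"
      by (rule continuous_on_compose2[OF g]) (auto intro: continuous_intros)
    show "compact ((\<lambda>x. x - c) ` K)"
      by (intro compact_continuous_image K continuous_intros)
    show "g (y + c) = 0" if "y \<notin> (\<lambda>x. x - c) ` K" for y
      using that by (intro g0) (force simp: image_iff)
  qed
  define Q where "Q n x = (g (x + s n *\<^sub>R e) - g x) / s n" for n x
  have "(\<lambda>n. LINT x|lborel. Q n x) \<longlonglongrightarrow> (LINT x|lborel. g' x)"
  proof (rule integral_dominated_convergence[where w="\<lambda>x. indicator (cball 0 (r + 1)) x * M"])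
    show "integrable lborel (\<lambda>x::real^'n. indicator (cball 0 (r + 1)) x * M)"
      using emeasure_lborel_cball_finite[of "0::real^'n" "r + 1"]
      by (intro integrable_mult_left integrable_real_indicator) auto
    show "AE x in lborel. (\<lambda>n. Q n x) \<longlonglongrightarrow> g' x"
    proof (rule AE_I2)
      fix x
      have "((\<lambda>h. (g (x + h *\<^sub>R e) - g x) / h) \<longlongrightarrow> g' x) (at 0)"
        using pd[of x] unfolding has_pd_def DERIV_def e_def by simp
      moreover have "filterlim s (at 0) sequentially"
        using s(1) LIMSEQ_inverse_real_of_nat unfolding s_def[abs_def] filterlim_at
        by (auto simp: less_imp_neq[symmetric])
      ultimately show "(\<lambda>n. Q n x) \<longlonglongrightarrow> g' x"
        unfolding Q_def by (rule filterlim_compose)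
    qed
    show "AE x in lborel. norm (Q n x) \<le> indicator (cball 0 (r + 1)) x * M" for n
    proof (rule AE_I2)
      fix x
      show "norm (Q n x) \<le> indicator (cball 0 (r + 1)) x * M"
      proof (cases "x \<in> cball 0 (r + 1)")
        case True
        have "\<exists>z. 0 < z \<and> z < s n \<and> g (x + s n *\<^sub>R e) - g (x + 0 *\<^sub>R e) = (s n - 0) * g' (x + z *\<^sub>R e)"
          unfolding e_def by (rule MVT2) (use s in \<open>auto intro!: has_pd_line pd\<close>)
        then obtain z where "g (x + s n *\<^sub>R e) - g x = s n * g' (x + z *\<^sub>R e)" by auto
        then show ?thesis using M True s(1)[of n] by (simp add: Q_def)
      next
        case False
        have "norm x \<le> norm (x + s n *\<^sub>R e) + norm (s n *\<^sub>R e)"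
          by (metis add_diff_cancel_right' norm_triangle_ineq4)
        also have "norm (s n *\<^sub>R e) \<le> 1"
          using s[of n] by (simp add: e_def norm_axis_1)
        finally have "x + s n *\<^sub>R e \<notin> K" "x \<notin> K"
          using False r[of "x + s n *\<^sub>R e"] r[of x] by auto
        then show ?thesis using False by (simp add: Q_def g0)
      qed
    qed
  qed (auto simp: Q_def)
  moreover have "(LINT x|lborel. Q n x) = 0" for n
    unfolding Q_def using int intT integral_lborel_translate[of g "s n *\<^sub>R e"] by simp
  ultimately show ?thesis by (simp add: LIMSEQ_const_iff)
qed

text \<open>
  The second difference of \<open>f\<close> over a small square equals, by two applications of the mean value theorem in either
  order, a value of either mixed derivative near \<open>x\<close>.
\<close>

lemma has_pd_commute:
  fixes f :: "real^'n::finite \<Rightarrow> real"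
  assumes i: "\<And>x. has_pd i f (fi x) x" and j: "\<And>x. has_pd j f (fj x) x"
    and ij: "\<And>x. has_pd j fi (fij x) x" and ji: "\<And>x. has_pd i fj (fji x) x"
    and c: "continuous_on UNIV fij" "continuous_on UNIV fji"
  shows "fij x = fji x"
proof -
  have mixed: "\<exists>s t. 0 < s \<and> s < h \<and> 0 < t \<and> t < h \<and>
      f (x + h *\<^sub>R axis i 1 + h *\<^sub>R axis j 1) - f (x + h *\<^sub>R axis j 1) - f (x + h *\<^sub>R axis i 1) + f x
        = h * h * fij (x + s *\<^sub>R axis i 1 + t *\<^sub>R axis j 1)"
    if h: "0 < h" and i: "\<And>x. has_pd i f (fi x) x" and ij: "\<And>x. has_pd j fi (fij x) x"
    for h i j fi fij
  proof -
    define G where "G s = f (x + h *\<^sub>R axis j 1 + s *\<^sub>R axis i 1) - f (x + s *\<^sub>R axis i 1)" for s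
    have "\<exists>s. 0 < s \<and> s < h \<and> G h - G 0 = (h - 0) * (fi (x + h *\<^sub>R axis j 1 + s *\<^sub>R axis i 1) - fi (x + s *\<^sub>R axis i 1))"
      unfolding G_def by (rule MVT2) (use h in \<open>auto intro!: DERIV_diff has_pd_line i\<close>)
    then obtain s where s: "0 < s" "s < h"
      and G: "G h - G 0 = h * (fi (x + h *\<^sub>R axis j 1 + s *\<^sub>R axis i 1) - fi (x + s *\<^sub>R axis i 1))" by auto
    have "\<exists>t. 0 < t \<and> t < h \<and> fi ((x + s *\<^sub>R axis i 1) + h *\<^sub>R axis j 1) - fi ((x + s *\<^sub>R axis i 1) + 0 *\<^sub>R axis j 1)
        = (h - 0) * fij ((x + s *\<^sub>R axis i 1) + t *\<^sub>R axis j 1)"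
      by (rule MVT2) (use h in \<open>auto intro!: has_pd_line ij\<close>)
    then obtain t where t: "0 < t" "t < h"
      and F: "fi ((x + s *\<^sub>R axis i 1) + h *\<^sub>R axis j 1) - fi (x + s *\<^sub>R axis i 1)
        = h * fij (x + s *\<^sub>R axis i 1 + t *\<^sub>R axis j 1)" by auto
    have "f (x + h *\<^sub>R axis i 1 + h *\<^sub>R axis j 1) - f (x + h *\<^sub>R axis j 1) - f (x + h *\<^sub>R axis i 1) + f x = G h - G 0"
      by (simp add: G_def algebra_simps)
    also have "\<dots> = h * h * fij (x + s *\<^sub>R axis i 1 + t *\<^sub>R axis j 1)"
      unfolding G using F by (simp add: algebra_simps)
    finally show ?thesis using s t by blast
  qed
  define h where "h n = inverse (real (Suc n))" for n
  have h: "0 < h n" for n by (simp add: h_def)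
  have hlim: "h \<longlonglongrightarrow> 0" unfolding h_def[abs_def] by (rule LIMSEQ_inverse_real_of_nat)
  from mixed[OF h i ij] obtain s t where st: "\<And>n. 0 < s n \<and> s n < h n \<and> 0 < t n \<and> t n < h n \<and>
      f (x + h n *\<^sub>R axis i 1 + h n *\<^sub>R axis j 1) - f (x + h n *\<^sub>R axis j 1) - f (x + h n *\<^sub>R axis i 1) + f x
        = h n * h n * fij (x + s n *\<^sub>R axis i 1 + t n *\<^sub>R axis j 1)" by metis
  from mixed[OF h j ji] obtain s' t' where st': "\<And>n. 0 < s' n \<and> s' n < h n \<and> 0 < t' n \<and> t' n < h n \<and>
      f (x + h n *\<^sub>R axis j 1 + h n *\<^sub>R axis i 1) - f (x + h n *\<^sub>R axis i 1) - f (x + h n *\<^sub>R axis j 1) + f x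
        = h n * h n * fji (x + s' n *\<^sub>R axis j 1 + t' n *\<^sub>R axis i 1)" by metis
  have eq: "fij (x + s n *\<^sub>R axis i 1 + t n *\<^sub>R axis j 1) = fji (x + s' n *\<^sub>R axis j 1 + t' n *\<^sub>R axis i 1)" for n
  proof -
    have "h n * h n * fij (x + s n *\<^sub>R axis i 1 + t n *\<^sub>R axis j 1)
        = h n * h n * fji (x + s' n *\<^sub>R axis j 1 + t' n *\<^sub>R axis i 1)"
      using st[of n] st'[of n] by (simp add: algebra_simps)
    then show ?thesis using h[of n] by simp
  qed
  have lim: "(\<lambda>n. F (x + a n *\<^sub>R p + b n *\<^sub>R q)) \<longlonglongrightarrow> F x"
    if "continuous_on UNIV F" "\<And>n. 0 < a n \<and> a n < h n" "\<And>n. 0 < b n \<and> b n < h n" for F :: "real^'n \<Rightarrow> real" and a b p q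
  proof -
    have "a \<longlonglongrightarrow> 0" "b \<longlonglongrightarrow> 0"
      using that(2,3) less_imp_le by (auto intro!: tendsto_sandwich[OF _ _ tendsto_const hlim] always_eventually)
    then have "(\<lambda>n. x + a n *\<^sub>R p + b n *\<^sub>R q) \<longlonglongrightarrow> x + 0 *\<^sub>R p + 0 *\<^sub>R q"
      by (intro tendsto_intros)
    then show ?thesis using that(1) by (intro isCont_tendsto_compose[of x F]) (auto simp: continuous_on_eq_continuous_at)
  qed
  have "(\<lambda>n. fij (x + s n *\<^sub>R axis i 1 + t n *\<^sub>R axis j 1)) \<longlonglongrightarrow> fij x"
    using st by (intro lim c) auto
  moreover have "(\<lambda>n. fij (x + s n *\<^sub>R axis i 1 + t n *\<^sub>R axis j 1)) \<longlonglongrightarrow> fji x"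
    unfolding eq using st' by (intro lim c) auto
  ultimately show ?thesis by (rule LIMSEQ_unique)
qed

section \<open>Radial integrals in dimension four\<close>

text \<open>
  Polar coordinates without surface measure: both measures give the volume \<open>\<pi>^2 a^4 / 2\<close> of a ball to \<open>{..a}\<close>.
\<close>

lemma distr_norm_lborel4:
  "distr lborel borel (norm :: real^4 \<Rightarrow> real)
     = density lborel (\<lambda>r. ennreal (2 * pi\<^sup>2 * r ^ 3) * indicator {0..} r)" (is "?M = ?N")
proof (rule measure_eqI_generator_eq[where E="range atMost" and \<Omega>=UNIV and A="\<lambda>i. {..real i}"])
  show "Int_stable (range (atMost :: real \<Rightarrow> _))"
    by (auto simp: Int_stable_def)
  have M: "emeasure ?M {..a} = (if a < 0 then 0 else ennreal (pi\<^sup>2 / 2 * a ^ 4))" for a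
  proof -
    have "emeasure ?M {..a} = emeasure lborel (cball (0::real^4) a)"
      by (subst emeasure_distr) (auto simp: vimage_def cball_def intro!: arg_cong2[where f=emeasure])
    also have "\<dots> = (if a < 0 then 0 else ennreal (pi\<^sup>2 / 2 * a ^ 4))"
      by (auto simp: emeasure_cball unit_ball_vol_4)
    finally show ?thesis .
  qed
  have N: "emeasure ?N {..a} = (if a < 0 then 0 else ennreal (pi\<^sup>2 / 2 * a ^ 4))" for a
  proof -
    have "emeasure ?N {..a} = (\<integral>\<^sup>+r. ennreal (2 * pi\<^sup>2 * r ^ 3) * indicator {0..a} r \<partial>lborel)"
      by (subst emeasure_density) (auto intro!: nn_integral_cong split: split_indicator)
    also have "\<dots> = (if a < 0 then 0 else ennreal (pi\<^sup>2 / 2 * a ^ 4))"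
    proof (cases "a < 0")
      case True then show ?thesis by simp
    next
      case False
      have "(\<integral>\<^sup>+r. ennreal (2 * pi\<^sup>2 * r ^ 3) * indicator {0..a} r \<partial>lborel)
         = ennreal (pi\<^sup>2 / 2 * a ^ 4 - pi\<^sup>2 / 2 * 0 ^ 4)"
        using False by (intro nn_integral_FTC_Icc) (auto intro!: derivative_eq_intros)
      then show ?thesis using False by simp
    qed
    finally show ?thesis .
  qed
  show "emeasure ?M X = emeasure ?N X" if "X \<in> range atMost" for X
    using that M N by auto
  show "sets ?M = sigma_sets UNIV (range atMost)"
    by (simp add: borel_eq_atMost)
  show "sets ?N = sigma_sets UNIV (range atMost)"
    by (simp add: borel_eq_atMost)
  show "(\<Union>i. {..real i}) = UNIV"
    by (auto intro: real_arch_simple)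
  show "emeasure ?M {..real i} \<noteq> \<infinity>" for i
    by (simp add: M)
qed auto

lemma nn_integral_radial:
  assumes [measurable]: "f \<in> borel_measurable borel"
  shows "(\<integral>\<^sup>+z. f (norm (z - (x::real^4))) \<partial>lborel)
     = (\<integral>\<^sup>+r. ennreal (2 * pi\<^sup>2 * r ^ 3) * indicator {0..} r * f r \<partial>lborel)"
proof -
  have "(\<integral>\<^sup>+z. f (norm (z - x)) \<partial>lborel) = (\<integral>\<^sup>+z. f (norm (z - x)) \<partial>(distr lborel borel ((+) x)))"
    by (simp add: lborel_distr_plus)
  also have "\<dots> = (\<integral>\<^sup>+z. f (norm z) \<partial>(lborel :: (real^4) measure))"
    by (subst nn_integral_distr) auto
  also have "\<dots> = (\<integral>\<^sup>+r. f r \<partial>distr lborel borel (norm :: real^4 \<Rightarrow> real))"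
    by (subst nn_integral_distr) auto
  also have "\<dots> = (\<integral>\<^sup>+r. ennreal (2 * pi\<^sup>2 * r ^ 3) * indicator {0..} r * f r \<partial>lborel)"
    by (simp add: distr_norm_lborel4 nn_integral_density)
  finally show ?thesis .
qed

lemma nn_integral_radial_Icc:
  fixes x :: "real^4"
  assumes [measurable]: "g \<in> borel_measurable borel" and "0 \<le> a" "a \<le> b"
    and F: "\<And>r. a \<le> r \<Longrightarrow> r \<le> b \<Longrightarrow> (F has_real_derivative 2 * pi\<^sup>2 * r ^ 3 * g r) (at r)"
    and g: "\<And>r. a \<le> r \<Longrightarrow> r \<le> b \<Longrightarrow> 0 \<le> g r"
  shows "(\<integral>\<^sup>+z. ennreal (g (norm (z - x))) * indicator {z. a \<le> norm (z - x) \<and> norm (z - x) \<le> b} z \<partial>lborel)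
     = ennreal (F b - F a)"
proof -
  have "(\<integral>\<^sup>+z. ennreal (g (norm (z - x))) * indicator {z. a \<le> norm (z - x) \<and> norm (z - x) \<le> b} z \<partial>lborel)
     = (\<integral>\<^sup>+z. (\<lambda>r. ennreal (g r) * indicator {a..b} r) (norm (z - x)) \<partial>lborel)"
    by (auto intro!: nn_integral_cong split: split_indicator)
  also have "\<dots> = (\<integral>\<^sup>+r. ennreal (2 * pi\<^sup>2 * r ^ 3) * indicator {0..} r * (ennreal (g r) * indicator {a..b} r) \<partial>lborel)"
    by (rule nn_integral_radial) measurable
  also have "\<dots> = (\<integral>\<^sup>+r. ennreal (2 * pi\<^sup>2 * r ^ 3 * g r) * indicator {a..b} r \<partial>lborel)"
    using assms(2) g by (auto intro!: nn_integral_cong split: split_indicator simp: ennreal_mult'')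
  also have "\<dots> = ennreal (F b - F a)"
    using assms(2,3) by (intro nn_integral_FTC_Icc F) (auto simp: g)
  finally show ?thesis .
qed

lemma nn_integral_radial_atLeast:
  fixes x :: "real^4"
  assumes [measurable]: "g \<in> borel_measurable borel" and "0 \<le> a"
    and F: "\<And>r. a \<le> r \<Longrightarrow> (F has_real_derivative 2 * pi\<^sup>2 * r ^ 3 * g r) (at r)"
    and g: "\<And>r. a \<le> r \<Longrightarrow> 0 \<le> g r" and lim: "(F \<longlongrightarrow> T) at_top"
  shows "(\<integral>\<^sup>+z. ennreal (g (norm (z - x))) * indicator {z. a \<le> norm (z - x)} z \<partial>lborel)
     = ennreal (T - F a)"
proof -
  have "(\<integral>\<^sup>+z. ennreal (g (norm (z - x))) * indicator {z. a \<le> norm (z - x)} z \<partial>lborel)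
     = (\<integral>\<^sup>+z. (\<lambda>r. ennreal (g r) * indicator {a..} r) (norm (z - x)) \<partial>lborel)"
    by (auto intro!: nn_integral_cong split: split_indicator)
  also have "\<dots> = (\<integral>\<^sup>+r. ennreal (2 * pi\<^sup>2 * r ^ 3) * indicator {0..} r * (ennreal (g r) * indicator {a..} r) \<partial>lborel)"
    by (rule nn_integral_radial) measurable
  also have "\<dots> = (\<integral>\<^sup>+r. ennreal (2 * pi\<^sup>2 * r ^ 3 * g r) * indicator {a..} r \<partial>lborel)"
    using assms(2) g by (auto intro!: nn_integral_cong split: split_indicator simp: ennreal_mult'')
  also have "\<dots> = ennreal (T - F a)"
    using assms(2) by (intro nn_integral_FTC_atLeast F lim) (auto simp: g)
  finally show ?thesis .
qed

section \<open>The energy of a conformally transformed function\<close>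

lemma norm_sq_nth: "(norm (x :: real^'n::finite))\<^sup>2 = (\<Sum>j\<in>UNIV. (x $ j)\<^sup>2)"
  by (simp add: norm_vec_def L2_set_def sum_nonneg)

lemma has_pd_norm_sq: "has_pd i (\<lambda>x. (norm (x - a))\<^sup>2) (2 * (x $ i - a $ i)) (x :: real^'n::finite)"
proof -
  have "has_pd i (\<lambda>x. \<Sum>j\<in>UNIV. (x $ j - a $ j)\<^sup>2)
      (\<Sum>j\<in>UNIV. 2 * ((if i = j then 1 else 0) - 0) * (x $ j - a $ j)) x"
    by (intro has_pd_sum has_pd_power2 has_pd_diff has_pd_nth has_pd_const)
  moreover have "(\<Sum>j\<in>UNIV. 2 * ((if i = j then 1 else 0) - 0) * (x $ j - a $ j)) = 2 * (x $ i - a $ i)"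
    by (simp add: if_distrib if_distribR sum.delta cong: if_cong)
  ultimately show ?thesis by (simp add: norm_sq_nth)
qed

text \<open>
  A compactly supported \<open>C^2\<close> function on the unit ball with its first and second partial derivatives. It is
  instantiated with \<open>w = \<phi> u\<close>, so that \<open>q w = u\<close> for \<open>q = 1 / \<phi>\<close>.
\<close>

locale ball_C2 =
  fixes w :: "real^4 \<Rightarrow> real" and d :: "4 \<Rightarrow> real^4 \<Rightarrow> real" and d2 :: "4 \<Rightarrow> 4 \<Rightarrow> real^4 \<Rightarrow> real"
    and K :: "(real^4) set"
  assumes K: "compact K" "K \<subseteq> ball 0 1"
    and w_cont: "continuous_on UNIV w" and d_cont: "continuous_on UNIV (d i)"
    and d2_cont: "continuous_on UNIV (d2 i j)"
    and w_pd: "has_pd i w (d i x) x" and d_pd: "has_pd j (d i) (d2 i j x) x"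
    and sym: "d2 i j x = d2 j i x"
    and w_off: "x \<notin> K \<Longrightarrow> w x = 0"
begin

lemma K_closed: "closed K" using K(1) by (rule compact_imp_closed)

lemma d_off: "x \<notin> K \<Longrightarrow> d i x = 0"
  by (rule has_pd_unique[OF w_pd has_pd_off_support[OF K_closed w_off]])

lemma d2_off: "x \<notin> K \<Longrightarrow> d2 i j x = 0"
  by (rule has_pd_unique[OF d_pd has_pd_off_support[OF K_closed d_off]])

definition lap :: "real^4 \<Rightarrow> real" where "lap x = (\<Sum>i\<in>UNIV. d2 i i x)"

definition grad2 :: "real^4 \<Rightarrow> real" where "grad2 x = (\<Sum>i\<in>UNIV. (d i x)\<^sup>2)"

lemma lap_cont: "continuous_on UNIV lap"
  unfolding lap_def[abs_def] by (intro continuous_intros d2_cont)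

lemma grad2_cont: "continuous_on UNIV grad2"
  unfolding grad2_def[abs_def] by (intro continuous_intros d_cont)

lemma lap_off: "x \<notin> K \<Longrightarrow> lap x = 0" by (simp add: lap_def d2_off)

lemma grad2_off: "x \<notin> K \<Longrightarrow> grad2 x = 0" by (simp add: grad2_def d_off)

text \<open>
  The divergence theorem for a compactly supported vector field; integration by parts enters below only through
  this vanishing of fluxes.
\<close>

lemma flux:
  assumes "\<And>i x. has_pd i (W i) (W' i x) x" "\<And>i. continuous_on UNIV (W i)"
    "\<And>i. continuous_on UNIV (W' i)" "\<And>i x. x \<notin> K \<Longrightarrow> W i x = 0"
  shows "integrable lborel (\<lambda>x. \<Sum>i\<in>UNIV. W' i x)" "(LINT x|lborel. (\<Sum>i\<in>UNIV. W' i x)) = 0"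
proof -
  have off: "W' i x = 0" if "x \<notin> K" for i x
    by (rule has_pd_unique[OF assms(1) has_pd_off_support[OF K_closed assms(4) that]])
  have int: "integrable lborel (W' i)" for i
    using assms(3) K(1) off by (rule integrable_compact_support)
  then show "integrable lborel (\<lambda>x. \<Sum>i\<in>UNIV. W' i x)" by simp
  show "(LINT x|lborel. (\<Sum>i\<in>UNIV. W' i x)) = 0"
    using integral_partial_deriv_zero[OF assms(2,3,1) K(1) assms(4)] int by simp
qed

text \<open>
  Hardy inequalities in general: expand \<open>0 \<le> |\<nabla>w + w X|^2\<close> and integrate the cross term by parts. The right choice
  of the field \<open>X\<close> gives each concrete inequality.
\<close>

lemma vector_field_ineq:
  assumes U: "open U" "K \<subseteq> U" and X: "\<And>i. continuous_on U (X i)" "\<And>i. continuous_on U (X' i)"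
    and pd: "\<And>i x. x \<in> U \<Longrightarrow> has_pd i (X i) (X' i x) x"
  shows "integrable lborel (\<lambda>x. (w x)\<^sup>2 * (\<Sum>i\<in>UNIV. X' i x - (X i x)\<^sup>2))"
    and "(LINT x|lborel. (w x)\<^sup>2 * (\<Sum>i\<in>UNIV. X' i x - (X i x)\<^sup>2)) \<le> (LINT x|lborel. grad2 x)"
proof -
  let ?W' = "\<lambda>i x. (2 * d i x * w x) * X i x + (w x)\<^sup>2 * X' i x"
  let ?V = "\<lambda>x. (w x)\<^sup>2 * (\<Sum>i\<in>UNIV. X' i x - (X i x)\<^sup>2)"
  note cm = continuous_mult_support[OF K_closed U(2,1)]
  have "has_pd i (\<lambda>x. (w x)\<^sup>2 * X i x) (?W' i x) x" for i x
    by (rule has_pd_mult_support[OF K_closed U(2)]) (auto simp: w_off intro!: has_pd_power2 w_pd pd)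
  moreover have "continuous_on UNIV (\<lambda>x. (w x)\<^sup>2 * X i x)" for i
    by (rule cm) (auto simp: w_off intro!: continuous_intros w_cont X)
  moreover have "continuous_on UNIV (?W' i)" for i
    by (intro continuous_on_add; rule cm) (auto simp: w_off intro!: continuous_intros w_cont d_cont X)
  ultimately have fl: "integrable lborel (\<lambda>x. \<Sum>i\<in>UNIV. ?W' i x)"
      "(LINT x|lborel. (\<Sum>i\<in>UNIV. ?W' i x)) = 0"
    by (rule flux; simp add: w_off)+
  have "continuous_on UNIV ?V"
    by (rule cm) (auto simp: w_off intro!: continuous_intros w_cont X)
  then show iV: "integrable lborel ?V"
    by (rule integrable_compact_support[OF _ K(1)]) (simp add: w_off)
  have ig: "integrable lborel grad2" by (rule integrable_compact_support[OF grad2_cont K(1) grad2_off])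
  have eq: "(\<Sum>i\<in>UNIV. (d i x + X i x * w x)\<^sup>2) = grad2 x + (\<Sum>i\<in>UNIV. ?W' i x) - ?V x" for x
    unfolding grad2_def sum_distrib_left sum.distrib[symmetric] sum_subtractf[symmetric]
    by (intro sum.cong) (auto simp: power2_eq_square algebra_simps)
  have "0 \<le> (LINT x|lborel. (\<Sum>i\<in>UNIV. (d i x + X i x * w x)\<^sup>2))"
    by (intro integral_nonneg_AE AE_I2 sum_nonneg) auto
  also have "\<dots> = (LINT x|lborel. grad2 x) + 0 - (LINT x|lborel. ?V x)"
    unfolding eq using ig iV fl by simp
  finally show "(LINT x|lborel. ?V x) \<le> (LINT x|lborel. grad2 x)" by simp
qed

lemma ball_pos: "x \<in> ball (0::real^4) 1 \<Longrightarrow> 0 < 1 - (norm x)\<^sup>2"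
  by (simp add: power_less_one_iff abs_square_less_1)

text \<open>
  With \<open>X = x / (1 - |x|^2)\<close>. This is the spectral bound \<open>A - 2 \<ge> 1/4\<close>, hence the source of the number 9.
\<close>

lemma hardy_boundary: "(LINT x|lborel. (w x)\<^sup>2 / (1 - (norm x)\<^sup>2)\<^sup>2) \<le> (LINT x|lborel. grad2 x)"
proof -
  let ?N = "\<lambda>x::real^4. 1 - (norm x)\<^sup>2"
  let ?X = "\<lambda>i (x::real^4). x $ i * (1 / ?N x)"
  let ?X' = "\<lambda>i (x::real^4). 1 / ?N x + 2 * (x $ i)\<^sup>2 / (?N x)\<^sup>2"
  have N: "?N x \<noteq> 0" if "x \<in> ball 0 1" for x using ball_pos[OF that] by auto
  have pN: "has_pd i ?N (- 2 * x $ i) x" for i x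
    using has_pd_diff[OF has_pd_const has_pd_norm_sq[of i 0 x], of 1] by simp
  have c: "continuous_on (ball 0 1) (?X i)" "continuous_on (ball 0 1) (?X' i)" for i
    using N by (auto intro!: continuous_intros)
  have pd: "has_pd i (?X i) (?X' i x) x" if "x \<in> ball 0 1" for i x
  proof -
    have eq: "1 * (1 / n) + s * (- (- 2 * s) / n\<^sup>2) = 1 / n + 2 * s\<^sup>2 / n\<^sup>2" for s n :: real
      by (simp add: power2_eq_square)
    have "has_pd i (?X i) (1 * (1 / ?N x) + x $ i * (- (- 2 * x $ i) / (?N x)\<^sup>2)) x"
      using has_pd_mult[OF has_pd_nth[of i i x] has_pd_inverse[OF pN N[OF that], of i]] by simp
    then show ?thesis unfolding eq .
  qed
  note vf = vector_field_ineq[OF open_ball K(2) c pd]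
  have "(LINT x|lborel. (w x)\<^sup>2 / (?N x)\<^sup>2) \<le> (LINT x|lborel. (w x)\<^sup>2 * (\<Sum>i\<in>UNIV. ?X' i x - (?X i x)\<^sup>2))"
  proof (rule integral_mono[OF _ vf(1)])
    have "continuous_on UNIV (\<lambda>x. (w x)\<^sup>2 * (1 / (?N x)\<^sup>2))"
      using N by (intro continuous_mult_support[OF K_closed K(2) open_ball])
        (auto simp: w_off intro!: continuous_intros w_cont)
    then show "integrable lborel (\<lambda>x. (w x)\<^sup>2 / (?N x)\<^sup>2)"
      by (intro integrable_compact_support[OF _ K(1)]) (auto simp: w_off)
    fix x :: "real^4"
    show "(w x)\<^sup>2 / (?N x)\<^sup>2 \<le> (w x)\<^sup>2 * (\<Sum>i\<in>UNIV. ?X' i x - (?X i x)\<^sup>2)"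
    proof (cases "x \<in> K")
      case True
      then have x: "x \<in> ball 0 1" using K by auto
      have frac: "4 / n + s / n\<^sup>2 = (4 * n + s) / n\<^sup>2" if "n \<noteq> 0" for n s :: real
        using that by (simp add: field_simps power2_eq_square)
      have "(\<Sum>i\<in>UNIV. ?X' i x - (?X i x)\<^sup>2) = (\<Sum>i\<in>(UNIV::4 set). 1 / ?N x + (x $ i)\<^sup>2 / (?N x)\<^sup>2)"
        by (intro sum.cong) (auto simp: power_mult_distrib power_divide)
      also have "\<dots> = 4 / ?N x + (norm x)\<^sup>2 / (?N x)\<^sup>2"
        by (simp add: sum.distrib norm_sq_nth sum_divide_distrib)
      also have "\<dots> = (4 * ?N x + (norm x)\<^sup>2) / (?N x)\<^sup>2"
        using frac[OF N[OF x]] .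
      also have "\<dots> \<ge> 1 / (?N x)\<^sup>2"
        using ball_pos[OF x] by (intro divide_right_mono) auto
      finally have "1 / (?N x)\<^sup>2 \<le> (\<Sum>i\<in>UNIV. ?X' i x - (?X i x)\<^sup>2)" .
      then have "(w x)\<^sup>2 * (1 / (?N x)\<^sup>2) \<le> (w x)\<^sup>2 * (\<Sum>i\<in>UNIV. ?X' i x - (?X i x)\<^sup>2)"
        by (intro mult_left_mono) auto
      then show ?thesis by simp
    qed (simp add: w_off)
  qed
  with vf(2) show ?thesis by simp
qed

text \<open>
  With \<open>X = (x - a) / (|x - a|^2 + e)\<close>. The parameter \<open>e\<close> keeps the field smooth.
\<close>

lemma hardy_point:
  assumes e: "0 < e"
  shows "(LINT x|lborel. (w x)\<^sup>2 / ((norm (x - a))\<^sup>2 + e)) \<le> (LINT x|lborel. grad2 x)"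
proof -
  let ?N = "\<lambda>x::real^4. (norm (x - a))\<^sup>2 + e"
  let ?X = "\<lambda>i (x::real^4). (x $ i - a $ i) * (1 / ?N x)"
  let ?X' = "\<lambda>i (x::real^4). 1 / ?N x - 2 * (x $ i - a $ i)\<^sup>2 / (?N x)\<^sup>2"
  have Np: "0 < ?N x" for x using e by (simp add: add_nonneg_pos)
  have N: "?N x \<noteq> 0" for x using Np[of x] by linarith
  have pN: "has_pd i ?N (2 * (x $ i - a $ i)) x" for i x
    using has_pd_add[OF has_pd_norm_sq[of i a x] has_pd_const, of e] by simp
  have c: "continuous_on UNIV (?X i)" "continuous_on UNIV (?X' i)" for i
    using N by (auto intro!: continuous_intros)
  have pd: "has_pd i (?X i) (?X' i x) x" for i x
  proof -
    have eq: "1 * (1 / n) + s * (- (2 * s) / n\<^sup>2) = 1 / n - 2 * s\<^sup>2 / n\<^sup>2" for s n :: real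
      by (simp add: power2_eq_square)
    have "has_pd i (?X i) (1 * (1 / ?N x) + (x $ i - a $ i) * (- (2 * (x $ i - a $ i)) / (?N x)\<^sup>2)) x"
      using has_pd_mult[OF has_pd_diff[OF has_pd_nth[of i i x] has_pd_const] has_pd_inverse[OF pN N, of i]] by simp
    then show ?thesis unfolding eq .
  qed
  note vf = vector_field_ineq[OF open_UNIV subset_UNIV c pd]
  have "(LINT x|lborel. (w x)\<^sup>2 / ?N x) \<le> (LINT x|lborel. (w x)\<^sup>2 * (\<Sum>i\<in>UNIV. ?X' i x - (?X i x)\<^sup>2))"
  proof (rule integral_mono[OF _ vf(1)])
    have "continuous_on UNIV (\<lambda>x. (w x)\<^sup>2 / ?N x)"
      using N by (auto intro!: continuous_intros w_cont)
    then show "integrable lborel (\<lambda>x. (w x)\<^sup>2 / ?N x)"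
      by (intro integrable_compact_support[OF _ K(1)]) (auto simp: w_off)
    fix x :: "real^4"
    have "(\<Sum>i\<in>UNIV. ?X' i x - (?X i x)\<^sup>2) = (\<Sum>i\<in>(UNIV::4 set). 1 / ?N x - 3 * (((x-a) $ i)\<^sup>2 / (?N x)\<^sup>2))"
      by (intro sum.cong) (auto simp: power_mult_distrib power_divide)
    also have "\<dots> = 4 / ?N x - 3 * ((norm (x - a))\<^sup>2 / (?N x)\<^sup>2)"
      by (simp add: sum_subtractf norm_sq_nth sum_divide_distrib sum_distrib_left)
    also have "\<dots> = (?N x + 3 * e) / (?N x)\<^sup>2"
      using N[of x] by (simp add: divide_simps) (simp add: algebra_simps power2_eq_square)
    also have "\<dots> \<ge> ?N x / (?N x)\<^sup>2"
      using e by (intro divide_right_mono) auto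
    finally have "1 / ?N x \<le> (\<Sum>i\<in>UNIV. ?X' i x - (?X i x)\<^sup>2)"
      using N[of x] by (simp add: power2_eq_square)
    then have "(w x)\<^sup>2 * (1 / ?N x) \<le> (w x)\<^sup>2 * (\<Sum>i\<in>UNIV. ?X' i x - (?X i x)\<^sup>2)"
      by (intro mult_left_mono) auto
    then show "(w x)\<^sup>2 / ?N x \<le> (w x)\<^sup>2 * (\<Sum>i\<in>UNIV. ?X' i x - (?X i x)\<^sup>2)" by simp
  qed
  with vf(2) show ?thesis by simp
qed

lemma green:
  assumes U: "open U" "K \<subseteq> U" and h: "continuous_on U h" "\<And>i. continuous_on U (h1 i)" "\<And>i. continuous_on U (h2 i)"
    and pd: "\<And>i x. x \<in> U \<Longrightarrow> has_pd i h (h1 i x) x" "\<And>i x. x \<in> U \<Longrightarrow> has_pd i (h1 i) (h2 i x) x"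
  shows "(LINT x|lborel. lap x * h x) = (LINT x|lborel. w x * (\<Sum>i\<in>UNIV. h2 i x))"
proof -
  let ?W' = "\<lambda>i x. (d2 i i x * h x + d i x * h1 i x) - (d i x * h1 i x + w x * h2 i x)"
  note cm = continuous_mult_support[OF K_closed U(2,1)]
  have fl: "(LINT x|lborel. (\<Sum>i\<in>UNIV. ?W' i x)) = 0"
  proof (rule flux[where W="\<lambda>i x. d i x * h x - w x * h1 i x" and W'="?W'"])
    show "has_pd i (\<lambda>x. d i x * h x - w x * h1 i x) (?W' i x) x" for i x
      by (intro has_pd_diff has_pd_mult_support[OF K_closed U(2)]) (auto simp: w_off d_off intro!: d_pd w_pd pd)
    show "continuous_on UNIV (\<lambda>x. d i x * h x - w x * h1 i x)" for i
      by (intro continuous_on_diff cm) (auto simp: w_off d_off intro!: w_cont d_cont h)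
    show "continuous_on UNIV (?W' i)" for i
      by (intro continuous_on_diff continuous_on_add cm) (auto simp: w_off d_off d2_off intro!: w_cont d_cont d2_cont h)
  qed (auto simp: w_off d_off)
  have "integrable lborel (\<lambda>x. lap x * h x)"
    by (rule integrable_compact_support[OF _ K(1)], rule cm) (auto simp: lap_off intro!: lap_cont h)
  moreover have "integrable lborel (\<lambda>x. w x * (\<Sum>i\<in>UNIV. h2 i x))"
    by (rule integrable_compact_support[OF _ K(1)], rule cm) (auto simp: w_off intro!: w_cont continuous_intros h)
  moreover have "(\<Sum>i\<in>UNIV. ?W' i x) = lap x * h x - w x * (\<Sum>i\<in>UNIV. h2 i x)" for x
    by (simp add: lap_def sum_subtractf sum_distrib_left sum_distrib_right)
  ultimately show ?thesis using fl by simp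
qed

definition radial_deriv :: "real^4 \<Rightarrow> real" where "radial_deriv x = (\<Sum>j\<in>UNIV. x $ j * d j x)"

lemma radial_deriv_cont: "continuous_on UNIV radial_deriv"
  unfolding radial_deriv_def[abs_def] by (intro continuous_intros d_cont)

lemma radial_deriv_off: "x \<notin> K \<Longrightarrow> radial_deriv x = 0" by (simp add: radial_deriv_def d_off)

lemma radial_deriv_pd: "has_pd i radial_deriv (d i x + (\<Sum>j\<in>UNIV. x $ j * d2 j i x)) x"
proof -
  have "has_pd i radial_deriv (\<Sum>j\<in>UNIV. (if i = j then 1 else 0) * d j x + x $ j * d2 j i x) x"
    unfolding radial_deriv_def[abs_def] by (intro has_pd_sum has_pd_mult has_pd_nth d_pd)
  moreover have "(\<Sum>j\<in>UNIV. (if i = j then 1 else 0) * d j x) = d i x"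
    by (simp add: if_distribR if_distrib cong: if_cong)
  ultimately show ?thesis by (simp add: sum.distrib)
qed

text \<open>
  The left integrand is the Laplacian of \<open>u = q w\<close>, since \<open>\<nabla>q = - x\<close> and \<open>\<Delta>q = - 4\<close>. The identity is
  \<open>\<langle>A (A - 2) u, u\<rangle> = \<parallel>(A - 2) u\<parallel>^2 + 2 \<langle>(A - 2) u, u\<rangle>\<close>. It follows from the fluxes of the four fields
  \<open>q w \<nabla>w\<close>, \<open>q (x \<cdot> \<nabla>w) \<nabla>w\<close>, \<open>q |\<nabla>w|^2 x\<close> and \<open>w^2 x\<close>, the second and third being of Pohozaev type.
\<close>

lemma paneitz_identity:
  fixes q :: "real^4 \<Rightarrow> real"
  defines "q \<equiv> \<lambda>x. (1 - (norm x)\<^sup>2) / 2"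
  shows "(LINT x|lborel. (q x * lap x - 2 * radial_deriv x - 4 * w x)\<^sup>2)
    = (LINT x|lborel. (q x * lap x)\<^sup>2) + 2 * (LINT x|lborel. grad2 x)"
proof -
  \<comment> \<open>\<open>G\<close> is half the radial derivative of \<open>|\<nabla>w|^2\<close>; it cancels between the two Pohozaev fluxes.\<close>
  define G where "G x = (\<Sum>i\<in>UNIV. \<Sum>j\<in>UNIV. x $ j * d2 j i x * d i x)" for x :: "real^4"
  have q_pd: "has_pd i q (- x $ i) x" for i x
    using has_pd_mult[OF has_pd_diff[OF has_pd_const has_pd_norm_sq[of i 0 x], of 1] has_pd_const, of "1/2"]
    by (simp add: q_def)
  have q_cont: "continuous_on UNIV q" unfolding q_def by (intro continuous_intros) auto
  have grad2_pd: "has_pd i grad2 (\<Sum>j\<in>UNIV. 2 * d2 j i x * d j x) x" for i x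
    unfolding grad2_def[abs_def] by (intro has_pd_sum has_pd_power2 d_pd)
  note cs = continuous_intros q_cont w_cont d_cont d2_cont radial_deriv_cont grad2_cont
  note off = w_off d_off d2_off radial_deriv_off grad2_off
  have r: "(\<Sum>i\<in>UNIV. (x $ i)\<^sup>2) = 1 - 2 * q x" for x
    by (simp add: q_def norm_sq_nth field_simps)

  have qw_pd: "has_pd i (\<lambda>x. q x * w x) (- x $ i * w x + q x * d i x) x" for i x
    by (rule has_pd_mult[OF q_pd w_pd])
  have "integrable lborel (\<lambda>x. \<Sum>i\<in>UNIV. (- x $ i * w x + q x * d i x) * d i x + (q x * w x) * d2 i i x)"
    and "(LINT x|lborel. (\<Sum>i\<in>UNIV. (- x $ i * w x + q x * d i x) * d i x + (q x * w x) * d2 i i x)) = 0"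
    by ((rule flux[where W="\<lambda>i x. q x * w x * d i x"],
        rule has_pd_mult[OF qw_pd d_pd], auto simp: off intro!: cs)[1])+
  moreover have "(\<Sum>i\<in>UNIV. (- x $ i * w x + q x * d i x) * d i x + (q x * w x) * d2 i i x)
    = q x * w x * lap x + q x * grad2 x - radial_deriv x * w x" for x
    unfolding lap_def grad2_def radial_deriv_def sum_distrib_left sum_distrib_right
      sum.distrib[symmetric] sum_subtractf[symmetric]
    by (intro sum.cong refl) (simp add: algebra_simps power2_eq_square)
  ultimately have f1: "integrable lborel (\<lambda>x. q x * w x * lap x + q x * grad2 x - radial_deriv x * w x)"
    "(LINT x|lborel. q x * w x * lap x + q x * grad2 x - radial_deriv x * w x) = 0" by auto

  let ?E = "\<lambda>i x. d i x + (\<Sum>j\<in>UNIV. x $ j * d2 j i x)"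
  have "integrable lborel (\<lambda>x. \<Sum>i\<in>UNIV. (- x $ i * radial_deriv x + q x * ?E i x) * d i x + (q x * radial_deriv x) * d2 i i x)"
    and "(LINT x|lborel. (\<Sum>i\<in>UNIV. (- x $ i * radial_deriv x + q x * ?E i x) * d i x + (q x * radial_deriv x) * d2 i i x)) = 0"
    by ((rule flux[where W="\<lambda>i x. q x * radial_deriv x * d i x"],
        intro has_pd_mult q_pd radial_deriv_pd d_pd, auto simp: off intro!: cs)[1])+
  moreover have "(\<Sum>i\<in>UNIV. (- x $ i * radial_deriv x + q x * ?E i x) * d i x + (q x * radial_deriv x) * d2 i i x)
    = q x * radial_deriv x * lap x - (radial_deriv x)\<^sup>2 + q x * (grad2 x + G x)" for x
  proof -
    have "(\<Sum>i\<in>UNIV. (- x $ i * radial_deriv x + q x * ?E i x) * d i x + (q x * radial_deriv x) * d2 i i x)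
      = (\<Sum>i\<in>UNIV. (q x * radial_deriv x) * d2 i i x - radial_deriv x * (x $ i * d i x)
          + (q x * (d i x)\<^sup>2 + q x * (\<Sum>j\<in>UNIV. x $ j * d2 j i x * d i x)))"
      by (intro sum.cong) (auto simp: algebra_simps power2_eq_square sum_distrib_left sum_distrib_right)
    also have "\<dots> = q x * radial_deriv x * lap x - radial_deriv x * radial_deriv x + (q x * grad2 x + q x * G x)"
      unfolding sum.distrib sum_subtractf sum_distrib_left[symmetric]
      by (simp add: lap_def grad2_def G_def radial_deriv_def)
    finally show ?thesis by (simp add: power2_eq_square algebra_simps)
  qed
  ultimately have f2: "integrable lborel (\<lambda>x. q x * radial_deriv x * lap x - (radial_deriv x)\<^sup>2 + q x * (grad2 x + G x))"
    "(LINT x|lborel. q x * radial_deriv x * lap x - (radial_deriv x)\<^sup>2 + q x * (grad2 x + G x)) = 0" by auto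

  let ?P = "\<lambda>i x. \<Sum>j\<in>UNIV. 2 * d2 j i x * d j x"
  have "integrable lborel (\<lambda>x. \<Sum>i\<in>UNIV. (- x $ i * x $ i + q x * (if i = i then 1 else 0)) * grad2 x + (q x * x $ i) * ?P i x)"
    and "(LINT x|lborel. (\<Sum>i\<in>UNIV. (- x $ i * x $ i + q x * (if i = i then 1 else 0)) * grad2 x + (q x * x $ i) * ?P i x)) = 0"
    by ((rule flux[where W="\<lambda>i x. q x * x $ i * grad2 x"], 
        intro has_pd_mult q_pd has_pd_nth grad2_pd, auto simp: off intro!: cs)[1])+
  moreover have "(\<Sum>i\<in>UNIV. (- x $ i * x $ i + q x * (if i = i then 1 else 0)) * grad2 x + (q x * x $ i) * ?P i x)
    = (6 * q x - 1) * grad2 x + 2 * q x * G x" for x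
  proof -
    have "(\<Sum>i\<in>UNIV. (- x $ i * x $ i + q x * (if i = i then 1 else 0)) * grad2 x + (q x * x $ i) * ?P i x)
      = (\<Sum>i\<in>(UNIV::4 set). q x * grad2 x) - (\<Sum>i\<in>UNIV. (x $ i)\<^sup>2) * grad2 x
        + 2 * q x * (\<Sum>i\<in>UNIV. \<Sum>j\<in>UNIV. x $ i * d2 i j x * d j x)"
      unfolding sum_distrib_left sum_distrib_right sum.distrib[symmetric] sum_subtractf[symmetric]
      by (intro sum.cong refl) (simp add: algebra_simps power2_eq_square sum_distrib_left sym[of _ i for i])
    also have "(\<Sum>i\<in>UNIV. \<Sum>j\<in>UNIV. x $ i * d2 i j x * d j x) = G x"
      unfolding G_def by (rule sum.swap)
    finally show ?thesis by (simp add: r algebra_simps)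
  qed
  ultimately have f3: "integrable lborel (\<lambda>x. (6 * q x - 1) * grad2 x + 2 * q x * G x)"
    "(LINT x|lborel. (6 * q x - 1) * grad2 x + 2 * q x * G x) = 0" by auto

  have "integrable lborel (\<lambda>x. \<Sum>i\<in>UNIV. (if i = i then 1 else 0) * (w x)\<^sup>2 + x $ i * (2 * d i x * w x))"
    and "(LINT x|lborel. (\<Sum>i\<in>UNIV. (if i = i then 1 else 0) * (w x)\<^sup>2 + x $ i * (2 * d i x * w x))) = 0"
    by ((rule flux[where W="\<lambda>i x. x $ i * (w x)\<^sup>2"],
        intro has_pd_mult has_pd_nth has_pd_power2 w_pd, auto simp: off intro!: cs)[1])+
  moreover have "(\<Sum>i\<in>UNIV. (if i = i then 1 else 0) * (w x)\<^sup>2 + x $ i * (2 * d i x * w x)) = 4 * (w x)\<^sup>2 + 2 * radial_deriv x * w x" for x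
    by (simp add: radial_deriv_def sum.distrib sum_distrib_left sum_distrib_right algebra_simps)
  ultimately have f4: "integrable lborel (\<lambda>x. 4 * (w x)\<^sup>2 + 2 * radial_deriv x * w x)"
    "(LINT x|lborel. 4 * (w x)\<^sup>2 + 2 * radial_deriv x * w x) = 0" by auto

  have g: "integrable lborel grad2" by (rule integrable_compact_support[OF grad2_cont K(1) grad2_off])
  have l: "integrable lborel (\<lambda>x. (q x * lap x)\<^sup>2)"
    by (rule integrable_compact_support[OF _ K(1)]) (auto simp: lap_off intro!: continuous_intros q_cont lap_cont)
  define A1 where "A1 = (\<lambda>x. q x * w x * lap x + q x * grad2 x - radial_deriv x * w x)"
  define A2 where "A2 = (\<lambda>x. q x * radial_deriv x * lap x - (radial_deriv x)\<^sup>2 + q x * (grad2 x + G x))"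
  define A3 where "A3 = (\<lambda>x. (6 * q x - 1) * grad2 x + 2 * q x * G x)"
  define A4 where "A4 = (\<lambda>x. 4 * (w x)\<^sup>2 + 2 * radial_deriv x * w x)"
  define Q where "Q = (\<lambda>x. (q x * lap x)\<^sup>2)"
  have "(q x * lap x - 2 * radial_deriv x - 4 * w x)\<^sup>2
      = Q x + 2 * grad2 x - 8 * A1 x - 4 * A2 x + 2 * A3 x + 4 * A4 x" for x
    by (simp add: Q_def A1_def A2_def A3_def A4_def power2_eq_square algebra_simps)
  then show ?thesis
    using f1[folded A1_def] f2[folded A2_def] f3[folded A3_def] f4[folded A4_def] g l[folded Q_def]
    unfolding Q_def[symmetric] by (simp add: A1_def[symmetric])
qed

text \<open>
  Completing the square at the bottom \<open>9/4\<close> of the spectrum: \<open>- (q \<Delta>w + w / (4 q))\<close> is \<open>\<phi>^2 (A - 9/4) u\<close>.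
\<close>

lemma energy_identity:
  fixes q :: "real^4 \<Rightarrow> real"
  defines "q \<equiv> \<lambda>x. (1 - (norm x)\<^sup>2) / 2"
  shows "(LINT x|lborel. (q x * lap x - 2 * radial_deriv x - 4 * w x)\<^sup>2)
    = (LINT x|lborel. (q x * lap x + w x / (4 * q x))\<^sup>2) + 5 / 2 * (LINT x|lborel. grad2 x)
      - 1 / 16 * (LINT x|lborel. (w x / q x)\<^sup>2)"
    and "(LINT x|lborel. (w x / q x)\<^sup>2) \<le> 4 * (LINT x|lborel. grad2 x)"
proof -
  have q_cont: "continuous_on UNIV q" unfolding q_def by (intro continuous_intros) auto
  have q0: "q x \<noteq> 0" if "x \<in> ball 0 1" for x using ball_pos[OF that] by (auto simp: q_def)
  have wq_cont: "continuous_on UNIV (\<lambda>x. w x * (1 / q x))"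
    by (rule continuous_mult_support[OF K_closed K(2) open_ball])
       (use q0 in \<open>auto simp: w_off intro!: w_cont continuous_intros continuous_on_subset[OF q_cont]\<close>)
  have g: "integrable lborel grad2" by (rule integrable_compact_support[OF grad2_cont K(1) grad2_off])
  have l: "integrable lborel (\<lambda>x. (q x * lap x)\<^sup>2)"
    by (rule integrable_compact_support[OF _ K(1)]) (auto simp: lap_off intro!: continuous_intros q_cont lap_cont)
  have y: "integrable lborel (\<lambda>x. (w x / q x)\<^sup>2)"
    by (rule integrable_compact_support[OF _ K(1)]) (use wq_cont in \<open>auto simp: w_off intro!: continuous_intros\<close>)
  have wl: "integrable lborel (\<lambda>x. w x * lap x)"
    by (rule integrable_compact_support[OF _ K(1)]) (auto simp: w_off intro!: continuous_intros w_cont lap_cont)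
  have "(LINT x|lborel. (\<Sum>i\<in>UNIV. d i x * d i x + w x * d2 i i x)) = 0"
    by (rule flux(2)[where W="\<lambda>i x. w x * d i x"])
       (auto simp: w_off intro!: has_pd_mult w_pd d_pd continuous_intros w_cont d_cont d2_cont)
  moreover have "(\<Sum>i\<in>UNIV. d i x * d i x + w x * d2 i i x) = grad2 x + w x * lap x" for x
    by (simp add: grad2_def lap_def sum.distrib sum_distrib_left power2_eq_square)
  ultimately have ibp: "(LINT x|lborel. w x * lap x) = - (LINT x|lborel. grad2 x)"
    using g wl by simp
  have "(q x * lap x + w x / (4 * q x))\<^sup>2 = (q x * lap x)\<^sup>2 + 1 / 2 * (w x * lap x) + 1 / 16 * (w x / q x)\<^sup>2" for x
  proof (cases "x \<in> K")
    case True
    then have "q x \<noteq> 0" using K q0 by auto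
    then show ?thesis by (simp add: power2_eq_square field_simps)
  qed (simp add: w_off)
  then have "(LINT x|lborel. (q x * lap x + w x / (4 * q x))\<^sup>2)
     = (LINT x|lborel. (q x * lap x)\<^sup>2) + 1 / 2 * (LINT x|lborel. w x * lap x) + 1 / 16 * (LINT x|lborel. (w x / q x)\<^sup>2)"
    using l y wl by simp
  then show "(LINT x|lborel. (q x * lap x - 2 * radial_deriv x - 4 * w x)\<^sup>2)
    = (LINT x|lborel. (q x * lap x + w x / (4 * q x))\<^sup>2) + 5 / 2 * (LINT x|lborel. grad2 x)
      - 1 / 16 * (LINT x|lborel. (w x / q x)\<^sup>2)"
    using paneitz_identity ibp by (simp add: q_def)
  have "(w x / q x)\<^sup>2 = 4 * ((w x)\<^sup>2 / (1 - (norm x)\<^sup>2)\<^sup>2)" for x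
    by (simp add: q_def power_divide power_mult_distrib)
  then have "(LINT x|lborel. (w x / q x)\<^sup>2) = 4 * (LINT x|lborel. (w x)\<^sup>2 / (1 - (norm x)\<^sup>2)\<^sup>2)"
    by (simp only: integral_mult_right_zero)
  then show "(LINT x|lborel. (w x / q x)\<^sup>2) \<le> 4 * (LINT x|lborel. grad2 x)"
    using hardy_boundary by simp
qed

end

lemma has_pd_partial_deriv:
  "(\<lambda>t. f (x + t *\<^sub>R axis i 1)) differentiable (at 0) \<Longrightarrow> has_pd i f (partial_deriv i f x) x"
  by (simp add: has_pd_def partial_deriv_def DERIV_deriv_iff_real_differentiable)

lemma set_integral_eq_of_support:
  fixes f :: "'a::euclidean_space \<Rightarrow> real"
  assumes "\<And>x. x \<notin> A \<Longrightarrow> f x = 0"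
  shows "(LINT x:A|lborel. f x) = (LINT x|lborel. f x)"
  unfolding set_lebesgue_integral_def
  by (rule Bochner_Integration.integral_cong) (use assms in \<open>auto split: split_indicator\<close>)

text \<open>
  The reciprocal of the conformal factor \<open>\<phi>\<close>.
\<close>

definition iconf :: "real^4 \<Rightarrow> real" where "iconf x = (1 - (norm x)\<^sup>2) / 2"

lemma iconf_pos: "x \<in> ball 0 1 \<Longrightarrow> 0 < iconf x"
  by (simp add: iconf_def power_less_one_iff abs_square_less_1)

lemma iconf_cont: "continuous_on A iconf"
  unfolding iconf_def[abs_def] by (intro continuous_intros) auto

lemma iconf_pd: "has_pd i iconf (- x $ i) x"
  using has_pd_mult[OF has_pd_diff[OF has_pd_const has_pd_norm_sq[of i 0 x], of 1] has_pd_const, of "1/2"]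
  by (simp add: iconf_def[abs_def])

lemma conformal_ball_C2:
  assumes u: "u \<in> test_functions B4"
  defines "K \<equiv> closure {x. u x \<noteq> 0}"
  obtains d d2 where "ball_C2 (\<lambda>x. u x * (1 / iconf x)) d d2 K"
    "\<And>x. laplacian u x = iconf x * ball_C2.lap d2 x - 2 * ball_C2.radial_deriv d x - 4 * (u x * (1 / iconf x))"
proof -
  have K: "compact K" "K \<subseteq> ball 0 1" and Ck: "C_k k u" for k
    using u by (auto simp: test_functions_def K_def)
  have Kc: "closed K" by (simp add: K_def)
  have u_off: "u x = 0" if "x \<notin> K" for x
    using that closure_subset[of "{x. u x \<noteq> 0}"] by (auto simp: K_def)
  define u1 where "u1 i = partial_deriv i u" for i
  define u2 where "u2 i j = partial_deriv j (u1 i)" for i j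
  have c: "continuous_on UNIV u" "continuous_on UNIV (u1 i)" "continuous_on UNIV (u2 i j)"
    and pd: "has_pd i u (u1 i x) x" "has_pd j (u1 i) (u2 i j x) x" for i j x
    using Ck[of 3] by (auto simp: numeral_3_eq_3 u1_def u2_def intro!: has_pd_partial_deriv)
  have u2_sym: "u2 i j x = u2 j i x" for i j x
    by (rule has_pd_commute[OF pd(1) pd(1) pd(2) pd(2) c(3) c(3)])
  have u1_off: "u1 i x = 0" if "x \<notin> K" for i x
    by (rule has_pd_unique[OF pd(1) has_pd_off_support[OF Kc u_off that]])
  have u2_off: "u2 i j x = 0" if "x \<notin> K" for i j x
    by (rule has_pd_unique[OF pd(2) has_pd_off_support[OF Kc u1_off that]])

  define p where "p x = 1 / iconf x" for x
  define p1 where "p1 i x = x $ i * (p x * p x)" for i x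
  define p2 where "p2 i j x = (if i = j then 1 else 0) * (p x * p x) + 2 * x $ i * x $ j * (p x * p x * p x)" for i j x
  have q0: "iconf x \<noteq> 0" if "x \<in> ball 0 1" for x using iconf_pos[OF that] by simp
  have p_pd: "has_pd i p (p1 i x) x" if "x \<in> ball 0 1" for i x
    using has_pd_inverse[OF iconf_pd q0[OF that], of i]
    by (simp add: p_def[abs_def] p1_def power2_eq_square)
  have p1_pd: "has_pd j (p1 i) (p2 i j x) x" if "x \<in> ball 0 1" for i j x
  proof -
    have "has_pd j (p1 i) ((if j = i then 1 else 0) * (p x * p x) + x $ i * (p1 j x * p x + p x * p1 j x)) x"
      unfolding p1_def[of i, abs_def] by (intro has_pd_mult has_pd_nth p_pd that)
    then show ?thesis by (rule has_pd_cong) (auto simp: p2_def p1_def algebra_simps)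
  qed
  have p_cont: "continuous_on (ball 0 1) p" "continuous_on (ball 0 1) (p1 i)" "continuous_on (ball 0 1) (p2 i j)" for i j
  proof -
    show pc: "continuous_on (ball 0 1) p"
      unfolding p_def[abs_def] using q0 by (intro continuous_intros iconf_cont) auto
    show "continuous_on (ball 0 1) (p1 i)" "continuous_on (ball 0 1) (p2 i j)"
      unfolding p1_def[abs_def] p2_def[abs_def] by (intro continuous_intros pc)+
  qed

  define d where "d i x = u1 i x * p x + u x * p1 i x" for i x
  define d2 where "d2 i j x = (u2 i j x * p x + u1 i x * p1 j x) + (u1 j x * p1 i x + u x * p2 i j x)" for i j x
  note cm = continuous_mult_support[OF Kc K(2) open_ball]
  note pm = has_pd_mult_support[OF Kc K(2)]
  interpret ball_C2 "\<lambda>x. u x * (1 / iconf x)" d d2 K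
    unfolding p_def[symmetric]
  proof
    show "continuous_on UNIV (\<lambda>x. u x * p x)"
      by (rule cm) (auto simp: u_off intro: c p_cont)
    show "continuous_on UNIV (d i)" for i
      unfolding d_def[abs_def] by (intro continuous_on_add; rule cm) (auto simp: u_off u1_off intro: c p_cont)
    show "continuous_on UNIV (d2 i j)" for i j
      unfolding d2_def[abs_def] by (intro continuous_on_add; rule cm) (auto simp: u_off u1_off u2_off intro: c p_cont)
    show "has_pd i (\<lambda>x. u x * p x) (d i x) x" for i x
      unfolding d_def by (rule pm) (auto simp: u_off intro: pd p_pd)
    show "has_pd j (d i) (d2 i j x) x" for i j x
      unfolding d_def[abs_def] d2_def
      by (intro has_pd_add; rule pm) (auto simp: u_off u1_off intro: pd p_pd p1_pd)
    show "d2 i j x = d2 j i x" for i j x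
      by (auto simp: d2_def u2_sym[of i j] p2_def)
  qed (use K in \<open>auto simp: u_off\<close>)
  have "laplacian u x = iconf x * lap x - 2 * radial_deriv x - 4 * (u x * (1 / iconf x))" for x
  proof (cases "x \<in> K")
    case False
    then have "laplacian u x = 0" by (simp add: laplacian_def flip: u1_def u2_def) (simp add: u2_off)
    then show ?thesis using False by (simp add: lap_off radial_deriv_off u_off)
  next
    case True
    then have pq: "iconf x * p x = 1" using q0 K by (auto simp: p_def)
    have r: "(\<Sum>i\<in>UNIV. (x $ i)\<^sup>2) = 1 - 2 * iconf x"
      by (simp add: iconf_def norm_sq_nth field_simps)
    define S where "S = (\<Sum>i\<in>UNIV. x $ i * u1 i x)"
    have lapu: "laplacian u x = (\<Sum>i\<in>UNIV. u2 i i x)"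
      by (simp add: laplacian_def u1_def u2_def)
    have "lap x = (\<Sum>i\<in>UNIV. p x * u2 i i x + 2 * (p x)\<^sup>2 * (x $ i * u1 i x) + (u x * (p x)\<^sup>2 + 2 * u x * (p x)^3 * (x $ i)\<^sup>2))"
      unfolding lap_def by (intro sum.cong refl) (simp add: d2_def p1_def p2_def power2_eq_square power3_eq_cube algebra_simps)
    also have "\<dots> = p x * laplacian u x + 2 * (p x)\<^sup>2 * S + (4 * (u x * (p x)\<^sup>2) + 2 * u x * (p x)^3 * (1 - 2 * iconf x))"
      unfolding r[symmetric] S_def lapu sum_distrib_left sum.distrib by simp
    finally have l: "lap x = p x * laplacian u x + 2 * (p x)\<^sup>2 * S
        + (4 * (u x * (p x)\<^sup>2) + 2 * u x * (p x)^3 * (1 - 2 * iconf x))" .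
    have 1: "iconf x * lap x = (iconf x * p x) * laplacian u x + 2 * (iconf x * p x) * p x * S
        + (4 * u x * (iconf x * p x) * p x + 2 * u x * (iconf x * p x) * (p x)\<^sup>2 - 4 * u x * (iconf x * p x) * (iconf x * p x) * p x)"
      unfolding l by (simp add: algebra_simps power2_eq_square power3_eq_cube)
    have "radial_deriv x = (\<Sum>i\<in>UNIV. p x * (x $ i * u1 i x) + u x * (p x)\<^sup>2 * (x $ i)\<^sup>2)"
      unfolding radial_deriv_def by (intro sum.cong refl) (simp add: d_def p1_def power2_eq_square algebra_simps)
    also have "\<dots> = p x * S + u x * (p x)\<^sup>2 * (1 - 2 * iconf x)"
      unfolding r[symmetric] S_def sum_distrib_left sum.distrib by simp
    finally have 2: "radial_deriv x = p x * S + u x * (p x)\<^sup>2 - 2 * u x * (iconf x * p x) * p x"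
      by (simp add: algebra_simps power2_eq_square)
    show ?thesis using 1 2 unfolding pq p_def[symmetric] by (simp add: algebra_simps)
  qed
  then show thesis using that ball_C2_axioms by blast
qed

text \<open>
  The slack \<open>del\<close> is chosen so that \<open>(5/2 - del) X \<ge> ((1 + lam) / 16 + del) Y\<close> whenever \<open>4 X \<ge> Y\<close>, where
  \<open>X\<close> and \<open>Y\<close> are the two integrals multiplied by \<open>del\<close>; this is where \<open>lam < 9\<close> is used.
\<close>

lemma energy_splitting:
  fixes lam :: real
  assumes u: "u \<in> test_functions B4" and lam: "lam < 9"
    and E: "(LINT x:B4|lborel. (laplacian u x)\<^sup>2)
        - lam * (LINT x:B4|lborel. (u x)\<^sup>2 / (1 - (norm x)\<^sup>2) ^ 4) \<le> 1"
    and w: "ball_C2 w d d2 K" and wu: "w = (\<lambda>x. u x * (1 / iconf x))"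
    and lapu: "\<And>x. laplacian u x = iconf x * ball_C2.lap d2 x - 2 * ball_C2.radial_deriv d x - 4 * w x"
  defines "del \<equiv> min 1 ((9 - lam) / 20)"
  shows "(LINT x|lborel. (iconf x * ball_C2.lap d2 x + w x / (4 * iconf x))\<^sup>2)
     + del * ((LINT x|lborel. ball_C2.grad2 d x) + (LINT x|lborel. (w x / iconf x)\<^sup>2)) \<le> 1"
proof -
  interpret ball_C2 w d d2 K by (rule w)
  define X where "X = (LINT x|lborel. grad2 x)"
  define Y where "Y = (LINT x|lborel. (w x / iconf x)\<^sup>2)"
  have out: "x \<notin> K" if "x \<notin> B4" for x using that K by auto
  have 1: "(LINT x:B4|lborel. (laplacian u x)\<^sup>2) = (LINT x|lborel. (iconf x * lap x - 2 * radial_deriv x - 4 * w x)\<^sup>2)"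
    by (subst set_integral_eq_of_support) (use out in \<open>auto simp: lapu lap_off radial_deriv_off w_off\<close>)
  have bq0: "iconf x \<noteq> 0" if "x \<in> B4" for x using iconf_pos[OF that] by simp
  have u0: "u x = 0" if "x \<notin> B4" for x
    using u that closure_subset[of "{x. u x \<noteq> 0}"] by (auto simp: test_functions_def)
  have "(LINT x:B4|lborel. (u x)\<^sup>2 / (1 - (norm x)\<^sup>2) ^ 4) = (LINT x|lborel. (u x)\<^sup>2 / (1 - (norm x)\<^sup>2) ^ 4)"
    by (rule set_integral_eq_of_support) (simp add: u0)
  also have "\<dots> = (LINT x|lborel. 1 / 16 * (w x / iconf x)\<^sup>2)"
    by (rule Bochner_Integration.integral_cong) (auto simp: wu iconf_def power_divide power_mult_distrib power2_eq_square power4_eq_xxxx)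
  finally have 2: "(LINT x:B4|lborel. (u x)\<^sup>2 / (1 - (norm x)\<^sup>2) ^ 4) = Y / 16"
    by (simp add: Y_def)
  have 3: "(LINT x|lborel. (iconf x * lap x - 2 * radial_deriv x - 4 * w x)\<^sup>2)
    = (LINT x|lborel. (iconf x * lap x + w x / (4 * iconf x))\<^sup>2) + 5 / 2 * X - 1 / 16 * Y" and 4: "Y \<le> 4 * X"
    using energy_identity by (simp_all add: X_def Y_def iconf_def)
  have Y0: "0 \<le> Y" by (simp add: Y_def)
  have del: "del \<le> 1" "20 * del \<le> 9 - lam" by (auto simp: del_def min_def)
  have "(5 / 2 - del) * Y \<le> (5 / 2 - del) * (4 * X)" using 4 del by (intro mult_left_mono) auto
  moreover have "20 * del * Y \<le> (9 - lam) * Y" using del Y0 by (intro mult_right_mono) auto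
  ultimately have "del * (X + Y) \<le> 5 / 2 * X - 1 / 16 * Y - lam * (Y / 16)"
    by (simp add: algebra_simps)
  then show ?thesis using E unfolding 1 2 3 X_def[symmetric] Y_def[symmetric] by linarith
qed

section \<open>Representation by the Green function of the ball\<close>

definition depth :: "real^4 \<Rightarrow> real" where "depth x = 1 - (norm x)\<^sup>2"

text \<open>
  The square of \<open>|x|\<close> times the distance from \<open>z\<close> to the mirror image \<open>x / |x|^2\<close>, written in a form that makes the
  positivity of the Green function \<open>1 / |z - x|^2 - 1 / image_sq x z\<close> visible.
\<close>

definition image_sq :: "real^4 \<Rightarrow> real^4 \<Rightarrow> real" where
  "image_sq x z = (norm (z - x))\<^sup>2 + depth x * depth z"

text \<open>
  The kernel that recovers \<open>4 \<pi>^2 u\<close> from \<open>- q \<Delta>w = \<phi>^2 (A - 2) u\<close> by Lebesgue integration in \<open>z\<close>: the Green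
  function times \<open>q x / q z\<close>. The weights are distributed so that \<open>L^2(dx)\<close> norms of \<open>q \<Delta>w\<close> are the relevant ones.
\<close>

definition kern :: "real^4 \<Rightarrow> real^4 \<Rightarrow> real" where
  "kern x z = (depth x)\<^sup>2 / ((norm (z - x))\<^sup>2 * image_sq x z)"

lemma depth_pos: "x \<in> ball 0 1 \<Longrightarrow> 0 < depth x"
  by (simp add: depth_def power_less_one_iff abs_square_less_1)

lemma image_sq_pos: "x \<in> ball 0 1 \<Longrightarrow> z \<in> ball 0 1 \<Longrightarrow> 0 < image_sq x z"
  unfolding image_sq_def by (intro add_nonneg_pos mult_pos_pos depth_pos) auto

lemma depth_measurable [measurable]: "depth \<in> borel_measurable borel"
  unfolding depth_def[abs_def] by measurable

lemma kern_measurable [measurable (raw)]: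
  assumes [measurable]: "f \<in> borel_measurable M" "g \<in> borel_measurable M"
  shows "(\<lambda>x. kern (f x) (g x)) \<in> borel_measurable M"
  unfolding kern_def image_sq_def depth_def by measurable

lemma nn_integral_cauchy_kernel:
  "(\<integral>\<^sup>+y. ennreal (8 / ((norm (y::real^4))\<^sup>2 + 1) ^ 3) \<partial>lborel) = ennreal (4 * pi\<^sup>2)"
proof -
  let ?F = "\<lambda>r::real. 4 * pi\<^sup>2 * (r\<^sup>2 / (r\<^sup>2 + 1))\<^sup>2"
  have p: "r\<^sup>2 + 1 \<noteq> 0" for r :: real by (simp add: add_nonneg_eq_0_iff)
  have "(\<integral>\<^sup>+y. ennreal (8 / ((norm (y::real^4))\<^sup>2 + 1) ^ 3) \<partial>lborel)
     = (\<integral>\<^sup>+y. ennreal (8 / ((norm (y - 0::real^4))\<^sup>2 + 1) ^ 3) * indicator {y. 0 \<le> norm (y - 0)} y \<partial>lborel)"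
    by (intro nn_integral_cong) auto
  also have "\<dots> = ennreal (4 * pi\<^sup>2 - ?F 0)"
  proof (rule nn_integral_radial_atLeast[where g="\<lambda>r. 8 / (r\<^sup>2 + 1) ^ 3"])
    show "(?F has_real_derivative 2 * pi\<^sup>2 * r ^ 3 * (8 / (r\<^sup>2 + 1) ^ 3)) (at r)" for r
    proof -
      have "((\<lambda>r. r\<^sup>2 / (r\<^sup>2 + 1)) has_real_derivative (2 * r * (r\<^sup>2 + 1) - r\<^sup>2 * (2 * r)) / (r\<^sup>2 + 1)\<^sup>2) (at r)"
        using p[of r] by (auto intro!: derivative_eq_intros simp: power2_eq_square)
      from DERIV_cmult[OF DERIV_power[OF this, of 2], of "4 * pi\<^sup>2"]
      have "(?F has_real_derivative 4 * pi\<^sup>2 * (2 * ((2 * r * (r\<^sup>2 + 1) - r\<^sup>2 * (2 * r)) / (r\<^sup>2 + 1)\<^sup>2) * (r\<^sup>2 / (r\<^sup>2 + 1)))) (at r)"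
        by (simp only: mult.assoc of_nat_numeral diff_Suc_1 numeral_2_eq_2[symmetric] power_one_right numeral_eq_Suc pred_numeral_simps) simp
      also have "2 * r * (r\<^sup>2 + 1) - r\<^sup>2 * (2 * r) = 2 * r" by (simp add: algebra_simps)
      also have "4 * pi\<^sup>2 * (2 * (2 * r / (r\<^sup>2 + 1)\<^sup>2) * (r\<^sup>2 / (r\<^sup>2 + 1))) = 2 * pi\<^sup>2 * r ^ 3 * (8 / (r\<^sup>2 + 1) ^ 3)"
        by (simp add: power2_eq_square power3_eq_cube)
      finally show ?thesis .
    qed
    have "((\<lambda>r::real. 4 * pi\<^sup>2 * (r\<^sup>2 / (r\<^sup>2 + 1))\<^sup>2) \<longlongrightarrow> 4 * pi\<^sup>2 * 1\<^sup>2) at_top"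
    proof (intro tendsto_intros)
      have "LIM r at_top. 1 + (r::real)\<^sup>2 :> at_top"
        by (intro filterlim_tendsto_add_at_top[OF tendsto_const] filterlim_pow_at_top filterlim_ident) auto
      then have "((\<lambda>r::real. 1 - inverse (1 + r\<^sup>2)) \<longlongrightarrow> 1 - 0) at_top"
        by (intro tendsto_diff tendsto_const tendsto_inverse_0_at_top)
      moreover have "1 - inverse (1 + r\<^sup>2) = r\<^sup>2 / (r\<^sup>2 + 1)" for r :: real
        using p[of r] by (simp add: field_simps)
      ultimately show "((\<lambda>r::real. r\<^sup>2 / (r\<^sup>2 + 1)) \<longlongrightarrow> 1) at_top" by simp
    qed
    then show "(?F \<longlongrightarrow> 4 * pi\<^sup>2) at_top" by simp
  qed auto
  finally show ?thesis by simp
qed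

text \<open>
  The kernel is the negative Laplacian of \<open>1 / (|z - x|^2 + s^2)\<close>, a rescaling of one integrable profile of mass
  \<open>4 \<pi>^2\<close>.
\<close>

lemma cauchy_kernel_approx_identity:
  fixes w :: "real^4 \<Rightarrow> real"
  assumes w: "continuous_on UNIV w" and M: "\<And>x. \<bar>w x\<bar> \<le> M" and s: "s \<longlonglongrightarrow> 0" "\<And>n. 0 < s n"
  shows "(\<lambda>n. LINT z|lborel. 8 * (s n)\<^sup>2 / ((norm (z - x))\<^sup>2 + (s n)\<^sup>2) ^ 3 * w z) \<longlonglongrightarrow> 4 * pi\<^sup>2 * w x"
proof -
  have [measurable]: "w \<in> borel_measurable borel"
    using w by (rule borel_measurable_continuous_onI)
  let ?h = "\<lambda>y::real^4. 8 / ((norm y)\<^sup>2 + 1) ^ 3"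
  have hb: "has_bochner_integral lborel ?h (4 * pi\<^sup>2)"
    by (rule has_bochner_integral_nn_integral) (auto simp: nn_integral_cauchy_kernel)
  have subst: "(LINT z|lborel. 8 * t\<^sup>2 / ((norm (z - x))\<^sup>2 + t\<^sup>2) ^ 3 * w z) = (LINT y|lborel. ?h y * w (x + t *\<^sub>R y))"
    if t: "0 < t" for t
  proof -
    have "(LINT z|lborel. 8 * t\<^sup>2 / ((norm (z - x))\<^sup>2 + t\<^sup>2) ^ 3 * w z)
       = (LINT z|density (distr lborel borel (\<lambda>y. x + t *\<^sub>R y)) (\<lambda>_. \<bar>t\<bar> ^ DIM(real^4)). 8 * t\<^sup>2 / ((norm (z - x))\<^sup>2 + t\<^sup>2) ^ 3 * w z)"
      using t by (subst lborel_affine[of t x]) auto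
    also have "\<dots> = (LINT y|lborel. t ^ 4 * (8 * t\<^sup>2 / ((norm (t *\<^sub>R y))\<^sup>2 + t\<^sup>2) ^ 3 * w (x + t *\<^sub>R y)))"
      using t by (subst integral_density) (auto simp: integral_distr)
    also have "\<dots> = (LINT y|lborel. ?h y * w (x + t *\<^sub>R y))"
    proof (rule Bochner_Integration.integral_cong[OF refl])
      fix y :: "real^4"
      have "(norm (t *\<^sub>R y))\<^sup>2 + t\<^sup>2 = t\<^sup>2 * ((norm y)\<^sup>2 + 1)"
        by (simp add: power_mult_distrib algebra_simps)
      then have "((norm (t *\<^sub>R y))\<^sup>2 + t\<^sup>2) ^ 3 = t ^ 6 * ((norm y)\<^sup>2 + 1) ^ 3"
        by (simp add: power_mult_distrib)
      then show "t ^ 4 * (8 * t\<^sup>2 / ((norm (t *\<^sub>R y))\<^sup>2 + t\<^sup>2) ^ 3 * w (x + t *\<^sub>R y)) = ?h y * w (x + t *\<^sub>R y)"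
        using t by (simp add: power_add[symmetric] field_simps)
    qed
    finally show ?thesis .
  qed
  have "(\<lambda>n. LINT y|lborel. ?h y * w (x + s n *\<^sub>R y)) \<longlonglongrightarrow> (LINT y|lborel. ?h y * w x)"
  proof (rule integral_dominated_convergence[where w="\<lambda>y. ?h y * M"])
    show "integrable lborel (\<lambda>y. ?h y * M)"
      using hb by (intro integrable_mult_left) (simp add: has_bochner_integral_iff)
    show "AE y in lborel. (\<lambda>n. ?h y * w (x + s n *\<^sub>R y)) \<longlonglongrightarrow> ?h y * w x"
    proof (intro AE_I2 tendsto_mult tendsto_const)
      fix y :: "real^4"
      have "(\<lambda>n. x + s n *\<^sub>R y) \<longlonglongrightarrow> x + 0 *\<^sub>R y" by (intro tendsto_intros s)
      then show "(\<lambda>n. w (x + s n *\<^sub>R y)) \<longlonglongrightarrow> w x"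
        using w by (intro isCont_tendsto_compose[of x w]) (auto simp: continuous_on_eq_continuous_at)
    qed
    show "AE y in lborel. norm (?h y * w (x + s n *\<^sub>R y)) \<le> ?h y * M" for n
      using M by (intro AE_I2) (auto simp: abs_mult intro!: mult_left_mono divide_right_mono)
  qed auto
  moreover have "(LINT y|lborel. ?h y * w x) = 4 * pi\<^sup>2 * w x"
    unfolding integral_mult_left_zero using hb by (simp add: has_bochner_integral_iff)
  ultimately show ?thesis using subst[OF s(2)] by (simp only:)
qed

context ball_C2
begin

text \<open>
  Green's identity with \<open>h = 1 / N\<close>, where \<open>N\<close> has the constant second derivatives \<open>c\<close> in all directions. The
  regularised fundamental solution and the image term are both of this form.
\<close>

lemma green_inverse_quadratic:
  assumes U: "open U" "K \<subseteq> U" and N: "\<And>x. x \<in> U \<Longrightarrow> N x \<noteq> 0"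
    and cont: "continuous_on UNIV N" "\<And>i. continuous_on UNIV (n i)"
    and pd: "\<And>i x. has_pd i N (n i x) x" "\<And>i x. has_pd i (n i) c x"
  shows "(LINT x|lborel. lap x * (1 / N x))
    = (LINT x|lborel. w x * (2 * (\<Sum>i\<in>UNIV. (n i x)\<^sup>2) - 4 * c * N x) / (N x) ^ 3)"
proof -
  let ?h1 = "\<lambda>i x. - n i x * (1 / N x * (1 / N x))"
  let ?h2 = "\<lambda>i x. - c * (1 / N x * (1 / N x)) + - n i x * (- n i x / (N x)\<^sup>2 * (1 / N x) + 1 / N x * (- n i x / (N x)\<^sup>2))"
  have c: "continuous_on U N" "continuous_on U (n i)" for i
    using cont by (auto intro: continuous_on_subset)
  have "(LINT x|lborel. lap x * (1 / N x)) = (LINT x|lborel. w x * (\<Sum>i\<in>UNIV. ?h2 i x))"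
  proof (rule green[OF U, where ?h1.0="?h1" and ?h2.0="?h2"])
    show "has_pd i (\<lambda>x. 1 / N x) (?h1 i x) x" if "x \<in> U" for i x
      using has_pd_inverse[OF pd(1) N[OF that], of i] by (simp add: power2_eq_square)
    show "has_pd i (?h1 i) (?h2 i x) x" if "x \<in> U" for i x
      by (intro has_pd_mult has_pd_minus has_pd_inverse pd N that)
  qed (use N in \<open>auto intro!: continuous_intros c\<close>)
  also have "\<dots> = (LINT x|lborel. w x * (2 * (\<Sum>i\<in>UNIV. (n i x)\<^sup>2) - 4 * c * N x) / (N x) ^ 3)"
  proof (rule Bochner_Integration.integral_cong[OF refl])
    fix x :: "real^4"
    show "w x * (\<Sum>i\<in>UNIV. ?h2 i x) = w x * (2 * (\<Sum>i\<in>UNIV. (n i x)\<^sup>2) - 4 * c * N x) / (N x) ^ 3"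
    proof (cases "x \<in> K")
      case True
      then have N0: "N x \<noteq> 0" using U N by auto
      have "?h2 i x = 2 / (N x) ^ 3 * (n i x)\<^sup>2 - c / (N x)\<^sup>2" for i
        using N0 by (simp add: field_simps power2_eq_square power3_eq_cube)
      then have "(\<Sum>i\<in>UNIV. ?h2 i x) = 2 / (N x) ^ 3 * (\<Sum>i\<in>UNIV. (n i x)\<^sup>2) - 4 * (c / (N x)\<^sup>2)"
        by (simp only: sum_subtractf sum_distrib_left) simp
      also have "\<dots> = (2 * (\<Sum>i\<in>UNIV. (n i x)\<^sup>2) - 4 * c * N x) / (N x) ^ 3"
        using N0 by (simp add: field_simps power2_eq_square power3_eq_cube)
      finally show ?thesis by simp
    qed (simp add: w_off)
  qed
  finally show ?thesis .
qed

text \<open>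
  In dimension four \<open>1 / image_sq x z\<close> is harmonic in \<open>z\<close>.
\<close>

lemma image_term_vanishes:
  assumes x: "x \<in> ball 0 1"
  shows "(LINT z|lborel. lap z * (1 / image_sq x z)) = 0"
proof -
  let ?n = "\<lambda>i z. 2 * (z $ i - x $ i) + depth x * (- 2 * z $ i)"
  have "has_pd i depth (- 2 * z $ i) z" for i z
    unfolding depth_def[abs_def] using has_pd_diff[OF has_pd_const has_pd_norm_sq[of i 0 z], of 1] by simp
  then have 1: "has_pd i (image_sq x) (?n i z) z" for i z
    unfolding image_sq_def[abs_def]
    using has_pd_add[OF has_pd_norm_sq[of i x z] has_pd_mult[OF has_pd_const]] by fastforce
  have "has_pd i (\<lambda>z. 2 * (z $ i - x $ i) + depth x * (- 2 * z $ i))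
     ((0 * (z $ i - x $ i) + 2 * ((if i = i then 1 else 0) - 0)) + (0 * (- 2 * z $ i) + depth x * (0 * z $ i + - 2 * (if i = i then 1 else 0)))) z" for i z
    by (intro has_pd_add has_pd_mult has_pd_diff has_pd_const has_pd_nth)
  then have 2: "has_pd i (?n i) (2 * (norm x)\<^sup>2) z" for i z
    by (rule has_pd_cong) (auto simp: depth_def algebra_simps)
  have "(LINT z|lborel. lap z * (1 / image_sq x z))
     = (LINT z|lborel. w z * (2 * (\<Sum>i\<in>UNIV. (?n i z)\<^sup>2) - 4 * (2 * (norm x)\<^sup>2) * image_sq x z) / (image_sq x z) ^ 3)"
  proof (rule green_inverse_quadratic[OF open_ball K(2) _ _ _ 1 2])
    show "image_sq x z \<noteq> 0" if "z \<in> ball 0 1" for z using image_sq_pos[OF x that] by simp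
    show "continuous_on UNIV (image_sq x)" "continuous_on UNIV (?n i)" for i
      unfolding image_sq_def[abs_def] depth_def by (intro continuous_intros)+
  qed
  moreover have "2 * (\<Sum>i\<in>UNIV. (?n i z)\<^sup>2) - 4 * (2 * (norm x)\<^sup>2) * image_sq x z = 0" for z
  proof -
    define B where "B = (\<Sum>i\<in>UNIV. x $ i * z $ i)"
    have "(norm (z - x))\<^sup>2 = (\<Sum>i\<in>UNIV. (z $ i)\<^sup>2 - 2 * (x $ i * z $ i) + (x $ i)\<^sup>2)"
      unfolding norm_sq_nth by (intro sum.cong) (auto simp: power2_eq_square algebra_simps)
    also have "\<dots> = (norm z)\<^sup>2 - 2 * B + (norm x)\<^sup>2"
      unfolding norm_sq_nth B_def by (simp only: sum.distrib sum_subtractf sum_distrib_left)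
    finally have zx: "(norm (z - x))\<^sup>2 = (norm z)\<^sup>2 - 2 * B + (norm x)\<^sup>2" .
    have "(\<Sum>i\<in>UNIV. (?n i z)\<^sup>2) = (\<Sum>i\<in>UNIV. 4 * (x $ i)\<^sup>2 - 8 * (norm x)\<^sup>2 * (x $ i * z $ i) + 4 * (norm x) ^ 4 * (z $ i)\<^sup>2)"
      by (intro sum.cong refl) (simp add: depth_def power2_eq_square power4_eq_xxxx algebra_simps)
    also have "\<dots> = 4 * (norm x)\<^sup>2 - 8 * (norm x)\<^sup>2 * B + 4 * (norm x) ^ 4 * (norm z)\<^sup>2"
      unfolding norm_sq_nth[of z] B_def
      by (simp only: sum.distrib sum_subtractf sum_distrib_left[symmetric] norm_sq_nth[of x])
    finally show ?thesis
      unfolding image_sq_def zx by (simp add: depth_def power2_eq_square power4_eq_xxxx algebra_simps)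
  qed
  ultimately show ?thesis by simp
qed

lemma regularised_newton:
  assumes e: "0 < e"
  shows "(LINT z|lborel. lap z * (1 / ((norm (z - x))\<^sup>2 + e)))
    = - (LINT z|lborel. 8 * e / ((norm (z - x))\<^sup>2 + e) ^ 3 * w z)"
proof -
  let ?N = "\<lambda>z. (norm (z - x))\<^sup>2 + e"
  let ?n = "\<lambda>i (z::real^4). 2 * (z $ i - x $ i)"
  have N: "0 < ?N z" for z using e by (simp add: add_nonneg_pos)
  have 1: "has_pd i ?N (?n i z) z" for i z
    using has_pd_add[OF has_pd_norm_sq[of i x z] has_pd_const, of e] by simp
  have "has_pd i (?n i) (0 * (z $ i - x $ i) + 2 * ((if i = i then 1 else 0) - 0)) z" for i z
    by (intro has_pd_mult has_pd_diff has_pd_const has_pd_nth)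
  then have 2: "has_pd i (?n i) 2 z" for i z by simp
  have "(LINT z|lborel. lap z * (1 / ?N z))
     = (LINT z|lborel. w z * (2 * (\<Sum>i\<in>UNIV. (?n i z)\<^sup>2) - 4 * 2 * ?N z) / (?N z) ^ 3)"
    by (rule green_inverse_quadratic[OF open_UNIV subset_UNIV _ _ _ 1 2])
       (use N in \<open>auto intro!: continuous_intros simp: less_imp_neq[symmetric]\<close>)
  also have "\<dots> = (LINT z|lborel. - (8 * e / (?N z) ^ 3 * w z))"
  proof (rule Bochner_Integration.integral_cong[OF refl])
    fix z
    have "(\<Sum>i\<in>UNIV. (?n i z)\<^sup>2) = 4 * (norm (z - x))\<^sup>2"
      unfolding norm_sq_nth sum_distrib_left by (intro sum.cong) (auto simp: power2_eq_square algebra_simps)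
    then have "2 * (\<Sum>i\<in>UNIV. (?n i z)\<^sup>2) - 4 * 2 * ?N z = - (8 * e)" by simp
    then show "w z * (2 * (\<Sum>i\<in>UNIV. (?n i z)\<^sup>2) - 4 * 2 * ?N z) / (?N z) ^ 3 = - (8 * e / (?N z) ^ 3 * w z)"
      by (simp only:) simp
  qed
  finally show ?thesis by simp
qed

text \<open>
  Only an upper bound is needed, so the regularisation has to be removed on one side only. On the support of \<open>w\<close> and for
  small \<open>e\<close> the regularised Green function is still nonnegative and lies below the true one.
\<close>

lemma newton_pointwise:
  assumes x: "x \<in> ball 0 1"
  shows "ennreal (4 * pi\<^sup>2 * \<bar>iconf x * w x\<bar>) \<le> (\<integral>\<^sup>+z. ennreal (kern x z * \<bar>iconf z * lap z\<bar>) \<partial>lborel)"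
proof -
  have bqx: "0 < iconf x" using iconf_pos[OF x] .
  have [measurable]: "lap \<in> borel_measurable borel" "iconf \<in> borel_measurable borel"
    by (auto intro: borel_measurable_continuous_onI lap_cont iconf_cont)
  obtain M where M: "\<And>z. \<bar>w z\<bar> \<le> M"
  proof -
    have "compact (w ` K)" by (intro compact_continuous_image K continuous_on_subset[OF w_cont]) auto
    then obtain B where "\<And>y. y \<in> w ` K \<Longrightarrow> norm y \<le> B" "0 < B"
      using compact_imp_bounded bounded_pos by metis
    then have "\<bar>w z\<bar> \<le> B" for z using w_off[of z] by (cases "z \<in> K") auto
    then show thesis using that by blast
  qed
  \<comment> \<open>For \<open>e \<le> m\<close> the regularised kernel dominates the image term on the support.\<close>
  obtain m where m: "0 < m" "\<And>z. z \<in> K \<Longrightarrow> m \<le> depth x * depth z"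
  proof (cases "K = {}")
    case True then show thesis using that[of 1] by auto
  next
    case False
    have "continuous_on K (\<lambda>z. depth x * depth z)" unfolding depth_def by (intro continuous_intros)
    then obtain z0 where "z0 \<in> K" "\<And>z. z \<in> K \<Longrightarrow> depth x * depth z0 \<le> depth x * depth z"
      using continuous_attains_inf[OF K(1) False] by blast
    then show thesis using that[of "depth x * depth z0"] depth_pos[OF x] depth_pos[of z0] K(2) by auto
  qed
  let ?B = "\<integral>\<^sup>+z. ennreal (kern x z * \<bar>iconf z * lap z\<bar>) \<partial>lborel"
  have main: "ennreal (\<bar>iconf x * (LINT z|lborel. 8 * e / ((norm (z - x))\<^sup>2 + e) ^ 3 * w z)\<bar>) \<le> ?B"
    if e: "0 < e" "e \<le> m" for e
  proof -
    let ?N = "\<lambda>z. (norm (z - x))\<^sup>2 + e"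
    have N: "0 < ?N z" for z using e by (simp add: add_nonneg_pos)
    let ?f = "\<lambda>z. lap z * (iconf x * (1 / ?N z - 1 / image_sq x z))"
    have c1: "continuous_on UNIV (\<lambda>z. lap z * (1 / ?N z))"
      using N by (auto intro!: continuous_intros lap_cont simp: less_imp_neq[symmetric])
    have "continuous_on (ball 0 1) (image_sq x)" unfolding image_sq_def[abs_def] depth_def by (intro continuous_intros)
    then have c2: "continuous_on UNIV (\<lambda>z. lap z * (1 / image_sq x z))"
      by (intro continuous_mult_support[OF K_closed K(2) open_ball lap_off lap_cont] continuous_intros)
         (use image_sq_pos[OF x] in force)+
    have i: "integrable lborel (\<lambda>z. lap z * (1 / ?N z))" "integrable lborel (\<lambda>z. lap z * (1 / image_sq x z))"
      by (rule integrable_compact_support[OF _ K(1)]; use c1 c2 in \<open>simp add: lap_off\<close>)+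
    have eq: "?f z = iconf x * (lap z * (1 / ?N z)) - iconf x * (lap z * (1 / image_sq x z))" for z
      by (simp add: algebra_simps)
    have "(LINT z|lborel. ?f z) = iconf x * (LINT z|lborel. lap z * (1 / ?N z)) - iconf x * (LINT z|lborel. lap z * (1 / image_sq x z))"
      unfolding eq by (subst Bochner_Integration.integral_diff) (use i in \<open>simp_all del: times_divide_eq_right\<close>)
    also have "\<dots> = - (iconf x * (LINT z|lborel. 8 * e / ?N z ^ 3 * w z))"
      unfolding image_term_vanishes[OF x] regularised_newton[OF e(1)] by simp
    finally have "ennreal (\<bar>iconf x * (LINT z|lborel. 8 * e / ?N z ^ 3 * w z)\<bar>) = ennreal \<bar>LINT z|lborel. ?f z\<bar>"
      by simp
    also have "\<dots> \<le> ennreal (LINT z|lborel. \<bar>?f z\<bar>)"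
      by (intro ennreal_leI integral_abs_bound)
    also have "\<dots> = (\<integral>\<^sup>+z. ennreal \<bar>?f z\<bar> \<partial>lborel)"
      unfolding eq by (rule nn_integral_eq_integral[symmetric]) (use i in \<open>auto simp del: times_divide_eq_right\<close>)
    also have "\<dots> \<le> ?B"
    proof (rule nn_integral_mono_AE)
      have "AE z in lborel. z \<noteq> x" by (rule AE_lborel_singleton)
      then show "AE z in lborel. ennreal \<bar>?f z\<bar> \<le> ennreal (kern x z * \<bar>iconf z * lap z\<bar>)"
      proof eventually_elim
        case (elim z)
        show ?case
        proof (cases "z \<in> K")
          case True
          then have z: "z \<in> ball 0 1" using K by auto
          have n0: "0 < (norm (z - x))\<^sup>2" using elim by simp
          have d0: "0 < image_sq x z" using image_sq_pos[OF x z] .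
          have "1 / image_sq x z \<le> 1 / ?N z"
            using m(2)[OF True] e N[of z] by (intro divide_left_mono) (auto simp: image_sq_def)
          moreover have "1 / ?N z \<le> 1 / (norm (z - x))\<^sup>2"
            using e n0 N[of z] by (intro divide_left_mono) auto
          ultimately have "\<bar>1 / ?N z - 1 / image_sq x z\<bar> \<le> 1 / (norm (z - x))\<^sup>2 - 1 / image_sq x z" by simp
          also have "\<dots> = depth x * depth z / ((norm (z - x))\<^sup>2 * image_sq x z)"
            using n0 d0 by (simp add: image_sq_def field_simps)
          finally have "iconf x * \<bar>1 / ?N z - 1 / image_sq x z\<bar> \<le> iconf x * (depth x * depth z / ((norm (z - x))\<^sup>2 * image_sq x z))"
            using bqx by (intro mult_left_mono) auto
          also have "\<dots> = kern x z * iconf z"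
            by (simp add: kern_def iconf_def depth_def power2_eq_square)
          finally have "\<bar>lap z\<bar> * (iconf x * \<bar>1 / ?N z - 1 / image_sq x z\<bar>) \<le> \<bar>lap z\<bar> * (kern x z * iconf z)"
            by (intro mult_left_mono) auto
          then have "\<bar>?f z\<bar> \<le> kern x z * \<bar>iconf z * lap z\<bar>"
            using bqx iconf_pos[OF z] by (simp add: abs_mult mult_ac)
          then show ?thesis by (rule ennreal_leI)
        qed (simp add: lap_off)
      qed
    qed
    finally show ?thesis .
  qed
  define s where "s n = inverse (real (Suc n))" for n
  have s: "s \<longlonglongrightarrow> 0" "\<And>n. 0 < s n" unfolding s_def[abs_def] by (rule LIMSEQ_inverse_real_of_nat, simp)
  have "(\<lambda>n. ennreal (\<bar>iconf x * (LINT z|lborel. 8 * (s n)\<^sup>2 / ((norm (z - x))\<^sup>2 + (s n)\<^sup>2) ^ 3 * w z)\<bar>))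
      \<longlonglongrightarrow> ennreal \<bar>iconf x * (4 * pi\<^sup>2 * w x)\<bar>"
    by (intro tendsto_ennrealI tendsto_intros cauchy_kernel_approx_identity[OF w_cont M s])
  moreover have "\<forall>\<^sub>F n in sequentially. (s n)\<^sup>2 \<le> m"
  proof -
    have "(\<lambda>n. (s n)\<^sup>2) \<longlonglongrightarrow> 0\<^sup>2" by (intro tendsto_intros s)
    then have "\<forall>\<^sub>F n in sequentially. (s n)\<^sup>2 < m" using m(1) by (intro order_tendstoD(2)) auto
    then show ?thesis by eventually_elim simp
  qed
  then have "\<forall>\<^sub>F n in sequentially. ennreal (\<bar>iconf x * (LINT z|lborel. 8 * (s n)\<^sup>2 / ((norm (z - x))\<^sup>2 + (s n)\<^sup>2) ^ 3 * w z)\<bar>) \<le> ?B"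
    by eventually_elim (rule main, auto simp: less_imp_neq[OF s(2), symmetric])
  ultimately have "ennreal \<bar>iconf x * (4 * pi\<^sup>2 * w x)\<bar> \<le> ?B"
    by (intro tendsto_upperbound) auto
  then show ?thesis by (simp add: abs_mult mult_ac)
qed

end

section \<open>Estimates for the Green kernel\<close>

lemma ennreal_le_of_square:
  assumes "(I::ennreal)\<^sup>2 \<le> ennreal (c\<^sup>2)" "0 \<le> c"
  shows "I \<le> ennreal c"
proof (cases I)
  case (real r)
  then have "r\<^sup>2 \<le> c\<^sup>2" using assms by (simp add: ennreal_power)
  then show ?thesis using real assms by (simp add: power2_le_iff_abs_le ennreal_leI)
next
  case top
  then show ?thesis using assms(1) by (simp add: ennreal_top_eq_mult_iff power2_eq_square top_unique)
qed

lemma nn_integral_cauchy_schwarz: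
  assumes [measurable]: "f \<in> borel_measurable M" "g \<in> borel_measurable M"
    and f: "(\<integral>\<^sup>+x. (f x)\<^sup>2 \<partial>M) \<le> ennreal (a\<^sup>2)" and g: "(\<integral>\<^sup>+x. (g x)\<^sup>2 \<partial>M) \<le> ennreal (b\<^sup>2)"
    and ab: "0 \<le> a" "0 \<le> b"
  shows "(\<integral>\<^sup>+x. f x * g x \<partial>M) \<le> ennreal (a * b)"
proof (rule ennreal_le_of_square)
  have "(\<integral>\<^sup>+x. f x * g x \<partial>M)\<^sup>2 \<le> (\<integral>\<^sup>+x. (f x)\<^sup>2 \<partial>M) * (\<integral>\<^sup>+x. (g x)\<^sup>2 \<partial>M)"
    by (rule Cauchy_Schwarz_nn_integral) measurable
  also have "\<dots> \<le> ennreal (a\<^sup>2) * ennreal (b\<^sup>2)" by (intro mult_mono f g) auto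
  finally show "(\<integral>\<^sup>+x. f x * g x \<partial>M)\<^sup>2 \<le> ennreal ((a * b)\<^sup>2)"
    by (simp add: ennreal_mult[symmetric] power_mult_distrib)
qed (use ab in auto)

text \<open>
  Comparability of the conformal factor on balls of radius a quarter of \<open>depth x\<close>; all near-diagonal estimates use it.
\<close>

lemma depth_lipschitz:
  assumes "x \<in> ball 0 1" "z \<in> ball 0 1"
  shows "depth x - 2 * norm (z - x) \<le> depth z"
proof -
  have "(norm z)\<^sup>2 - (norm x)\<^sup>2 = (norm z - norm x) * (norm z + norm x)"
    by (simp add: power2_eq_square algebra_simps)
  also have "\<dots> \<le> norm (z - x) * (norm z + norm x)"
    by (intro mult_right_mono norm_triangle_ineq2) auto
  also have "\<dots> \<le> norm (z - x) * 2"
    using assms by (intro mult_left_mono) auto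
  finally show ?thesis by (simp add: depth_def)
qed

lemma depth_lipschitz_abs:
  assumes "x \<in> ball 0 1" "z \<in> ball 0 1"
  shows "depth z \<le> depth x + 2 * norm (z - x)"
  using depth_lipschitz[OF assms(2,1)] by (simp add: norm_minus_commute)

lemma image_sq_ge:
  assumes x: "x \<in> ball 0 1" and z: "z \<in> ball 0 1"
  shows "(norm (z - x))\<^sup>2 \<le> image_sq x z" "(depth x)\<^sup>2 - 2 * depth x * norm (z - x) \<le> image_sq x z" "(depth x)\<^sup>2 / 4 \<le> image_sq x z"
proof -
  have r: "0 < depth x" "0 < depth z" using depth_pos x z by auto
  show 1: "(norm (z - x))\<^sup>2 \<le> image_sq x z" using r by (simp add: image_sq_def)
  have "depth x * (depth x - 2 * norm (z - x)) \<le> depth x * depth z"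
    using r by (intro mult_left_mono depth_lipschitz x z) auto
  then have "(depth x)\<^sup>2 - 2 * depth x * norm (z - x) + (norm (z - x))\<^sup>2 \<le> image_sq x z"
    by (simp add: image_sq_def power2_eq_square algebra_simps)
  then show 2: "(depth x)\<^sup>2 - 2 * depth x * norm (z - x) \<le> image_sq x z"
    using zero_le_power2[of "norm (z - x)"] by linarith
  have 3: "(depth x - norm (z - x))\<^sup>2 \<le> image_sq x z"
    using \<open>(depth x)\<^sup>2 - 2 * depth x * norm (z - x) + (norm (z - x))\<^sup>2 \<le> image_sq x z\<close>
    by (simp add: power2_eq_square algebra_simps)
  show "(depth x)\<^sup>2 / 4 \<le> image_sq x z"
  proof (cases "norm (z - x) \<le> depth x / 2")
    case True
    then have "(depth x / 2)\<^sup>2 \<le> (depth x - norm (z - x))\<^sup>2" using r by (intro power_mono) auto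
    with 3 show ?thesis by (simp add: power_divide)
  next
    case False
    then have "(depth x / 2)\<^sup>2 \<le> (norm (z - x))\<^sup>2" using r by (intro power_mono) auto
    with 1 show ?thesis by (simp add: power_divide)
  qed
qed

text \<open>
  The last bound has the exact constant 1 on the diagonal, which the sharp exponent requires; its error factor is
  integrable against \<open>dr / r\<close>. The third bound decays fast enough to be square integrable away from the diagonal, which
  is the effect of the image term.
\<close>

lemma kern_bounds:
  assumes x: "x \<in> ball 0 1" and z: "z \<in> ball 0 1"
  shows "0 \<le> kern x z" "kern x z \<le> 4 / (norm (z - x))\<^sup>2" "kern x z \<le> (depth x)\<^sup>2 / (norm (z - x)) ^ 4"
    "norm (z - x) \<le> depth x / 4 \<Longrightarrow> (kern x z)\<^sup>2 \<le> (1 + 12 * norm (z - x) / depth x) / (norm (z - x)) ^ 4"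
proof -
  note D = image_sq_ge[OF x z]
  have d: "0 < image_sq x z" using image_sq_pos[OF x z] .
  have r: "0 < depth x" using depth_pos[OF x] .
  show "0 \<le> kern x z" using d by (simp add: kern_def)
  have *: "kern x z \<le> 4 / (norm (z - x))\<^sup>2 \<and> kern x z \<le> (depth x)\<^sup>2 / (norm (z - x)) ^ 4 \<and>
     (norm (z - x) \<le> depth x / 4 \<longrightarrow> (kern x z)\<^sup>2 \<le> (1 + 12 * norm (z - x) / depth x) / (norm (z - x)) ^ 4)"
  proof (cases "z = x")
    case True then show ?thesis by (simp add: kern_def)
  next
    case False
    define n where "n = norm (z - x)"
    have n: "0 < n" using False by (simp add: n_def)
    have k: "kern x z = (depth x)\<^sup>2 / image_sq x z / n\<^sup>2" by (simp add: kern_def n_def)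
    have "(depth x)\<^sup>2 / image_sq x z \<le> 4" using D(3) d by (simp add: field_simps)
    then have 1: "kern x z \<le> 4 / n\<^sup>2" unfolding k by (intro divide_right_mono) auto
    have "(depth x)\<^sup>2 / image_sq x z \<le> (depth x)\<^sup>2 / n\<^sup>2" using D(1) d n by (intro divide_left_mono) (auto simp: n_def)
    then have "kern x z \<le> (depth x)\<^sup>2 / n\<^sup>2 / n\<^sup>2" unfolding k by (intro divide_right_mono) auto
    then have 2: "kern x z \<le> (depth x)\<^sup>2 / n ^ 4" by (simp add: power2_eq_square power4_eq_xxxx)
    have 3: "(kern x z)\<^sup>2 \<le> (1 + 12 * n / depth x) / n ^ 4" if nr: "n \<le> depth x / 4"
    proof -
      define s where "s = n / depth x"
      have s: "0 \<le> s" "s \<le> 1 / 4" using n r nr by (auto simp: s_def field_simps)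
      have "(depth x)\<^sup>2 * (1 - 2 * s) \<le> image_sq x z"
        using D(2) r by (simp add: s_def n_def power2_eq_square algebra_simps)
      then have le: "(depth x)\<^sup>2 / image_sq x z \<le> 1 / (1 - 2 * s)"
        using d s by (simp add: field_simps)
      have "((depth x)\<^sup>2 / image_sq x z)\<^sup>2 \<le> (1 / (1 - 2 * s))\<^sup>2"
        using le d by (intro power_mono) auto
      also have "\<dots> \<le> 1 + 12 * s"
      proof -
        \<comment> \<open>The product below is \<open>(1 + 12 s) (1 - 2 s)^2 - 1\<close>.\<close>
        have "0 \<le> s * (4 * ((1 - 4 * s) * (2 - 3 * s)))" using s by (intro mult_nonneg_nonneg) auto
        then have "1 \<le> (1 + 12 * s) * (1 - 2 * s)\<^sup>2"
          by (simp add: power2_eq_square algebra_simps)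
        then show ?thesis using s by (simp add: power_divide divide_simps)
      qed
      finally have "((depth x)\<^sup>2 / image_sq x z)\<^sup>2 / n ^ 4 \<le> (1 + 12 * s) / n ^ 4"
        using n by (intro divide_right_mono) auto
      moreover have "(kern x z)\<^sup>2 = ((depth x)\<^sup>2 / image_sq x z)\<^sup>2 / n ^ 4"
        unfolding k by (simp add: power_divide power2_eq_square power4_eq_xxxx)
      ultimately show ?thesis by (simp add: s_def)
    qed
    from 1 2 3 show ?thesis by (simp add: n_def)
  qed
  then show "kern x z \<le> 4 / (norm (z - x))\<^sup>2" "kern x z \<le> (depth x)\<^sup>2 / (norm (z - x)) ^ 4"
    "norm (z - x) \<le> depth x / 4 \<Longrightarrow> (kern x z)\<^sup>2 \<le> (1 + 12 * norm (z - x) / depth x) / (norm (z - x)) ^ 4"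
    by blast+
qed

definition green_k :: "real^4 \<Rightarrow> real^4 \<Rightarrow> ennreal" where
  "green_k x z = (if norm z < 1 then ennreal (kern x z) else 0)"

lemma green_k_measurable [measurable (raw)]:
  assumes [measurable]: "f \<in> borel_measurable M" "g \<in> borel_measurable M"
  shows "(\<lambda>x. green_k (f x) (g x)) \<in> borel_measurable M"
  unfolding green_k_def by measurable

definition ln_pos :: "real \<Rightarrow> real" where "ln_pos t = max 0 (ln t)"

lemma ln_pos_nonneg [simp]: "0 \<le> ln_pos t" by (simp add: ln_pos_def)

lemma nn_integral_inverse_fourth_tail:
  fixes x :: "real^4"
  assumes "0 < a" and c: "0 \<le> c"
  shows "(\<integral>\<^sup>+z. ennreal (c / (norm (z - x)) ^ 8) * indicator {z. a \<le> norm (z - x)} z \<partial>lborel)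
    = ennreal (c * pi\<^sup>2 / (2 * a ^ 4))"
proof -
  have "(\<integral>\<^sup>+z. ennreal (c / (norm (z - x)) ^ 8) * indicator {z. a \<le> norm (z - x)} z \<partial>lborel)
    = ennreal (0 - (- (c * pi\<^sup>2 / 2) * inverse (a ^ 4)))"
  proof (rule nn_integral_radial_atLeast[where g="\<lambda>r. c / r ^ 8"])
    show "((\<lambda>r. - (c * pi\<^sup>2 / 2) * inverse (r ^ 4)) has_real_derivative 2 * pi\<^sup>2 * r ^ 3 * (c / r ^ 8)) (at r)"
      if "a \<le> r" for r
    proof -
      define i where "i = inverse (r ^ 4)"
      have r: "r \<noteq> 0" using assms that by auto
      have "((\<lambda>r. inverse (r ^ 4)) has_real_derivative - (i * (4 * r ^ 3) * i)) (at r)"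
        using r by (auto intro!: derivative_eq_intros simp: i_def)
      from DERIV_cmult[OF this, of "- (c * pi\<^sup>2 / 2)"]
      have "((\<lambda>r. - (c * pi\<^sup>2 / 2) * inverse (r ^ 4)) has_real_derivative
        - (c * pi\<^sup>2 / 2) * - (i * (4 * r ^ 3) * i)) (at r)" .
      moreover have "c / r ^ 8 = c * (i * i)"
        by (simp add: i_def divide_inverse flip: inverse_mult_distrib power_add)
      ultimately show ?thesis by (simp add: mult_ac)
    qed
    have "((\<lambda>r::real. inverse (r ^ 4)) \<longlongrightarrow> 0) at_top"
      by (intro tendsto_inverse_0_at_top filterlim_pow_at_top filterlim_ident) auto
    from tendsto_mult_left[OF this, of "- (c * pi\<^sup>2 / 2)"]
    show "((\<lambda>r. - (c * pi\<^sup>2 / 2) * inverse (r ^ 4)) \<longlongrightarrow> 0) at_top" by simp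
  qed (use assms in auto)
  also have "0 - (- (c * pi\<^sup>2 / 2) * inverse (a ^ 4)) = c * pi\<^sup>2 / (2 * a ^ 4)"
    using assms(1) by (simp add: field_simps)
  finally show ?thesis .
qed

lemma nn_integral_inverse_square_ball:
  fixes x :: "real^4"
  assumes "0 \<le> b" "0 \<le> c"
  shows "(\<integral>\<^sup>+z. ennreal (c / (norm (z - x))\<^sup>2) * indicator {z. norm (z - x) \<le> b} z \<partial>lborel)
    = ennreal (c * pi\<^sup>2 * b\<^sup>2)"
proof -
  have "(\<integral>\<^sup>+z. ennreal (c / (norm (z - x))\<^sup>2) * indicator {z. 0 \<le> norm (z - x) \<and> norm (z - x) \<le> b} z \<partial>lborel)
    = ennreal (c * pi\<^sup>2 * b\<^sup>2 - c * pi\<^sup>2 * 0\<^sup>2)"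
  proof (rule nn_integral_radial_Icc[where g="\<lambda>r. c / r\<^sup>2"])
    show "((\<lambda>r. c * pi\<^sup>2 * r\<^sup>2) has_real_derivative 2 * pi\<^sup>2 * r ^ 3 * (c / r\<^sup>2)) (at r)" for r
      by (cases "r = 0"; auto intro!: derivative_eq_intros simp: power2_eq_square power3_eq_cube)
  qed (use assms in auto)
  then show ?thesis by simp
qed

text \<open>
  The annulus \<open>d/2 \<le> |z - x| \<le> depth x / 4\<close> contributes the logarithm and the outer part a constant.
\<close>

lemma kern_square_tail:
  assumes x: "x \<in> ball 0 1" and d: "0 < d"
  shows "(\<integral>\<^sup>+z. (green_k x z)\<^sup>2 * indicator {z. d / 2 \<le> norm (z - x)} z \<partial>lborel)
    \<le> ennreal (2 * pi\<^sup>2 * ln_pos (depth x / d) + 134 * pi\<^sup>2)"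
proof -
  have r: "0 < depth x" using depth_pos[OF x] .
  let ?n = "\<lambda>z. norm (z - x)"
  let ?g1 = "\<lambda>r. (1 + 12 * r / depth x) / r ^ 4"
  let ?g2 = "\<lambda>r. (depth x) ^ 4 / r ^ 8"
  have pw: "(green_k x z)\<^sup>2 * indicator {z. d / 2 \<le> ?n z} z
      \<le> ennreal (?g1 (?n z)) * indicator {z. d / 2 \<le> ?n z \<and> ?n z \<le> depth x / 4} z
        + ennreal (?g2 (?n z)) * indicator {z. depth x / 4 \<le> ?n z} z" for z
  proof (cases "z \<in> ball 0 1 \<and> d / 2 \<le> ?n z")
    case False then show ?thesis by (auto simp: green_k_def)
  next
    case True
    then have z: "z \<in> ball 0 1" and dz: "d / 2 \<le> ?n z" by auto
    note k = kern_bounds[OF x z]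
    have green_k: "(green_k x z)\<^sup>2 = ennreal ((kern x z)\<^sup>2)" using z k(1) by (simp add: green_k_def ennreal_power)
    show ?thesis
    proof (cases "?n z \<le> depth x / 4")
      case True
      have "(green_k x z)\<^sup>2 \<le> ennreal (?g1 (?n z))" unfolding green_k using k(4)[OF True] by (rule ennreal_leI)
      then show ?thesis using True dz by (auto simp: add_increasing2)
    next
      case False
      have "(kern x z)\<^sup>2 \<le> ((depth x)\<^sup>2 / (?n z) ^ 4)\<^sup>2" using k(1,3) by (intro power_mono) auto
      then have "(green_k x z)\<^sup>2 \<le> ennreal (?g2 (?n z))"
        unfolding green_k by (intro ennreal_leI) (simp add: power_divide)
      then show ?thesis using False dz by (auto simp: add_increasing)
    qed
  qed
  have far: "(\<integral>\<^sup>+z. ennreal (?g2 (?n z)) * indicator {z. depth x / 4 \<le> ?n z} z \<partial>lborel) = ennreal (128 * pi\<^sup>2)"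
    using r by (subst nn_integral_inverse_fourth_tail) (auto simp: power_divide)
  have near: "(\<integral>\<^sup>+z. ennreal (?g1 (?n z)) * indicator {z. d / 2 \<le> ?n z \<and> ?n z \<le> depth x / 4} z \<partial>lborel)
      \<le> ennreal (2 * pi\<^sup>2 * ln_pos (depth x / d) + 6 * pi\<^sup>2)"
  proof (cases "d / 2 \<le> depth x / 4")
    case False
    then have "{z. d / 2 \<le> ?n z \<and> ?n z \<le> depth x / 4} = {}" by auto
    then show ?thesis by simp
  next
    case True
    let ?F = "\<lambda>r. 2 * pi\<^sup>2 * (ln r + 12 * r / depth x)"
    have "(\<integral>\<^sup>+z. ennreal (?g1 (?n z)) * indicator {z. d / 2 \<le> ?n z \<and> ?n z \<le> depth x / 4} z \<partial>lborel)
      = ennreal (?F (depth x / 4) - ?F (d / 2))"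
    proof (rule nn_integral_radial_Icc[where g="?g1"])
      show "(?F has_real_derivative 2 * pi\<^sup>2 * s ^ 3 * ?g1 s) (at s)" if "d / 2 \<le> s" for s
      proof -
        have "0 < s" using d that by auto
        then show ?thesis
          using r by (auto intro!: derivative_eq_intros simp: field_simps power4_eq_xxxx power3_eq_cube)
      qed
    qed (use True d r in auto)
    also have "\<dots> \<le> ennreal (2 * pi\<^sup>2 * ln_pos (depth x / d) + 6 * pi\<^sup>2)"
    proof (rule ennreal_leI)
      have "ln (depth x / 4) = ln (depth x) - ln 4" "ln (d / 2) = ln d - ln 2" "ln (depth x / d) = ln (depth x) - ln d"
        using r d by (simp_all add: ln_divide_pos)
      moreover have "ln 2 \<le> ln (4::real)" by (subst ln_le_cancel_iff) auto
      moreover have "ln (depth x / d) \<le> ln_pos (depth x / d)" by (simp add: ln_pos_def)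
      ultimately have "ln (depth x / 4) - ln (d / 2) \<le> ln_pos (depth x / d)" by linarith
      moreover have "12 * (depth x / 4) / depth x = 3" "0 \<le> 12 * (d / 2) / depth x" using r d by auto
      ultimately have "ln (depth x / 4) + 12 * (depth x / 4) / depth x - (ln (d / 2) + 12 * (d / 2) / depth x) \<le> ln_pos (depth x / d) + 3"
        by linarith
      then have "2 * pi\<^sup>2 * (ln (depth x / 4) + 12 * (depth x / 4) / depth x - (ln (d / 2) + 12 * (d / 2) / depth x)) \<le> 2 * pi\<^sup>2 * (ln_pos (depth x / d) + 3)"
        by (intro mult_left_mono) auto
      then show "?F (depth x / 4) - ?F (d / 2) \<le> 2 * pi\<^sup>2 * ln_pos (depth x / d) + 6 * pi\<^sup>2"
        by (simp add: algebra_simps)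
    qed
    finally show ?thesis .
  qed
  have "(\<integral>\<^sup>+z. (green_k x z)\<^sup>2 * indicator {z. d / 2 \<le> ?n z} z \<partial>lborel)
    \<le> (\<integral>\<^sup>+z. ennreal (?g1 (?n z)) * indicator {z. d / 2 \<le> ?n z \<and> ?n z \<le> depth x / 4} z
        + ennreal (?g2 (?n z)) * indicator {z. depth x / 4 \<le> ?n z} z \<partial>lborel)"
    by (intro nn_integral_mono pw)
  also have "\<dots> = (\<integral>\<^sup>+z. ennreal (?g1 (?n z)) * indicator {z. d / 2 \<le> ?n z \<and> ?n z \<le> depth x / 4} z \<partial>lborel)
     + (\<integral>\<^sup>+z. ennreal (?g2 (?n z)) * indicator {z. depth x / 4 \<le> ?n z} z \<partial>lborel)"
    by (rule nn_integral_add) measurable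
  also have "\<dots> \<le> ennreal (2 * pi\<^sup>2 * ln_pos (depth x / d) + 6 * pi\<^sup>2) + ennreal (128 * pi\<^sup>2)"
    using near far by (intro add_mono) auto
  also have "\<dots> = ennreal (2 * pi\<^sup>2 * ln_pos (depth x / d) + 134 * pi\<^sup>2)"
    by (subst ennreal_plus[symmetric]) auto
  finally show ?thesis .
qed

text \<open>
  Away from both poles the product is at most half the sum of the squares, and near one pole the other factor is of
  order \<open>1 / d^2\<close>. Both halves of the arithmetic-geometric bound produce the same logarithm, so that its
  coefficient \<open>2 \<pi>^2\<close> is the exact one.
\<close>

lemma kern_composition:
  assumes x: "x \<in> ball 0 1" and y: "y \<in> ball 0 1" and xy: "x \<noteq> y"
  shows "(\<integral>\<^sup>+z. green_k x z * green_k y z \<partial>lborel) \<le> ennreal (2 * pi\<^sup>2 * ln_pos (depth x / norm (x - y)) + 168 * pi\<^sup>2)"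
proof -
  define d where "d = norm (x - y)"
  have d: "0 < d" using xy by (simp add: d_def)
  let ?N = "\<lambda>p z. ennreal (64 / d\<^sup>2 / (norm (z - p))\<^sup>2) * indicator {z. norm (z - p) \<le> d / 2} z"
  let ?T = "\<lambda>p z. ennreal (1/2) * ((green_k p z)\<^sup>2 * indicator {z. d / 2 \<le> norm (z - p)} z)"
  have near: "green_k p z * green_k p' z \<le> ?N p z" if p: "p \<in> ball 0 1" "p' \<in> ball 0 1" "norm (p - p') = d" "norm (z - p) \<le> d / 2" for p p' z
  proof (cases "z \<in> ball 0 1")
    case True
    have "norm (p - p') \<le> norm (z - p') + norm (z - p)"
      using norm_triangle_ineq4[of "z - p'" "z - p"] by simp
    then have z: "d / 2 \<le> norm (z - p')" using p by simp
    have "kern p z \<le> 4 / (norm (z - p))\<^sup>2" "0 \<le> kern p z" using kern_bounds p True by auto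
    moreover have "kern p' z \<le> 4 / (norm (z - p'))\<^sup>2" "0 \<le> kern p' z" using kern_bounds p True by auto
    moreover have "4 / (norm (z - p'))\<^sup>2 \<le> 4 / (d / 2)\<^sup>2"
      using z d by (intro divide_left_mono power_mono mult_pos_pos zero_less_power) auto
    ultimately have "kern p z * kern p' z \<le> 4 / (norm (z - p))\<^sup>2 * (4 / (d / 2)\<^sup>2)"
      by (intro mult_mono) auto
    also have "\<dots> = 64 / d\<^sup>2 / (norm (z - p))\<^sup>2" by (simp add: power_divide)
    finally show ?thesis
      using True p(4) \<open>0 \<le> kern p z\<close> \<open>0 \<le> kern p' z\<close> by (simp add: green_k_def ennreal_mult[symmetric] ennreal_leI)
  qed (simp add: green_k_def)
  have half_square: "ennreal (1/2 * a\<^sup>2) = ennreal (1/2) * (ennreal a)\<^sup>2" if "0 \<le> a" for a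
    using that by (subst ennreal_power, simp, subst ennreal_mult[symmetric]) auto
  have pw: "green_k x z * green_k y z \<le> (?N x z + ?N y z) + (?T x z + ?T y z)" for z
  proof -
    consider "norm (z - x) \<le> d / 2" | "norm (z - y) \<le> d / 2" | "d / 2 \<le> norm (z - x)" "d / 2 \<le> norm (z - y)"
      by linarith
    then show ?thesis
    proof cases
      case 1
      show ?thesis using near[of x y z] x y 1 by (auto simp: d_def add_increasing2 add_increasing)
    next
      case 2
      have "green_k x z * green_k y z \<le> ?N y z" using near[of y x z] x y 2 by (simp add: d_def norm_minus_commute mult.commute)
      then show ?thesis by (simp add: add_increasing2 add_increasing)
    next
      case 3
      have "green_k x z * green_k y z \<le> ennreal (1/2) * (green_k x z)\<^sup>2 + ennreal (1/2) * (green_k y z)\<^sup>2"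
      proof (cases "z \<in> ball 0 1")
        case True
        have k: "0 \<le> kern x z" "0 \<le> kern y z" using kern_bounds x y True by auto
        have "kern x z * kern y z \<le> 1/2 * (kern x z)\<^sup>2 + 1/2 * (kern y z)\<^sup>2"
          using sum_squares_bound[of "kern x z" "kern y z"] by simp
        then have "ennreal (kern x z * kern y z) \<le> ennreal (1/2 * (kern x z)\<^sup>2 + 1/2 * (kern y z)\<^sup>2)"
          by (rule ennreal_leI)
        also have "\<dots> = ennreal (1/2 * (kern x z)\<^sup>2) + ennreal (1/2 * (kern y z)\<^sup>2)"
          by (rule ennreal_plus) auto
        also have "\<dots> = ennreal (1/2) * (ennreal (kern x z))\<^sup>2 + ennreal (1/2) * (ennreal (kern y z))\<^sup>2"
          by (simp only: half_square[OF k(1)] half_square[OF k(2)])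
        finally show ?thesis using True k by (simp add: green_k_def ennreal_mult)
      qed (simp add: green_k_def)
      then show ?thesis using 3 by (simp add: add_increasing)
    qed
  qed
  have N: "(\<integral>\<^sup>+z. ?N p z \<partial>lborel) = ennreal (16 * pi\<^sup>2)" for p :: "real^4"
    using d by (subst nn_integral_inverse_square_ball) (auto simp: power_divide)
  have T: "(\<integral>\<^sup>+z. ?T p z \<partial>lborel) \<le> ennreal (pi\<^sup>2 * ln_pos (depth p / d) + 67 * pi\<^sup>2)" if "p \<in> ball 0 1" for p
  proof -
    have "(\<integral>\<^sup>+z. ?T p z \<partial>lborel) = ennreal (1/2) * (\<integral>\<^sup>+z. (green_k p z)\<^sup>2 * indicator {z. d / 2 \<le> norm (z - p)} z \<partial>lborel)"
      by (rule nn_integral_cmult) measurable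
    also have "\<dots> \<le> ennreal (1/2) * ennreal (2 * pi\<^sup>2 * ln_pos (depth p / d) + 134 * pi\<^sup>2)"
      by (intro mult_left_mono kern_square_tail that d) auto
    also have "\<dots> = ennreal (1/2 * (2 * pi\<^sup>2 * ln_pos (depth p / d) + 134 * pi\<^sup>2))"
      by (rule ennreal_mult[symmetric]) auto
    also have "1/2 * (2 * pi\<^sup>2 * ln_pos (depth p / d) + 134 * pi\<^sup>2) = pi\<^sup>2 * ln_pos (depth p / d) + 67 * pi\<^sup>2"
      by (simp add: algebra_simps)
    finally show ?thesis .
  qed
  have l: "ln_pos (depth y / d) \<le> ln_pos (depth x / d) + 2"
  proof -
    have r: "0 < depth x" "0 < depth y" using depth_pos x y by auto
    have "depth y / d \<le> depth x / d + 2"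
      using depth_lipschitz_abs[OF x y] d by (simp add: field_simps d_def norm_minus_commute)
    also have "\<dots> \<le> 3 * max 1 (depth x / d)" by simp
    finally have "ln (depth y / d) \<le> ln (3 * max 1 (depth x / d))"
      using r d by (subst ln_le_cancel_iff) auto
    also have "\<dots> = ln 3 + ln (max 1 (depth x / d))" by (subst ln_mult) auto
    also have "ln (max 1 (depth x / d)) = ln_pos (depth x / d)"
      using r d by (auto simp: ln_pos_def max_def ln_ge_zero_iff not_le field_simps)
    also have "ln 3 \<le> (2::real)" using ln_le_minus_one[of 3] by simp
    finally show ?thesis using ln_pos_nonneg[of "depth x / d"] unfolding ln_pos_def[of "depth y / d"] by simp
  qed
  have "(\<integral>\<^sup>+z. green_k x z * green_k y z \<partial>lborel) \<le> (\<integral>\<^sup>+z. (?N x z + ?N y z) + (?T x z + ?T y z) \<partial>lborel)"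
    by (intro nn_integral_mono pw)
  also have "\<dots> = ((\<integral>\<^sup>+z. ?N x z \<partial>lborel) + (\<integral>\<^sup>+z. ?N y z \<partial>lborel)) + ((\<integral>\<^sup>+z. ?T x z \<partial>lborel) + (\<integral>\<^sup>+z. ?T y z \<partial>lborel))"
    by (simp add: nn_integral_add)
  also have "\<dots> \<le> (ennreal (16 * pi\<^sup>2) + ennreal (16 * pi\<^sup>2))
     + (ennreal (pi\<^sup>2 * ln_pos (depth x / d) + 67 * pi\<^sup>2) + ennreal (pi\<^sup>2 * ln_pos (depth y / d) + 67 * pi\<^sup>2))"
    by (intro add_mono T x y eq_refl N)
  also have "\<dots> = ennreal (32 * pi\<^sup>2 + (pi\<^sup>2 * ln_pos (depth x / d) + 67 * pi\<^sup>2 + (pi\<^sup>2 * ln_pos (depth y / d) + 67 * pi\<^sup>2)))"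
    by (simp add: ennreal_plus[symmetric] del: ennreal_plus)
  also have "\<dots> \<le> ennreal (2 * pi\<^sup>2 * ln_pos (depth x / d) + 168 * pi\<^sup>2)"
  proof (rule ennreal_leI)
    have "pi\<^sup>2 * ln_pos (depth y / d) \<le> pi\<^sup>2 * (ln_pos (depth x / d) + 2)" by (intro mult_left_mono l) auto
    then show "32 * pi\<^sup>2 + (pi\<^sup>2 * ln_pos (depth x / d) + 67 * pi\<^sup>2 + (pi\<^sup>2 * ln_pos (depth y / d) + 67 * pi\<^sup>2)) \<le> 2 * pi\<^sup>2 * ln_pos (depth x / d) + 168 * pi\<^sup>2"
      by (simp add: algebra_simps)
  qed
  finally show ?thesis by (simp add: d_def)
qed

definition hdens :: "real^4 \<Rightarrow> ennreal" where
  "hdens x = (if norm x < 1 then ennreal ((2 / depth x) ^ 4) else 0)"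

lemma hdens_measurable [measurable]: "hdens \<in> borel_measurable borel"
  unfolding hdens_def[abs_def] by measurable

text \<open>
  The average bound for the composed kernel. Its leading coefficient is \<open>2 \<pi>^2\<close>, from \<open>kern_composition\<close>, divided by
  the dimension.
\<close>

definition avg_bound :: "real \<Rightarrow> real" where
  "avg_bound t = pi\<^sup>2 / 2 * ln_pos (1 / t) + (174 * pi\<^sup>2 + 4 * pi ^ 4 / 3)"

lemma avg_bound_nonneg: "0 \<le> avg_bound t"
  unfolding avg_bound_def by (intro add_nonneg_nonneg mult_nonneg_nonneg) auto

text \<open>
  The truncation that replaces rearrangement: a constant, plus a part supported in a ball of relative radius \<open>r\<close>.
\<close>

lemma ln_pos_split:
  assumes R: "0 < R" and r: "0 < r" "r \<le> 1" and n: "0 < n"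
  shows "ln_pos (R / n) \<le> ln (1 / r) + (if n \<le> r * R then r * R / n else 0)"
proof -
  have l: "0 \<le> ln (1 / r)" using r by simp
  have e: "ln (R / n) = ln (1 / r) + ln (r * R / n)"
    using R r n by (simp add: ln_divide_pos ln_mult)
  show ?thesis
  proof (cases "n \<le> r * R")
    case True
    have "ln (r * R / n) \<le> r * R / n"
      using ln_le_minus_one[of "r * R / n"] R r n by simp
    moreover have "0 \<le> r * R / n" using R r n by simp
    ultimately show ?thesis using True e l by (simp add: ln_pos_def)
  next
    case False
    then have "ln (r * R / n) \<le> 0" using R r n by (subst ln_le_zero_iff) auto
    then show ?thesis using False e l by (simp add: ln_pos_def)
  qed
qed

lemma nn_integral_inverse_ball:
  fixes x :: "real^4"
  assumes "0 \<le> b" "0 \<le> c"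
  shows "(\<integral>\<^sup>+z. ennreal (c / norm (z - x)) * indicator {z. norm (z - x) \<le> b} z \<partial>lborel)
    = ennreal (2 / 3 * c * pi\<^sup>2 * b ^ 3)"
proof -
  have "(\<integral>\<^sup>+z. ennreal (c / norm (z - x)) * indicator {z. 0 \<le> norm (z - x) \<and> norm (z - x) \<le> b} z \<partial>lborel)
    = ennreal (2 / 3 * c * pi\<^sup>2 * b ^ 3 - 2 / 3 * c * pi\<^sup>2 * 0 ^ 3)"
  proof (rule nn_integral_radial_Icc[where g="\<lambda>r. c / r"])
    show "((\<lambda>r. 2 / 3 * c * pi\<^sup>2 * r ^ 3) has_real_derivative 2 * pi\<^sup>2 * r ^ 3 * (c / r)) (at r)" for r
      by (cases "r = 0"; auto intro!: derivative_eq_intros simp: power2_eq_square power3_eq_cube)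
  qed (use assms in auto)
  then show ?thesis by simp
qed

text \<open>
  Split the logarithm at relative radius \<open>r\<close> with \<open>r^4\<close> proportional to \<open>min 1 t\<close>. The constant part gives
  \<open>ln (1 / r) = ln_pos (1 / t) / 4 + const\<close>, and the local part integrates to \<open>O(r^4) = O(t)\<close>, for any shape of \<open>E\<close>.
\<close>

lemma kern_composition_average:
  assumes x: "x \<in> ball 0 1" and E[measurable]: "E \<in> sets borel"
    and t: "(\<integral>\<^sup>+y. hdens y * indicator E y \<partial>lborel) = ennreal t" "0 < t"
  shows "(\<integral>\<^sup>+y. (\<integral>\<^sup>+z. green_k x z * green_k y z \<partial>lborel) * (hdens y * indicator E y) \<partial>lborel) \<le> ennreal (t * avg_bound t)"
proof -
  define R where "R = depth x"
  have R: "0 < R" using depth_pos[OF x] by (simp add: R_def)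
  define b where "b = min 1 t"
  have b: "0 < b" "b \<le> 1" "b \<le> t" using t(2) by (auto simp: b_def)
  \<comment> \<open>The factor \<open>1/4\<close> keeps the local part inside the ball on which \<open>depth\<close> is comparable to \<open>depth x\<close>.\<close>
  define r where "r = root 4 b / 4"
  have r: "0 < r" "r \<le> 1 / 4" using b by (auto simp: r_def)
  have r4: "r ^ 4 = b / 256" using b by (simp add: r_def power_divide real_root_pow_pos2)
  define l where "l = ln (1 / r)"
  have l: "0 \<le> l" "l \<le> 3 + ln_pos (1 / t) / 4"
  proof -
    show "0 \<le> l" using r by (simp add: l_def)
    have "l = ln 4 - ln (root 4 b)" using r b by (simp add: l_def r_def ln_divide_pos)
    also have "ln (root 4 b) = ln b / 4" using b by (subst ln_root) auto
    also have "- ln b = ln_pos (1 / t)"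
      using t(2) by (auto simp: b_def ln_pos_def min_def max_def ln_divide_pos)
    then have "ln 4 - ln b / 4 = ln 4 + ln_pos (1 / t) / 4" by simp
    finally show "l \<le> 3 + ln_pos (1 / t) / 4" using ln_le_minus_one[of 4] by simp
  qed
  let ?f = "\<lambda>y. ennreal (2 * pi\<^sup>2 * l + 168 * pi\<^sup>2) * (hdens y * indicator E y)"
  let ?g = "\<lambda>y. ennreal (512 * pi\<^sup>2 * r / R ^ 3 / norm (y - x)) * indicator {y. norm (y - x) \<le> r * R} y"
  have pw: "(\<integral>\<^sup>+z. green_k x z * green_k y z \<partial>lborel) * (hdens y * indicator E y) \<le> ?f y + ?g y" if xy: "y \<noteq> x" for y
  proof (cases "y \<in> ball 0 1")
    case False then show ?thesis by (simp add: hdens_def)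
  next
    case True
    define n where "n = norm (y - x)"
    have n: "0 < n" using xy by (simp add: n_def)
    have h: "hdens y = ennreal ((2 / depth y) ^ 4)" using True by (simp add: hdens_def)
    have ry: "0 < depth y" using depth_pos[OF True] .
    let ?c = "if n \<le> r * R then r * R / n else 0"
    have c0: "0 \<le> ?c" using n r R by auto
    have "(\<integral>\<^sup>+z. green_k x z * green_k y z \<partial>lborel) \<le> ennreal (2 * pi\<^sup>2 * ln_pos (R / n) + 168 * pi\<^sup>2)"
      using kern_composition[OF x True] xy by (simp add: R_def n_def norm_minus_commute)
    also have "\<dots> \<le> ennreal ((2 * pi\<^sup>2 * l + 168 * pi\<^sup>2) + 2 * pi\<^sup>2 * ?c)"
    proof (rule ennreal_leI)
      have "2 * pi\<^sup>2 * ln_pos (R / n) \<le> 2 * pi\<^sup>2 * (l + ?c)"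
        unfolding l_def by (intro mult_left_mono ln_pos_split R r n) (use r in auto)
      then show "2 * pi\<^sup>2 * ln_pos (R / n) + 168 * pi\<^sup>2 \<le> (2 * pi\<^sup>2 * l + 168 * pi\<^sup>2) + 2 * pi\<^sup>2 * ?c"
        by (simp only: distrib_left)
    qed
    also have "\<dots> = ennreal (2 * pi\<^sup>2 * l + 168 * pi\<^sup>2) + ennreal (2 * pi\<^sup>2 * ?c)"
      using l(1) c0 by (intro ennreal_plus) auto
    finally have "(\<integral>\<^sup>+z. green_k x z * green_k y z \<partial>lborel) * (hdens y * indicator E y)
        \<le> (ennreal (2 * pi\<^sup>2 * l + 168 * pi\<^sup>2) + ennreal (2 * pi\<^sup>2 * ?c)) * (hdens y * indicator E y)"
      by (rule mult_right_mono) simp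
    then have step1: "(\<integral>\<^sup>+z. green_k x z * green_k y z \<partial>lborel) * (hdens y * indicator E y)
        \<le> ?f y + ennreal (2 * pi\<^sup>2 * ?c) * (hdens y * indicator E y)"
      by (simp only: distrib_right)
    have step2: "ennreal (2 * pi\<^sup>2 * ?c) * (hdens y * indicator E y) \<le> ?g y"
    proof (cases "n \<le> r * R")
      case True
      have "r * R \<le> 1/4 * R" using r R by (intro mult_right_mono) auto
      then have "R / 2 \<le> depth y"
        using depth_lipschitz[OF x \<open>y \<in> ball 0 1\<close>] True by (simp add: R_def n_def)
      then have "(2 / depth y) ^ 4 \<le> (4 / R) ^ 4"
        using R ry by (intro power_mono) (auto simp: field_simps)
      also have "\<dots> = 256 / R ^ 4" by (simp add: power_divide)
      finally have "2 * pi\<^sup>2 * (r * R / n) * (2 / depth y) ^ 4 \<le> 2 * pi\<^sup>2 * (r * R / n) * (256 / R ^ 4)"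
        using r R n by (intro mult_left_mono) auto
      also have "\<dots> = 512 * pi\<^sup>2 * r / R ^ 3 / n"
        using R by (simp add: field_simps power3_eq_cube power4_eq_xxxx)
      finally have "ennreal (2 * pi\<^sup>2 * (r * R / n)) * hdens y \<le> ennreal (512 * pi\<^sup>2 * r / R ^ 3 / n)"
        unfolding h using r R n by (subst ennreal_mult[symmetric]) (auto intro: ennreal_leI)
      then have "ennreal (2 * pi\<^sup>2 * (r * R / n)) * hdens y * indicator E y \<le> ennreal (512 * pi\<^sup>2 * r / R ^ 3 / n) * 1"
        by (intro mult_mono) (auto split: split_indicator)
      then show ?thesis using True by (simp add: n_def mult.assoc)
    qed simp
    show ?thesis by (rule order_trans[OF step1 add_left_mono[OF step2]])
  qed
  have ae: "AE y in lborel. y \<noteq> x" by (rule AE_lborel_singleton)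
  have "(\<integral>\<^sup>+y. (\<integral>\<^sup>+z. green_k x z * green_k y z \<partial>lborel) * (hdens y * indicator E y) \<partial>lborel) \<le> (\<integral>\<^sup>+y. ?f y + ?g y \<partial>lborel)"
    by (rule nn_integral_mono_AE, rule eventually_mono[OF ae], rule pw)
  also have "\<dots> = (\<integral>\<^sup>+y. ?f y \<partial>lborel) + (\<integral>\<^sup>+y. ?g y \<partial>lborel)"
    by (rule nn_integral_add) measurable
  also have "(\<integral>\<^sup>+y. ?f y \<partial>lborel) = ennreal (2 * pi\<^sup>2 * l + 168 * pi\<^sup>2) * ennreal t"
    by (subst nn_integral_cmult) (auto simp: t)
  also have "\<dots> = ennreal ((2 * pi\<^sup>2 * l + 168 * pi\<^sup>2) * t)"
    using l(1) t(2) by (intro ennreal_mult[symmetric]) auto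
  also have "(\<integral>\<^sup>+y. ?g y \<partial>lborel) = ennreal (2 / 3 * (512 * pi\<^sup>2 * r / R ^ 3) * pi\<^sup>2 * (r * R) ^ 3)"
    using r R by (intro nn_integral_inverse_ball) auto
  also have "2 / 3 * (512 * pi\<^sup>2 * r / R ^ 3) * pi\<^sup>2 * (r * R) ^ 3 = 4 / 3 * pi ^ 4 * b"
  proof -
    have "2 / 3 * (512 * pi\<^sup>2 * r / R ^ 3) * pi\<^sup>2 * (r * R) ^ 3 = 1024 / 3 * pi ^ 4 * r ^ 4"
      using R by (simp add: field_simps eval_nat_numeral)
    then show ?thesis by (simp add: r4)
  qed
  also have "ennreal ((2 * pi\<^sup>2 * l + 168 * pi\<^sup>2) * t) + ennreal (4 / 3 * pi ^ 4 * b)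
     = ennreal ((2 * pi\<^sup>2 * l + 168 * pi\<^sup>2) * t + 4 / 3 * pi ^ 4 * b)"
    using l(1) t(2) b by (intro ennreal_plus[symmetric]) auto
  also have "\<dots> \<le> ennreal (t * avg_bound t)"
  proof (rule ennreal_leI)
    have "2 * pi\<^sup>2 * l \<le> 2 * pi\<^sup>2 * (3 + ln_pos (1 / t) / 4)" using l by (intro mult_left_mono) auto
    then have "(2 * pi\<^sup>2 * l + 168 * pi\<^sup>2) * t \<le> (2 * pi\<^sup>2 * (3 + ln_pos (1 / t) / 4) + 168 * pi\<^sup>2) * t"
      using t(2) by (intro mult_right_mono) auto
    moreover have "4 / 3 * pi ^ 4 * b \<le> 4 / 3 * pi ^ 4 * t" using b by (intro mult_left_mono) auto
    moreover have "t * avg_bound t = (2 * pi\<^sup>2 * (3 + ln_pos (1 / t) / 4) + 168 * pi\<^sup>2) * t + 4 / 3 * pi ^ 4 * t"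
      by (simp add: avg_bound_def algebra_simps)
    ultimately show "(2 * pi\<^sup>2 * l + 168 * pi\<^sup>2) * t + 4 / 3 * pi ^ 4 * b \<le> t * avg_bound t"
      by linarith
  qed
  finally show ?thesis .
qed

definition potential :: "(real^4) set \<Rightarrow> real^4 \<Rightarrow> ennreal" where
  "potential E z = (\<integral>\<^sup>+x. green_k x z * (hdens x * indicator E x) \<partial>lborel)"

lemma potential_measurable [measurable]:
  assumes [measurable]: "E \<in> sets borel"
  shows "potential E \<in> borel_measurable borel"
  unfolding potential_def[abs_def] by measurable

text \<open>
  By Tonelli the product is a double integral of the composed kernel over \<open>E' \<times> E\<close>. Averaging the inner variable over
  \<open>E\<close> makes the bound depend on the volume of \<open>E\<close> only, so that for a pair of level sets one may take the larger one.
\<close>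

lemma potential_product:
  assumes E[measurable]: "E \<in> sets borel" and E'[measurable]: "E' \<in> sets borel"
    and t: "(\<integral>\<^sup>+y. hdens y * indicator E y \<partial>lborel) = ennreal t" "0 < t"
    and t': "(\<integral>\<^sup>+y. hdens y * indicator E' y \<partial>lborel) = ennreal t'" "0 < t'"
  shows "(\<integral>\<^sup>+z. potential E' z * potential E z \<partial>lborel) \<le> ennreal (t' * t * avg_bound t)"
proof -
  have "(\<integral>\<^sup>+z. potential E' z * potential E z \<partial>lborel)
     = (\<integral>\<^sup>+z. \<integral>\<^sup>+x. green_k x z * (hdens x * indicator E' x) * potential E z \<partial>lborel \<partial>lborel)"
    unfolding potential_def[of E'] by (intro nn_integral_cong nn_integral_multc[symmetric]) measurable
  also have "\<dots> = (\<integral>\<^sup>+x. \<integral>\<^sup>+z. green_k x z * (hdens x * indicator E' x) * potential E z \<partial>lborel \<partial>lborel)"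
    by (rule lborel_pair.Fubini') measurable
  also have "\<dots> = (\<integral>\<^sup>+x. (hdens x * indicator E' x) * (\<integral>\<^sup>+z. green_k x z * potential E z \<partial>lborel) \<partial>lborel)"
  proof (intro nn_integral_cong)
    fix x :: "real^4"
    show "(\<integral>\<^sup>+z. green_k x z * (hdens x * indicator E' x) * potential E z \<partial>lborel) = (hdens x * indicator E' x) * (\<integral>\<^sup>+z. green_k x z * potential E z \<partial>lborel)"
      by (subst nn_integral_cmult[symmetric]) (auto simp: mult_ac)
  qed
  also have "\<dots> \<le> (\<integral>\<^sup>+x. (hdens x * indicator E' x) * ennreal (t * avg_bound t) \<partial>lborel)"
  proof (intro nn_integral_mono)
    fix x :: "real^4"
    show "(hdens x * indicator E' x) * (\<integral>\<^sup>+z. green_k x z * potential E z \<partial>lborel) \<le> (hdens x * indicator E' x) * ennreal (t * avg_bound t)"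
    proof (cases "x \<in> ball 0 1")
      case True
      have "(\<integral>\<^sup>+z. green_k x z * potential E z \<partial>lborel) = (\<integral>\<^sup>+z. \<integral>\<^sup>+y. green_k x z * (green_k y z * (hdens y * indicator E y)) \<partial>lborel \<partial>lborel)"
        unfolding potential_def by (intro nn_integral_cong nn_integral_cmult[symmetric]) measurable
      also have "\<dots> = (\<integral>\<^sup>+y. \<integral>\<^sup>+z. green_k x z * (green_k y z * (hdens y * indicator E y)) \<partial>lborel \<partial>lborel)"
        by (rule lborel_pair.Fubini') measurable
      also have "\<dots> = (\<integral>\<^sup>+y. (\<integral>\<^sup>+z. green_k x z * green_k y z \<partial>lborel) * (hdens y * indicator E y) \<partial>lborel)"
        by (intro nn_integral_cong, subst nn_integral_multc[symmetric]) (auto simp: mult_ac)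
      also have "\<dots> \<le> ennreal (t * avg_bound t)" by (rule kern_composition_average[OF True E t])
      finally show ?thesis by (intro mult_left_mono) auto
    qed (simp add: hdens_def)
  qed
  also have "\<dots> = ennreal t' * ennreal (t * avg_bound t)"
    by (subst nn_integral_multc) (auto simp: t')
  also have "\<dots> = ennreal (t' * t * avg_bound t)"
    using t(2) t'(2) avg_bound_nonneg by (subst ennreal_mult[symmetric]) (auto simp: mult_ac)
  finally show ?thesis .
qed

context ball_C2
begin

lemma nn_hardy_point:
  "(\<integral>\<^sup>+z. (ennreal (\<bar>w z\<bar> / norm (z - x)))\<^sup>2 \<partial>lborel) \<le> ennreal (LINT z|lborel. grad2 z)"
proof -
  have [measurable]: "w \<in> borel_measurable borel" using w_cont by (rule borel_measurable_continuous_onI)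
  define s where "s n = inverse (real (Suc n))" for n
  have s: "s \<longlonglongrightarrow> 0" "\<And>n. 0 < s n" unfolding s_def[abs_def] by (rule LIMSEQ_inverse_real_of_nat, simp)
  let ?f = "\<lambda>n z. ennreal ((w z)\<^sup>2 / ((norm (z - x))\<^sup>2 + s n))"
  have pos: "0 < (norm (z - x))\<^sup>2 + s n" for z n using s(2)[of n] by (simp add: add_nonneg_pos)
  have "(\<integral>\<^sup>+z. (ennreal (\<bar>w z\<bar> / norm (z - x)))\<^sup>2 \<partial>lborel) \<le> (\<integral>\<^sup>+z. liminf (\<lambda>n. ?f n z) \<partial>lborel)"
  proof (rule nn_integral_mono_AE)
    have "AE z in lborel. z \<noteq> x" by (rule AE_lborel_singleton)
    then show "AE z in lborel. (ennreal (\<bar>w z\<bar> / norm (z - x)))\<^sup>2 \<le> liminf (\<lambda>n. ?f n z)"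
    proof eventually_elim
      case (elim z)
      have "(\<lambda>n. ?f n z) \<longlonglongrightarrow> ennreal ((w z)\<^sup>2 / ((norm (z - x))\<^sup>2 + 0))"
        using elim by (intro tendsto_ennrealI tendsto_intros s) auto
      then have "liminf (\<lambda>n. ?f n z) = ennreal ((w z)\<^sup>2 / ((norm (z - x))\<^sup>2 + 0))"
        by (intro lim_imp_Liminf) auto
      then show ?case by (simp add: ennreal_power power_divide)
    qed
  qed
  also have "\<dots> \<le> liminf (\<lambda>n. \<integral>\<^sup>+z. ?f n z \<partial>lborel)"
    by (rule nn_integral_liminf) measurable
  also have "\<dots> \<le> liminf (\<lambda>n. ennreal (LINT z|lborel. grad2 z))"
  proof (intro Liminf_mono always_eventually allI)
    fix n
    have "continuous_on UNIV (\<lambda>z. (w z)\<^sup>2 / ((norm (z - x))\<^sup>2 + s n))"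
      using pos[of _ n] by (auto intro!: continuous_intros w_cont simp: less_imp_neq[symmetric])
    then have "integrable lborel (\<lambda>z. (w z)\<^sup>2 / ((norm (z - x))\<^sup>2 + s n))"
      by (intro integrable_compact_support[OF _ K(1)]) (auto simp: w_off)
    then have "(\<integral>\<^sup>+z. ?f n z \<partial>lborel) = ennreal (LINT z|lborel. (w z)\<^sup>2 / ((norm (z - x))\<^sup>2 + s n))"
      using pos less_imp_le[OF pos] by (intro nn_integral_eq_integral) auto
    also have "\<dots> \<le> ennreal (LINT z|lborel. grad2 z)"
      by (intro ennreal_leI hardy_point s)
    finally show "(\<integral>\<^sup>+z. ?f n z \<partial>lborel) \<le> ennreal (LINT z|lborel. grad2 z)" .
  qed
  also have "\<dots> = ennreal (LINT z|lborel. grad2 z)" by (simp add: Liminf_const)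
  finally show ?thesis .
qed

lemma wq_cont: "continuous_on UNIV (\<lambda>x. w x * (1 / iconf x))"
  by (rule continuous_mult_support[OF K_closed K(2) open_ball w_off w_cont])
     (use iconf_pos in \<open>force intro!: continuous_intros iconf_cont\<close>)+

text \<open>
  Near \<open>x\<close> the kernel is \<open>O(1 / |z - x|^2)\<close>, and Cauchy--Schwarz distributes one power to Hardy's inequality and one to
  the integrable weight \<open>1 / |z - x|^2\<close>. Away from \<open>x\<close> the kernel is square integrable.
\<close>

lemma lower_order_bound:
  assumes x: "x \<in> ball 0 1"
  shows "(\<integral>\<^sup>+z. green_k x z * ennreal (\<bar>w z\<bar> / (4 * iconf z)) \<partial>lborel)
    \<le> ennreal (4 * pi * sqrt ((LINT z|lborel. grad2 z) + (LINT z|lborel. (w z / iconf z)\<^sup>2)))"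
proof -
  have [measurable]: "w \<in> borel_measurable borel" "iconf \<in> borel_measurable borel"
    using w_cont iconf_cont by (auto intro: borel_measurable_continuous_onI)
  define X where "X = (LINT z|lborel. grad2 z)"
  define Y where "Y = (LINT z|lborel. (w z / iconf z)\<^sup>2)"
  have XY: "0 \<le> X" "0 \<le> Y" by (auto simp: X_def Y_def grad2_def intro!: integral_nonneg_AE AE_I2 sum_nonneg)
  define R where "R = depth x"
  have R: "0 < R" using depth_pos[OF x] by (simp add: R_def)
  let ?n = "\<lambda>z. norm (z - x)"
  let ?f1 = "\<lambda>z. ennreal (\<bar>w z\<bar> / ?n z)"
  let ?g1 = "\<lambda>z. ennreal (1 / ?n z) * indicator {z. ?n z \<le> R / 4} z"
  let ?f2 = "\<lambda>z. ennreal (\<bar>w z\<bar> / \<bar>iconf z\<bar>)"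
  let ?g2 = "\<lambda>z. ennreal (R\<^sup>2 / ?n z ^ 4) * indicator {z. R / 4 \<le> ?n z} z"
  have pw: "green_k x z * ennreal (\<bar>w z\<bar> / (4 * iconf z)) \<le> ennreal (4 / R) * (?f1 z * ?g1 z) + ennreal (1/4) * (?f2 z * ?g2 z)" for z
  proof (cases "z \<in> ball 0 1")
    case False then show ?thesis by (simp add: green_k_def)
  next
    case True
    note kb = kern_bounds[OF x True]
    have b: "0 < iconf z" "iconf z = depth z / 2" using iconf_pos[OF True] by (auto simp: iconf_def depth_def)
    have green_k: "green_k x z * ennreal (\<bar>w z\<bar> / (4 * iconf z)) = ennreal (kern x z * (\<bar>w z\<bar> / (4 * iconf z)))"
      using True kb(1) b by (subst ennreal_mult) (auto simp: green_k_def)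
    show ?thesis
    proof (cases "?n z \<le> R / 4")
      case near: True
      have "R / 4 \<le> iconf z" using depth_lipschitz[OF x True] near by (simp add: b R_def)
      then have "\<bar>w z\<bar> / (4 * iconf z) \<le> \<bar>w z\<bar> / R" using R b by (intro divide_left_mono) auto
      from mult_mono[OF kb(2) this _ divide_nonneg_nonneg]
      have "kern x z * (\<bar>w z\<bar> / (4 * iconf z)) \<le> (4 / (?n z)\<^sup>2) * (\<bar>w z\<bar> / R)"
        using b(1) by simp
      also have "\<dots> = 4 / R * (\<bar>w z\<bar> / ?n z * (1 / ?n z))" by (simp add: power2_eq_square)
      finally have "green_k x z * ennreal (\<bar>w z\<bar> / (4 * iconf z)) \<le> ennreal (4 / R * (\<bar>w z\<bar> / ?n z * (1 / ?n z)))"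
        unfolding green_k by (rule ennreal_leI)
      also have "\<dots> = ennreal (4 / R) * (?f1 z * ennreal (1 / ?n z))"
        using R by (subst ennreal_mult, simp, simp, subst ennreal_mult) auto
      also have "\<dots> = ennreal (4 / R) * (?f1 z * ?g1 z)" using near by simp
      finally show ?thesis by (rule order_trans) simp
    next
      case far: False
      have "kern x z * (\<bar>w z\<bar> / (4 * iconf z)) \<le> (R\<^sup>2 / ?n z ^ 4) * (\<bar>w z\<bar> / (4 * iconf z))"
        using kb b by (intro mult_right_mono) (auto simp: R_def)
      also have "\<dots> = 1/4 * (\<bar>w z\<bar> / \<bar>iconf z\<bar> * (R\<^sup>2 / ?n z ^ 4))"
        using b(1) by (simp add: mult_ac)
      finally have "green_k x z * ennreal (\<bar>w z\<bar> / (4 * iconf z)) \<le> ennreal (1/4 * (\<bar>w z\<bar> / \<bar>iconf z\<bar> * (R\<^sup>2 / ?n z ^ 4)))"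
        unfolding green_k by (rule ennreal_leI)
      also have "\<dots> = ennreal (1/4) * (?f2 z * ennreal (R\<^sup>2 / ?n z ^ 4))"
        by (subst ennreal_mult, simp, simp, subst ennreal_mult) auto
      also have "\<dots> = ennreal (1/4) * (?f2 z * ?g2 z)" using far by simp
      finally show ?thesis by (rule order_trans) simp
    qed
  qed
  have near: "(\<integral>\<^sup>+z. ?f1 z * ?g1 z \<partial>lborel) \<le> ennreal (sqrt X * (pi * R / 4))"
  proof (rule nn_integral_cauchy_schwarz)
    show "(\<integral>\<^sup>+z. (?f1 z)\<^sup>2 \<partial>lborel) \<le> ennreal ((sqrt X)\<^sup>2)" using nn_hardy_point XY by (simp add: X_def)
    have "(\<integral>\<^sup>+z. (?g1 z)\<^sup>2 \<partial>lborel) = (\<integral>\<^sup>+z. ennreal (1 / (?n z)\<^sup>2) * indicator {z. ?n z \<le> R / 4} z \<partial>lborel)"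
      by (intro nn_integral_cong) (auto simp: ennreal_power power_divide split: split_indicator)
    also have "\<dots> = ennreal ((pi * R / 4)\<^sup>2)"
      using R by (subst nn_integral_inverse_square_ball) (auto simp: power_mult_distrib power_divide)
    finally show "(\<integral>\<^sup>+z. (?g1 z)\<^sup>2 \<partial>lborel) \<le> ennreal ((pi * R / 4)\<^sup>2)" by simp
  qed (use XY R in auto)
  have far: "(\<integral>\<^sup>+z. ?f2 z * ?g2 z \<partial>lborel) \<le> ennreal (sqrt Y * (12 * pi))"
  proof (rule nn_integral_cauchy_schwarz)
    have "integrable lborel (\<lambda>z. (w z / iconf z)\<^sup>2)"
      by (rule integrable_compact_support[OF _ K(1)]) (use wq_cont in \<open>auto simp: w_off intro!: continuous_intros\<close>)
    then have "(\<integral>\<^sup>+z. ennreal ((w z / iconf z)\<^sup>2) \<partial>lborel) = ennreal Y"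
      unfolding Y_def by (intro nn_integral_eq_integral) auto
    moreover have "(?f2 z)\<^sup>2 = ennreal ((w z / iconf z)\<^sup>2)" for z
      by (simp add: ennreal_power power_divide)
    ultimately show "(\<integral>\<^sup>+z. (?f2 z)\<^sup>2 \<partial>lborel) \<le> ennreal ((sqrt Y)\<^sup>2)" using XY by simp
    have "(\<integral>\<^sup>+z. (?g2 z)\<^sup>2 \<partial>lborel) = (\<integral>\<^sup>+z. ennreal (R ^ 4 / (?n z) ^ 8) * indicator {z. R / 4 \<le> ?n z} z \<partial>lborel)"
      by (intro nn_integral_cong) (auto simp: ennreal_power power_divide split: split_indicator)
    also have "\<dots> = ennreal (128 * pi\<^sup>2)"
      using R by (subst nn_integral_inverse_fourth_tail) (auto simp: power_divide)
    also have "\<dots> \<le> ennreal ((12 * pi)\<^sup>2)" by (intro ennreal_leI) (simp add: power_mult_distrib)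
    finally show "(\<integral>\<^sup>+z. (?g2 z)\<^sup>2 \<partial>lborel) \<le> ennreal ((12 * pi)\<^sup>2)" .
  qed (use XY in auto)
  have "(\<integral>\<^sup>+z. green_k x z * ennreal (\<bar>w z\<bar> / (4 * iconf z)) \<partial>lborel)
    \<le> (\<integral>\<^sup>+z. ennreal (4 / R) * (?f1 z * ?g1 z) + ennreal (1/4) * (?f2 z * ?g2 z) \<partial>lborel)"
    by (intro nn_integral_mono pw)
  also have "\<dots> = ennreal (4 / R) * (\<integral>\<^sup>+z. ?f1 z * ?g1 z \<partial>lborel) + ennreal (1/4) * (\<integral>\<^sup>+z. ?f2 z * ?g2 z \<partial>lborel)"
    by (simp add: nn_integral_add nn_integral_cmult del: divide_numeral_1)
  also have "\<dots> \<le> ennreal (4 / R) * ennreal (sqrt X * (pi * R / 4)) + ennreal (1/4) * ennreal (sqrt Y * (12 * pi))"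
    by (intro add_mono mult_left_mono near far) auto
  also have "\<dots> = ennreal (pi * sqrt X) + ennreal (3 * pi * sqrt Y)"
    using R XY by (subst (1 2) ennreal_mult[symmetric]) (auto simp: mult_ac)
  also have "\<dots> = ennreal (pi * sqrt X + 3 * pi * sqrt Y)"
    using XY by (intro ennreal_plus[symmetric]) auto
  also have "\<dots> \<le> ennreal (4 * pi * sqrt (X + Y))"
  proof (rule ennreal_leI)
    have "pi * sqrt X \<le> pi * sqrt (X + Y)" "3 * pi * sqrt Y \<le> 3 * pi * sqrt (X + Y)"
      using XY by (auto intro!: mult_left_mono)
    then show "pi * sqrt X + 3 * pi * sqrt Y \<le> 4 * pi * sqrt (X + Y)" by linarith
  qed
  finally show ?thesis by (simp add: X_def Y_def)
qed

end

section \<open>Testing against two level sets\<close>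

lemma two_term_cauchy_schwarz:
  fixes a b c d :: real
  shows "(a * c + b * d)\<^sup>2 \<le> (a\<^sup>2 + b\<^sup>2) * (c\<^sup>2 + d\<^sup>2)"
proof -
  have "(a\<^sup>2 + b\<^sup>2) * (c\<^sup>2 + d\<^sup>2) - (a * c + b * d)\<^sup>2 = (a * d - b * c)\<^sup>2"
    by (simp add: power2_eq_square algebra_simps)
  then show ?thesis using zero_le_power2[of "a * d - b * c"] by linarith
qed

context ball_C2
begin

text \<open>
  Integrate \<open>|u|\<close> against \<open>a 1_E1 / t1 + b 1_E2 / t2\<close>. The Green potential of this density has \<open>L^2\<close> norm
  controlled by the pairwise averages of the composed kernel, and the lower-order part is absorbed by the slack at the
  price of \<open>(a + b)^2\<close>. The bound on the right is the covariance of Brownian motion at times \<open>ln (1 / t1) \<le> ln (1 / t2)\<close>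
  up to additive constants, so \<open>E1\<close> is meant to be the larger set.
\<close>

lemma two_level_test:
  assumes nrg: "(LINT x|lborel. (iconf x * lap x + w x / (4 * iconf x))\<^sup>2)
      + del * ((LINT x|lborel. grad2 x) + (LINT x|lborel. (w x / iconf x)\<^sup>2)) \<le> 1" and del: "0 < del"
    and E1[measurable]: "E1 \<in> sets borel" and E2[measurable]: "E2 \<in> sets borel"
    and t1: "(\<integral>\<^sup>+x. hdens x * indicator E1 x \<partial>lborel) = ennreal t1" "0 < t1"
    and t2: "(\<integral>\<^sup>+x. hdens x * indicator E2 x \<partial>lborel) = ennreal t2" "0 < t2"
    and s1: "\<And>x. x \<in> E1 \<Longrightarrow> x \<in> ball 0 1 \<Longrightarrow> s1 \<le> \<bar>iconf x * w x\<bar>" "0 \<le> s1"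
    and s2: "\<And>x. x \<in> E2 \<Longrightarrow> x \<in> ball 0 1 \<Longrightarrow> s2 \<le> \<bar>iconf x * w x\<bar>" "0 \<le> s2"
    and ab: "0 \<le> a" "0 \<le> b"
  shows "16 * pi ^ 4 * (a * s1 + b * s2)\<^sup>2
    \<le> a\<^sup>2 * avg_bound t1 + 2 * a * b * avg_bound t1 + b\<^sup>2 * avg_bound t2 + 16 * pi\<^sup>2 / del * (a + b)\<^sup>2"
proof -
  have [measurable]: "w \<in> borel_measurable borel" "iconf \<in> borel_measurable borel" "lap \<in> borel_measurable borel"
    using w_cont iconf_cont lap_cont by (auto intro: borel_measurable_continuous_onI)
  define ft where "ft x = iconf x * lap x + w x / (4 * iconf x)" for x
  have [measurable]: "ft \<in> borel_measurable borel" unfolding ft_def[abs_def] by measurable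
  define A where "A = sqrt (LINT x|lborel. (ft x)\<^sup>2)"
  define h where "h = sqrt ((LINT x|lborel. grad2 x) + (LINT x|lborel. (w x / iconf x)\<^sup>2))"
  have A0: "0 \<le> (LINT x|lborel. (ft x)\<^sup>2)" by simp
  have "0 \<le> (LINT x|lborel. grad2 x)" "0 \<le> (LINT x|lborel. (w x / iconf x)\<^sup>2)"
    by (auto simp: grad2_def intro!: integral_nonneg_AE AE_I2 sum_nonneg)
  then have h0: "0 \<le> h" and h2: "h\<^sup>2 = (LINT x|lborel. grad2 x) + (LINT x|lborel. (w x / iconf x)\<^sup>2)"
    by (auto simp: h_def)
  have nrg': "A\<^sup>2 + del * h\<^sup>2 \<le> 1" using nrg A0 unfolding h2 by (simp add: A_def ft_def)
  have ft_int: "(\<integral>\<^sup>+z. (ennreal \<bar>ft z\<bar>)\<^sup>2 \<partial>lborel) = ennreal (A\<^sup>2)"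
  proof -
    have "ft = (\<lambda>x. iconf x * lap x + 1 / 4 * (w x * (1 / iconf x)))" by (auto simp: ft_def)
    then have "continuous_on UNIV ft"
      using continuous_on_mult_left[OF wq_cont, of "1/4"]
        continuous_on_add[OF continuous_on_mult[OF iconf_cont lap_cont]] by simp
    then have "integrable lborel (\<lambda>x. (ft x)\<^sup>2)"
      by (intro integrable_compact_support[OF _ K(1)]) (auto simp: ft_def lap_off w_off intro!: continuous_intros)
    then have "(\<integral>\<^sup>+z. ennreal ((ft z)\<^sup>2) \<partial>lborel) = ennreal (A\<^sup>2)"
      using A0 by (subst nn_integral_eq_integral) (auto simp: A_def)
    then show ?thesis by (simp add: ennreal_power)
  qed
  define m where "m x = ennreal (a / t1) * (hdens x * indicator E1 x) + ennreal (b / t2) * (hdens x * indicator E2 x)" for x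
  have [measurable]: "m \<in> borel_measurable borel" unfolding m_def[abs_def] by measurable
  have m_ball: "m x = 0" if "x \<notin> ball 0 1" for x using that by (simp add: m_def hdens_def)
  have m_int: "(\<integral>\<^sup>+x. m x \<partial>lborel) = ennreal (a + b)"
  proof -
    have "(\<integral>\<^sup>+x. m x \<partial>lborel) = ennreal (a / t1) * ennreal t1 + ennreal (b / t2) * ennreal t2"
      unfolding m_def by (subst nn_integral_add) (auto simp: nn_integral_cmult t1 t2)
    also have "\<dots> = ennreal a + ennreal b"
      using t1(2) t2(2) ab by (simp add: ennreal_mult[symmetric])
    finally show ?thesis using ab by simp
  qed
  define P where "P = a\<^sup>2 * avg_bound t1 + 2 * a * b * avg_bound t1 + b\<^sup>2 * avg_bound t2"
  have P0: "0 \<le> P" unfolding P_def using ab avg_bound_nonneg by (intro add_nonneg_nonneg mult_nonneg_nonneg) auto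
  define Psi where "Psi z = (\<integral>\<^sup>+x. green_k x z * m x \<partial>lborel)" for z
  have Psi: "Psi z = ennreal (a / t1) * potential E1 z + ennreal (b / t2) * potential E2 z" for z
  proof -
    have "Psi z = (\<integral>\<^sup>+x. ennreal (a / t1) * (green_k x z * (hdens x * indicator E1 x)) + ennreal (b / t2) * (green_k x z * (hdens x * indicator E2 x)) \<partial>lborel)"
      unfolding Psi_def m_def by (intro nn_integral_cong) (simp add: distrib_left mult_ac)
    also have "\<dots> = ennreal (a / t1) * potential E1 z + ennreal (b / t2) * potential E2 z"
      unfolding potential_def by (subst nn_integral_add) (auto simp: nn_integral_cmult)
    finally show ?thesis .
  qed
  have [measurable]: "Psi \<in> borel_measurable borel" unfolding Psi[abs_def] by measurable
  have Psi_sq: "(\<integral>\<^sup>+z. (Psi z)\<^sup>2 \<partial>lborel) \<le> ennreal ((sqrt P)\<^sup>2)"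
  proof -
    let ?a = "ennreal (a / t1)" and ?b = "ennreal (b / t2)"
    have "(\<integral>\<^sup>+z. (Psi z)\<^sup>2 \<partial>lborel) = (\<integral>\<^sup>+z. ?a * ?a * (potential E1 z * potential E1 z) + (2 * ?b * ?a * (potential E2 z * potential E1 z) + ?b * ?b * (potential E2 z * potential E2 z)) \<partial>lborel)"
      unfolding Psi by (intro nn_integral_cong) (simp add: power2_eq_square distrib_left distrib_right mult_ac mult_2 add_ac)
    also have "\<dots> = ?a * ?a * (\<integral>\<^sup>+z. potential E1 z * potential E1 z \<partial>lborel)
       + (2 * ?b * ?a * (\<integral>\<^sup>+z. potential E2 z * potential E1 z \<partial>lborel) + ?b * ?b * (\<integral>\<^sup>+z. potential E2 z * potential E2 z \<partial>lborel))"
      by (simp add: nn_integral_add nn_integral_cmult)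
    also have "\<dots> \<le> ?a * ?a * ennreal (t1 * t1 * avg_bound t1)
       + (2 * ?b * ?a * ennreal (t2 * t1 * avg_bound t1) + ?b * ?b * ennreal (t2 * t2 * avg_bound t2))"
      by (intro add_mono mult_left_mono potential_product E1 E2 t1 t2) auto
    also have "\<dots> = ennreal P"
    proof -
      have c: "ennreal (u / t) * ennreal (v / t') * ennreal (t * t' * B) = ennreal (u * v * B)"
        if "0 \<le> u" "0 \<le> v" "0 < t" "0 < t'" "0 \<le> B" for u v t t' B
        using that by (simp add: ennreal_mult[symmetric])
      have "?a * ?a * ennreal (t1 * t1 * avg_bound t1) = ennreal (a * a * avg_bound t1)"
        "?b * ?a * ennreal (t2 * t1 * avg_bound t1) = ennreal (b * a * avg_bound t1)"
        "?b * ?b * ennreal (t2 * t2 * avg_bound t2) = ennreal (b * b * avg_bound t2)"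
        using ab t1 t2 avg_bound_nonneg by (intro c; simp)+
      then have "?a * ?a * ennreal (t1 * t1 * avg_bound t1) + (2 * ?b * ?a * ennreal (t2 * t1 * avg_bound t1) + ?b * ?b * ennreal (t2 * t2 * avg_bound t2))
        = ennreal (a * a * avg_bound t1) + (2 * ennreal (b * a * avg_bound t1) + ennreal (b * b * avg_bound t2))"
        by (simp only: mult.assoc)
      also have "2 * ennreal (b * a * avg_bound t1) = ennreal (2 * (b * a * avg_bound t1))"
        using ab avg_bound_nonneg by (subst ennreal_mult) auto
      also have "ennreal (a * a * avg_bound t1) + (ennreal (2 * (b * a * avg_bound t1)) + ennreal (b * b * avg_bound t2)) = ennreal P"
        using ab avg_bound_nonneg by (simp add: ennreal_plus[symmetric] P_def power2_eq_square mult_ac add_ac del: ennreal_plus)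
      finally show ?thesis .
    qed
    finally show ?thesis using P0 by simp
  qed
  have lower: "ennreal (4 * pi\<^sup>2 * (a * s1 + b * s2)) \<le> (\<integral>\<^sup>+x. ennreal (4 * pi\<^sup>2 * \<bar>iconf x * w x\<bar>) * m x \<partial>lborel)"
  proof -
    let ?c1 = "ennreal (4 * pi\<^sup>2 * s1)" and ?c2 = "ennreal (4 * pi\<^sup>2 * s2)"
    have c: "ennreal (4 * pi\<^sup>2 * s) * (ennreal (u / t) * ennreal t) = ennreal (4 * pi\<^sup>2 * (u * s))" if "0 \<le> s" "0 \<le> u" "0 < t" for s u t
      using that by (simp add: ennreal_mult[symmetric] mult_ac)
    have "ennreal (4 * pi\<^sup>2 * (a * s1 + b * s2)) = ennreal (4 * pi\<^sup>2 * (a * s1)) + ennreal (4 * pi\<^sup>2 * (b * s2))"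
      using ab s1 s2 by (simp add: ennreal_plus[symmetric] algebra_simps del: ennreal_plus)
    also have "\<dots> = ?c1 * (ennreal (a / t1) * ennreal t1) + ?c2 * (ennreal (b / t2) * ennreal t2)"
      using c[OF s1(2) ab(1) t1(2)] c[OF s2(2) ab(2) t2(2)] by simp
    also have "\<dots> = (\<integral>\<^sup>+x. ?c1 * (ennreal (a / t1) * (hdens x * indicator E1 x)) + ?c2 * (ennreal (b / t2) * (hdens x * indicator E2 x)) \<partial>lborel)"
      by (subst nn_integral_add) (auto simp: nn_integral_cmult t1 t2)
    also have "\<dots> \<le> (\<integral>\<^sup>+x. ennreal (4 * pi\<^sup>2 * \<bar>iconf x * w x\<bar>) * m x \<partial>lborel)"
    proof (intro nn_integral_mono)
      fix x :: "real^4"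
      have c: "ennreal (4 * pi\<^sup>2 * s) * (k * (hdens x * indicator E x)) \<le> ennreal (4 * pi\<^sup>2 * \<bar>iconf x * w x\<bar>) * (k * (hdens x * indicator E x))"
        if "x \<in> E \<Longrightarrow> x \<in> ball 0 1 \<Longrightarrow> s \<le> \<bar>iconf x * w x\<bar>" for s k E
      proof (cases "x \<in> E \<and> x \<in> ball 0 1")
        case True
        then have "4 * pi\<^sup>2 * s \<le> 4 * pi\<^sup>2 * \<bar>iconf x * w x\<bar>" using that by (intro mult_left_mono) auto
        then show ?thesis by (intro mult_right_mono ennreal_leI) auto
      qed (auto simp: hdens_def)
      have "?c1 * (ennreal (a / t1) * (hdens x * indicator E1 x)) \<le> ennreal (4 * pi\<^sup>2 * \<bar>iconf x * w x\<bar>) * (ennreal (a / t1) * (hdens x * indicator E1 x))"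
        by (rule c) (rule s1(1))
      moreover have "?c2 * (ennreal (b / t2) * (hdens x * indicator E2 x)) \<le> ennreal (4 * pi\<^sup>2 * \<bar>iconf x * w x\<bar>) * (ennreal (b / t2) * (hdens x * indicator E2 x))"
        by (rule c) (rule s2(1))
      ultimately show "?c1 * (ennreal (a / t1) * (hdens x * indicator E1 x)) + ?c2 * (ennreal (b / t2) * (hdens x * indicator E2 x))
         \<le> ennreal (4 * pi\<^sup>2 * \<bar>iconf x * w x\<bar>) * m x"
        unfolding m_def distrib_left by (rule add_mono)
    qed
    finally show ?thesis .
  qed
  let ?f = "\<lambda>z. ennreal \<bar>ft z\<bar>"
  have upper: "ennreal (4 * pi\<^sup>2 * \<bar>iconf x * w x\<bar>) \<le> (\<integral>\<^sup>+z. green_k x z * ?f z \<partial>lborel) + ennreal (4 * pi * h)" if x: "x \<in> ball 0 1" for x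
  proof -
    have "ennreal (4 * pi\<^sup>2 * \<bar>iconf x * w x\<bar>) \<le> (\<integral>\<^sup>+z. ennreal (kern x z * \<bar>iconf z * lap z\<bar>) \<partial>lborel)"
      by (rule newton_pointwise[OF x])
    also have "\<dots> \<le> (\<integral>\<^sup>+z. green_k x z * ?f z + green_k x z * ennreal (\<bar>w z\<bar> / (4 * iconf z)) \<partial>lborel)"
    proof (intro nn_integral_mono)
      fix z
      show "ennreal (kern x z * \<bar>iconf z * lap z\<bar>) \<le> green_k x z * ?f z + green_k x z * ennreal (\<bar>w z\<bar> / (4 * iconf z))"
      proof (cases "z \<in> K")
        case True
        then have z: "z \<in> ball 0 1" using K by auto
        have b: "0 < iconf z" using iconf_pos[OF z] .
        have k: "0 \<le> kern x z" using kern_bounds(1)[OF x z] .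
        have "\<bar>iconf z * lap z\<bar> \<le> \<bar>ft z\<bar> + \<bar>w z / (4 * iconf z)\<bar>" unfolding ft_def by linarith
        also have "\<bar>w z / (4 * iconf z)\<bar> = \<bar>w z\<bar> / (4 * iconf z)" using b by simp
        finally have "kern x z * \<bar>iconf z * lap z\<bar> \<le> kern x z * (\<bar>ft z\<bar> + \<bar>w z\<bar> / (4 * iconf z))"
          using k by (rule mult_left_mono)
        then have "ennreal (kern x z * \<bar>iconf z * lap z\<bar>) \<le> ennreal (kern x z * (\<bar>ft z\<bar> + \<bar>w z\<bar> / (4 * iconf z)))"
          by (rule ennreal_leI)
        also have "\<dots> = ennreal (kern x z) * (?f z + ennreal (\<bar>w z\<bar> / (4 * iconf z)))"
          using k b by (subst ennreal_mult) auto
        finally show ?thesis using z by (simp add: green_k_def distrib_left)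
      qed (simp add: lap_off)
    qed
    also have "\<dots> = (\<integral>\<^sup>+z. green_k x z * ?f z \<partial>lborel) + (\<integral>\<^sup>+z. green_k x z * ennreal (\<bar>w z\<bar> / (4 * iconf z)) \<partial>lborel)"
      by (rule nn_integral_add) measurable
    also have "\<dots> \<le> (\<integral>\<^sup>+z. green_k x z * ?f z \<partial>lborel) + ennreal (4 * pi * h)"
      using lower_order_bound[OF x] by (intro add_left_mono) (simp add: h_def)
    finally show ?thesis .
  qed
  have "(\<integral>\<^sup>+x. ennreal (4 * pi\<^sup>2 * \<bar>iconf x * w x\<bar>) * m x \<partial>lborel)
     \<le> (\<integral>\<^sup>+x. (\<integral>\<^sup>+z. green_k x z * ?f z * m x \<partial>lborel) + ennreal (4 * pi * h) * m x \<partial>lborel)"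
  proof (intro nn_integral_mono)
    fix x :: "real^4"
    show "ennreal (4 * pi\<^sup>2 * \<bar>iconf x * w x\<bar>) * m x \<le> (\<integral>\<^sup>+z. green_k x z * ?f z * m x \<partial>lborel) + ennreal (4 * pi * h) * m x"
    proof (cases "x \<in> ball 0 1")
      case True
      have "ennreal (4 * pi\<^sup>2 * \<bar>iconf x * w x\<bar>) * m x \<le> ((\<integral>\<^sup>+z. green_k x z * ?f z \<partial>lborel) + ennreal (4 * pi * h)) * m x"
        by (intro mult_right_mono upper True) simp
      also have "\<dots> = (\<integral>\<^sup>+z. green_k x z * ?f z * m x \<partial>lborel) + ennreal (4 * pi * h) * m x"
        by (subst nn_integral_multc) (auto simp: distrib_right)
      finally show ?thesis .
    qed (simp add: m_ball)
  qed
  also have "\<dots> = (\<integral>\<^sup>+x. \<integral>\<^sup>+z. green_k x z * ?f z * m x \<partial>lborel \<partial>lborel) + (\<integral>\<^sup>+x. ennreal (4 * pi * h) * m x \<partial>lborel)"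
    by (rule nn_integral_add) measurable
  also have "(\<integral>\<^sup>+x. \<integral>\<^sup>+z. green_k x z * ?f z * m x \<partial>lborel \<partial>lborel) = (\<integral>\<^sup>+z. \<integral>\<^sup>+x. green_k x z * ?f z * m x \<partial>lborel \<partial>lborel)"
    by (rule lborel_pair.Fubini') measurable
  also have "\<dots> = (\<integral>\<^sup>+z. ?f z * Psi z \<partial>lborel)"
    unfolding Psi_def by (intro nn_integral_cong, subst nn_integral_cmult[symmetric]) (auto simp: mult_ac)
  also have "(\<integral>\<^sup>+x. ennreal (4 * pi * h) * m x \<partial>lborel) = ennreal (4 * pi * h) * ennreal (a + b)"
    by (subst nn_integral_cmult) (auto simp: m_int)
  also have "(\<integral>\<^sup>+z. ?f z * Psi z \<partial>lborel) + ennreal (4 * pi * h) * ennreal (a + b)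
     \<le> ennreal (A * sqrt P) + ennreal (4 * pi * h * (a + b))"
  proof (intro add_mono)
    show "(\<integral>\<^sup>+z. ?f z * Psi z \<partial>lborel) \<le> ennreal (A * sqrt P)"
      by (rule nn_integral_cauchy_schwarz) (use Psi_sq ft_int P0 A0 in \<open>auto simp: A_def\<close>)
    show "ennreal (4 * pi * h) * ennreal (a + b) \<le> ennreal (4 * pi * h * (a + b))"
      using h0 ab by (subst ennreal_mult) auto
  qed
  also have "\<dots> = ennreal (A * sqrt P + 4 * pi * h * (a + b))"
    using h0 ab P0 A0 by (intro ennreal_plus[symmetric]) (auto simp: A_def)
  finally have "ennreal (4 * pi\<^sup>2 * (a * s1 + b * s2)) \<le> ennreal (A * sqrt P + 4 * pi * h * (a + b))"
    using lower by (rule order_trans[rotated])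
  moreover have "0 \<le> A * sqrt P + 4 * pi * h * (a + b)"
    using h0 ab P0 A0 by (auto simp: A_def)
  ultimately have le: "4 * pi\<^sup>2 * (a * s1 + b * s2) \<le> A * sqrt P + 4 * pi * h * (a + b)"
    by (simp add: ennreal_le_iff)
  \<comment> \<open>The two parts of the energy form one vector of length at most 1 in the plane.\<close>
  have eq: "A * sqrt P + 4 * pi * h * (a + b) = A * sqrt P + (sqrt del * h) * (4 * pi * (a + b) / sqrt del)"
    using del by simp
  have "(4 * pi\<^sup>2 * (a * s1 + b * s2))\<^sup>2 \<le> (A * sqrt P + (sqrt del * h) * (4 * pi * (a + b) / sqrt del))\<^sup>2"
    using le ab s1 s2 unfolding eq by (intro power_mono) auto
  also have "\<dots> \<le> (A\<^sup>2 + (sqrt del * h)\<^sup>2) * ((sqrt P)\<^sup>2 + (4 * pi * (a + b) / sqrt del)\<^sup>2)"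
    by (rule two_term_cauchy_schwarz)
  also have "\<dots> \<le> 1 * ((sqrt P)\<^sup>2 + (4 * pi * (a + b) / sqrt del)\<^sup>2)"
    using nrg' del by (intro mult_right_mono) (auto simp: power_mult_distrib)
  also have "\<dots> = P + 16 * pi\<^sup>2 / del * (a + b)\<^sup>2"
    using P0 del by (simp add: power_divide power_mult_distrib)
  finally show ?thesis
    by (simp add: P_def power_mult_distrib flip: power_mult)
qed

end

section \<open>Summation over the levels\<close>

text \<open>
  Two levels that both come within \<open>L\<close> of saturating the one-level bound, and are not small compared with \<open>L\<close>, are close
  to each other. The test with \<open>b = 1\<close> and \<open>a = A - 1\<close> isolates the increment from \<open>i\<close> to \<open>j\<close>; \<open>A = 4\<close> suffices
  when \<open>j \<le> 9 i\<close>, and the optimal \<open>A\<close> excludes \<open>j > 9 i\<close>.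
\<close>

lemma two_level_gap:
  fixes i j I J L :: real
  assumes ij: "0 < i" "i < j" and L: "1 \<le> L" and i: "5 * L \<le> i"
    and I: "I \<le> i + L" and J: "J \<le> j + L" and IJ: "I \<le> J" and iI: "i \<le> I"
    and test: "\<And>a b. 0 \<le> a \<Longrightarrow> 0 \<le> b \<Longrightarrow>
      (a * sqrt i + b * sqrt j)\<^sup>2 \<le> a\<^sup>2 * I + 2 * a * b * I + b\<^sup>2 * J"
  shows "j - i \<le> 17 * L"
proof -
  define s where "s = sqrt i"
  define t where "t = sqrt j"
  have st: "0 < s" "s < t" "s\<^sup>2 = i" "t\<^sup>2 = j" using ij by (auto simp: s_def t_def)
  have main: "2 * A * s * (t - s) \<le> A\<^sup>2 * L + L + (j - i)" if A: "1 \<le> A" for A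
  proof -
    have "((A - 1) * s + 1 * t)\<^sup>2 \<le> (A - 1)\<^sup>2 * I + 2 * (A - 1) * 1 * I + 1\<^sup>2 * J"
      unfolding s_def t_def by (rule test) (use A in auto)
    moreover have "((A - 1) * s + 1 * t)\<^sup>2 = A\<^sup>2 * s\<^sup>2 + 2 * A * s * (t - s) + (t - s)\<^sup>2"
      by (simp add: power2_eq_square algebra_simps)
    moreover have "(A - 1)\<^sup>2 * I + 2 * (A - 1) * 1 * I + 1\<^sup>2 * J = A\<^sup>2 * I + (J - I)"
      by (simp add: power2_eq_square algebra_simps)
    moreover have "A\<^sup>2 * I \<le> A\<^sup>2 * i + A\<^sup>2 * L"
      using I mult_left_mono[of I "i + L" "A\<^sup>2"] by (simp add: algebra_simps)
    ultimately show ?thesis using J iI zero_le_power2[of "t - s"] unfolding st(3) by linarith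
  qed
  show ?thesis
  proof (cases "t \<le> 3 * s")
    case True
    have "(t - s) * (s + t) \<le> (t - s) * (4 * s)"
      using True st by (intro mult_left_mono) auto
    moreover have "(t - s) * (s + t) = j - i"
      using st by (simp add: power2_eq_square algebra_simps)
    ultimately show ?thesis using main[of 4] by (simp add: algebra_simps)
  next
    case False
    \<comment> \<open>The maximiser of \<open>2 A s (t - s) - A^2 L\<close>.\<close>
    define A where "A = s * (t - s) / L"
    have "5 * L \<le> s * s" using i st by (simp add: power2_eq_square)
    also have "\<dots> \<le> s * (t - s)" using False st by (intro mult_left_mono) auto
    finally have c: "5 * L \<le> s * (t - s)" .
    have A1: "1 \<le> A" using c L by (simp add: A_def field_simps)
    have AL: "A * L = s * (t - s)" using L by (simp add: A_def)
    have 1: "2 * A * s * (t - s) = 2 * A * (A * L)" by (simp add: AL)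
    have 2: "A\<^sup>2 * L = A * (A * L)" by (simp add: power2_eq_square)
    have "A * (A * L) \<le> L + (j - i)"
      using main[OF A1] unfolding 1 2 by linarith
    moreover have "A * (A * L) = s\<^sup>2 * (t - s)\<^sup>2 / L"
      unfolding AL using L by (simp add: A_def power2_eq_square)
    moreover have "5 * (t - s)\<^sup>2 \<le> s\<^sup>2 * (t - s)\<^sup>2 / L"
    proof -
      have "(5 * L) * (t - s)\<^sup>2 \<le> s\<^sup>2 * (t - s)\<^sup>2"
        using i st by (intro mult_right_mono) auto
      then show ?thesis using L by (simp add: field_simps)
    qed
    moreover have "(t/3*2)\<^sup>2 \<le> (t - s)\<^sup>2"
      using False st by (intro power_mono) auto
    ultimately have "20 / 9 * j \<le> L + (j - i)" using st by (simp add: power2_eq_square)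
    then show ?thesis using i ij L by linarith
  qed
qed

text \<open>
  \<open>T n + C - n\<close> is the deficit of level \<open>n\<close> in the one-level bound. Levels of deficit at most \<open>l\<close> lie below \<open>5 l\<close> or
  in one window of length \<open>17 l\<close>.
\<close>

lemma moser_level_card:
  fixes T :: "nat \<Rightarrow> real" and C :: real
  assumes S: "finite S" "0 \<notin> S"
    and mono: "\<And>i j. i \<in> S \<Longrightarrow> j \<in> S \<Longrightarrow> i \<le> j \<Longrightarrow> T i \<le> T j"
    and test: "\<And>i j a b. i \<in> S \<Longrightarrow> j \<in> S \<Longrightarrow> i \<le> j \<Longrightarrow> 0 \<le> a \<Longrightarrow> 0 \<le> b \<Longrightarrow>
      (a * sqrt i + b * sqrt j)\<^sup>2 \<le> a\<^sup>2 * (T i + C) + 2 * a * b * (T i + C) + b\<^sup>2 * (T j + C)"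
    and l: "1 \<le> l"
  shows "real (card {n \<in> S. T n + C - n \<le> real l}) \<le> 22 * real l + 2"
proof -
  let ?A = "{n \<in> S. T n + C - n \<le> real l}"
  let ?B = "{n \<in> ?A. 5 * l \<le> n}"
  have one: "real i \<le> T i + C" if "i \<in> S" for i
    using test[OF that that order_refl, of 1 0] by simp
  have sub: "?B \<subseteq> {Min ?B..Min ?B + 17 * l}"
  proof
    fix j assume j: "j \<in> ?B"
    have fin: "finite ?B" using S by auto
    have m: "Min ?B \<in> ?B" using Min_in[OF fin] j by auto
    have le: "Min ?B \<le> j" using fin j by (rule Min_le)
    show "j \<in> {Min ?B..Min ?B + 17 * l}"
    proof (cases "Min ?B = j")
      case False
      have "real j - real (Min ?B) \<le> 17 * real l"
      proof (rule two_level_gap[where I="T (Min ?B) + C" and J="T j + C"])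
        show "real (Min ?B) \<le> T (Min ?B) + C" using one m by blast
        show "T (Min ?B) + C \<le> real (Min ?B) + real l" "T j + C \<le> real j + real l"
          using m j by auto
        show "0 < real (Min ?B)" using m S by (metis (mono_tags, lifting) mem_Collect_eq of_nat_0_less_iff neq0_conv)
        show "real (Min ?B) < real j" using False le by auto
        show "1 \<le> real l" using l by auto
        show "5 * real l \<le> real (Min ?B)" using m by auto
        show "T (Min ?B) + C \<le> T j + C" using mono[OF _ _ le] m j by auto
        show "(a * sqrt (Min ?B) + b * sqrt j)\<^sup>2 \<le> a\<^sup>2 * (T (Min ?B) + C) + 2 * a * b * (T (Min ?B) + C) + b\<^sup>2 * (T j + C)"
          if "0 \<le> a" "0 \<le> b" for a b
          using test[OF _ _ le that] m j by auto
      qed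
      then show ?thesis using le by auto
    qed auto
  qed
  have "?A \<subseteq> {..<5 * l} \<union> ?B" by auto
  then have "card ?A \<le> card ({..<5 * l} \<union> ?B)" using S by (intro card_mono) auto
  also have "\<dots> \<le> card {..<5 * l} + card ?B" by (rule card_Un_le)
  also have "card ?B \<le> card {Min ?B..Min ?B + 17 * l}" by (intro card_mono sub) auto
  finally show ?thesis by simp
qed

definition moser_const :: real where
  "moser_const = (\<Sum>m. (22 * real m + 2) * exp (1 - real m))"

lemma summable_moser: "summable (\<lambda>m. (22 * real m + 2) * exp (1 - real m))"
proof (rule summable_comparison_test')
  show "summable (\<lambda>m. 44 * exp 1 * exp (- 1 / 2 :: real) ^ m)"
    by (intro summable_mult summable_geometric) auto
  fix m :: nat
  have "22 * real m + 2 \<le> 44 * exp (real m / 2)"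
    using exp_ge_add_one_self[of "real m / 2"] by linarith
  then have "(22 * real m + 2) * exp (1 - real m) \<le> 44 * exp (real m / 2) * exp (1 - real m)"
    by (intro mult_right_mono) auto
  also have "\<dots> = 44 * exp 1 * exp (- 1 / 2 :: real) ^ m"
    by (simp add: exp_of_nat_mult[symmetric] exp_add[symmetric] field_simps)
  finally show "norm ((22 * real m + 2) * exp (1 - real m)) \<le> 44 * exp 1 * exp (- 1 / 2 :: real) ^ m"
    by simp
qed

lemma moser_sum_bound:
  fixes T :: "nat \<Rightarrow> real" and C :: real
  assumes S: "finite S" "0 \<notin> S"
    and mono: "\<And>i j. i \<in> S \<Longrightarrow> j \<in> S \<Longrightarrow> i \<le> j \<Longrightarrow> T i \<le> T j"
    and test: "\<And>i j a b. i \<in> S \<Longrightarrow> j \<in> S \<Longrightarrow> i \<le> j \<Longrightarrow> 0 \<le> a \<Longrightarrow> 0 \<le> b \<Longrightarrow>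
      (a * sqrt i + b * sqrt j)\<^sup>2 \<le> a\<^sup>2 * (T i + C) + 2 * a * b * (T i + C) + b\<^sup>2 * (T j + C)"
  shows "(\<Sum>n\<in>S. exp (real n - T n)) \<le> exp C * moser_const"
proof -
  define L where "L n = T n + C - n" for n
  \<comment> \<open>The levels are grouped by the integer part of their deficit.\<close>
  define m where "m n = nat \<lfloor>L n\<rfloor> + 1" for n
  have one: "0 \<le> L i" if "i \<in> S" for i
    using test[OF that that order_refl, of 1 0] by (simp add: L_def)
  have m: "L n \<le> real (m n)" "real (m n) - 1 \<le> L n" if "n \<in> S" for n
    using one[OF that] by (auto simp: m_def) linarith
  have "(\<Sum>n\<in>S. exp (- L n)) \<le> (\<Sum>n\<in>S. exp (1 - real (m n)))"
    using m(2) by (intro sum_mono) (simp add: algebra_simps)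
  also have "\<dots> = (\<Sum>k\<in>m ` S. \<Sum>n\<in>{n\<in>S. m n = k}. exp (1 - real (m n)))"
    using S by (intro sum.image_gen)
  also have "\<dots> = (\<Sum>k\<in>m ` S. real (card {n\<in>S. m n = k}) * exp (1 - real k))"
    by (intro sum.cong) auto
  also have "\<dots> \<le> (\<Sum>k\<in>m ` S. (22 * real k + 2) * exp (1 - real k))"
  proof (intro sum_mono mult_right_mono)
    fix k assume "k \<in> m ` S"
    then have k: "1 \<le> k" by (auto simp: m_def)
    have "card {n\<in>S. m n = k} \<le> card {n\<in>S. T n + C - n \<le> real k}"
      using S m(1) by (intro card_mono) (auto simp: L_def)
    then show "real (card {n\<in>S. m n = k}) \<le> 22 * real k + 2"
      using moser_level_card[OF S mono test k] by linarith
  qed auto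
  also have "\<dots> \<le> moser_const"
    unfolding moser_const_def using S by (intro sum_le_suminf summable_moser) auto
  finally have "exp C * (\<Sum>n\<in>S. exp (- L n)) \<le> exp C * moser_const" by simp
  moreover have "exp C * (\<Sum>n\<in>S. exp (- L n)) = (\<Sum>n\<in>S. exp (real n - T n))"
    by (simp add: sum_distrib_left L_def exp_add[symmetric] algebra_simps)
  ultimately show ?thesis by simp
qed

section \<open>The exponential inequality\<close>

text \<open>
  The quadratic behaviour at small values is kept apart: the set where \<open>u\<close> is small has infinite volume, and only the
  weighted \<open>L^2\<close> norm controls its contribution.
\<close>

lemma exp_le_level_sum:
  assumes v: "0 \<le> v" "v \<le> real N"
  shows "exp v - 1 \<le> 2 * v + (\<Sum>n\<in>{1..N}. exp (real n + 1) * (if real n < v then 1 else 0))"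
proof (cases "v \<le> 1")
  case True
  have "exp v \<le> 1 + v + v\<^sup>2" using v True by (intro exp_bound) auto
  moreover have "v\<^sup>2 \<le> v" using v True by (simp add: power2_eq_square mult_left_le)
  moreover have "0 \<le> (\<Sum>n\<in>{1..N}. exp (real n + 1) * (if real n < v then 1 else 0))"
    by (intro sum_nonneg) auto
  ultimately show ?thesis by linarith
next
  case False
  define n where "n = nat (\<lceil>v\<rceil> - 1)"
  have n: "real n < v" "v \<le> real n + 1" "n \<in> {1..N}"
    using False v by (auto simp: n_def) linarith+
  have "exp v \<le> exp (real n + 1) * (if real n < v then 1 else 0)" using n by simp
  also have "\<dots> \<le> (\<Sum>n\<in>{1..N}. exp (real n + 1) * (if real n < v then 1 else 0))"
    by (rule member_le_sum[OF n(3)]) auto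
  finally show ?thesis using v by linarith
qed

definition hardy_adams_const :: "real \<Rightarrow> real" where
  "hardy_adams_const del = 64 * pi\<^sup>2 / del + exp 1 * max 1 (32 * pi\<^sup>2 / del)
     * (exp (2 / pi\<^sup>2 * (174 * pi\<^sup>2 + 4 * pi ^ 4 / 3 + 16 * pi\<^sup>2 / del)) * moser_const)"

context ball_C2
begin

text \<open>
  The logarithmic volumes of the level sets \<open>32 \<pi>^2 u^2 > n\<close> satisfy the hypothesis of \<open>moser_sum_bound\<close> by
  \<open>two_level_test\<close>. The volumes themselves are bounded by Chebyshev's inequality and the weighted
  \<open>L^2\<close> norm in the energy.
\<close>

lemma nn_hardy_adams:
  assumes nrg: "(LINT x|lborel. (iconf x * lap x + w x / (4 * iconf x))\<^sup>2)
      + del * ((LINT x|lborel. grad2 x) + (LINT x|lborel. (w x / iconf x)\<^sup>2)) \<le> 1" and del: "0 < del"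
    and wu: "w = (\<lambda>x. u x * (1 / iconf x))" and u: "continuous_on UNIV u" "\<And>x. x \<notin> K \<Longrightarrow> u x = 0"
  shows "(\<integral>\<^sup>+x. ennreal (exp (32 * pi\<^sup>2 * (u x)\<^sup>2) - 1) * hdens x \<partial>lborel) \<le> ennreal (hardy_adams_const del)"
proof -
  have [measurable]: "u \<in> borel_measurable borel" using u(1) by (rule borel_measurable_continuous_onI)
  define v where "v x = 32 * pi\<^sup>2 * (u x)\<^sup>2" for x
  have [measurable]: "v \<in> borel_measurable borel" unfolding v_def[abs_def] by measurable
  have v0: "0 \<le> v x" for x by (simp add: v_def)
  have uw: "iconf x * w x = u x" if "x \<in> ball 0 1" for x using iconf_pos[OF that] by (simp add: wu)
  define Y where "Y = (LINT x|lborel. (w x / iconf x)\<^sup>2)"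
  have Y0: "0 \<le> Y" by (simp add: Y_def)
  have Yle: "Y \<le> 1 / del"
  proof -
    have "0 \<le> (LINT x|lborel. (iconf x * lap x + w x / (4 * iconf x))\<^sup>2)" by simp
    moreover have "0 \<le> del * (LINT x|lborel. grad2 x)"
      using del by (auto simp: grad2_def intro!: mult_nonneg_nonneg integral_nonneg_AE AE_I2 sum_nonneg)
    ultimately have "del * Y \<le> 1" using nrg unfolding Y_def distrib_left by linarith
    then show ?thesis using del by (simp add: field_simps)
  qed
  have wq_m: "(\<lambda>x. ennreal ((w x / iconf x)\<^sup>2)) \<in> borel_measurable lborel"
    using borel_measurable_continuous_onI[OF w_cont] borel_measurable_continuous_onI[OF iconf_cont] by measurable
  have v_int: "(\<integral>\<^sup>+x. ennreal (v x) * hdens x \<partial>lborel) = ennreal (32 * pi\<^sup>2 * Y)"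
  proof -
    have "integrable lborel (\<lambda>x. (w x / iconf x)\<^sup>2)"
      by (rule integrable_compact_support[OF _ K(1)]) (use wq_cont in \<open>auto simp: w_off intro!: continuous_intros\<close>)
    then have "(\<integral>\<^sup>+x. ennreal ((w x / iconf x)\<^sup>2) \<partial>lborel) = ennreal Y"
      unfolding Y_def by (intro nn_integral_eq_integral) auto
    moreover have "ennreal (v x) * hdens x = ennreal (32 * pi\<^sup>2) * ennreal ((w x / iconf x)\<^sup>2)" for x
    proof (cases "x \<in> ball 0 1")
      case True
      have "(u x)\<^sup>2 * (2 / depth x) ^ 4 = (w x / iconf x)\<^sup>2"
        by (simp add: wu iconf_def depth_def power_divide power_mult_distrib power2_eq_square power4_eq_xxxx mult_ac)
      then have "v x * (2 / depth x) ^ 4 = 32 * pi\<^sup>2 * (w x / iconf x)\<^sup>2" by (simp add: v_def)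
      then have "ennreal (v x * (2 / depth x) ^ 4) = ennreal (32 * pi\<^sup>2 * (w x / iconf x)\<^sup>2)" by (rule arg_cong)
      then show ?thesis using True depth_pos[OF True] v0 by (simp add: hdens_def ennreal_mult)
    next
      case False
      then have "x \<notin> K" using K by auto
      then show ?thesis using False by (simp add: hdens_def w_off)
    qed
    ultimately have "(\<integral>\<^sup>+x. ennreal (v x) * hdens x \<partial>lborel) = ennreal (32 * pi\<^sup>2) * ennreal Y"
      by (simp only: nn_integral_cmult[OF wq_m])
    then show ?thesis using Y0 by (simp only: ennreal_mult[symmetric]) (subst ennreal_mult[symmetric], auto)
  qed
  obtain N where N: "\<And>x. v x \<le> real N"
  proof -
    have "compact (v ` K)"
      unfolding v_def by (intro compact_continuous_image K continuous_intros continuous_on_subset[OF u(1)]) auto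
    then obtain B where B: "\<And>y. y \<in> v ` K \<Longrightarrow> norm y \<le> B" "0 < B"
      using compact_imp_bounded bounded_pos by metis
    have "v x \<le> B" for x
    proof (cases "x \<in> K")
      case True
      then show ?thesis using B(1)[of "v x"] by auto
    next
      case False
      then show ?thesis using B(2) u(2) by (simp add: v_def)
    qed
    then show thesis using that[of "nat \<lceil>B\<rceil>"] by (meson of_nat_ceiling order_trans)
  qed

  define Om where "Om n = {x. real n < v x}" for n :: nat
  have Om[measurable]: "Om n \<in> sets borel" for n unfolding Om_def by measurable
  define V where "V n = (\<integral>\<^sup>+x. hdens x * indicator (Om n) x \<partial>lborel)" for n
  have V_le: "V n \<le> ennreal (32 * pi\<^sup>2 * Y)" if "1 \<le> n" for n
  proof -
    have "V n \<le> (\<integral>\<^sup>+x. ennreal (v x) * hdens x \<partial>lborel)"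
      unfolding V_def
    proof (intro nn_integral_mono)
      fix x
      show "hdens x * indicator (Om n) x \<le> ennreal (v x) * hdens x"
      proof (cases "x \<in> Om n")
        case True
        then have "1 \<le> ennreal (v x)" using that by (simp add: Om_def)
        then have "1 * hdens x \<le> ennreal (v x) * hdens x" by (rule mult_right_mono) simp
        then show ?thesis using True by simp
      qed simp
    qed
    then show ?thesis by (simp add: v_int)
  qed
  define t where "t n = enn2real (V n)" for n
  have Vt: "V n = ennreal (t n)" "0 \<le> t n" "t n \<le> 32 * pi\<^sup>2 / del" if "1 \<le> n" for n
  proof -
    have "V n < top" using V_le[OF that] by (simp add: order_le_less_trans)
    then show 1: "V n = ennreal (t n)" by (simp add: t_def)
    show 2: "0 \<le> t n" by (simp add: t_def)
    have "t n \<le> 32 * pi\<^sup>2 * Y" using V_le[OF that] Y0 unfolding 1 by (simp add: ennreal_le_iff)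
    also have "\<dots> \<le> 32 * pi\<^sup>2 * (1 / del)" using Yle by (intro mult_left_mono) auto
    finally show "t n \<le> 32 * pi\<^sup>2 / del" by simp
  qed
  \<comment> \<open>Level sets of measure zero admit no average, and their terms in the sum vanish.\<close>
  define S where "S = {n\<in>{1..N}. 0 < t n}"
  define T where "T n = ln_pos (1 / t n)" for n
  define C where "C = 2 / pi\<^sup>2 * (174 * pi\<^sup>2 + 4 * pi ^ 4 / 3 + 16 * pi\<^sup>2 / del)"
  have "(\<Sum>n\<in>S. exp (real n - T n)) \<le> exp C * moser_const"
  proof (rule moser_sum_bound)
    show "finite S" "0 \<notin> S" by (auto simp: S_def)
    show "T i \<le> T j" if ij: "i \<in> S" "j \<in> S" "i \<le> j" for i j
    proof -
      have i: "1 \<le> i" "0 < t i" "1 \<le> j" "0 < t j" using ij by (auto simp: S_def)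
      have "V j \<le> V i" unfolding V_def
        by (intro nn_integral_mono mult_left_mono) (use ij(3) in \<open>auto simp: Om_def split: split_indicator\<close>)
      then have "t j \<le> t i" using i Vt(1)[of i] Vt(1)[of j] by (simp add: ennreal_le_iff)
      then have "1 / t i \<le> 1 / t j" using i by (intro divide_left_mono) auto
      then have "ln (1 / t i) \<le> ln (1 / t j)" using i by (subst ln_le_cancel_iff) auto
      then show ?thesis by (simp add: T_def ln_pos_def)
    qed
    show "(a * sqrt i + b * sqrt j)\<^sup>2 \<le> a\<^sup>2 * (T i + C) + 2 * a * b * (T i + C) + b\<^sup>2 * (T j + C)"
      if ij: "i \<in> S" "j \<in> S" "i \<le> j" and ab: "0 \<le> a" "0 \<le> b" for i j a b
    proof -
      have i: "1 \<le> i" "0 < t i" "1 \<le> j" "0 < t j" using ij by (auto simp: S_def)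
      define s where "s n = sqrt (real n / (32 * pi\<^sup>2))" for n :: nat
      have s: "s n \<le> \<bar>iconf x * w x\<bar>" if "x \<in> Om n" "x \<in> ball 0 1" for n x
      proof -
        have "real n / (32 * pi\<^sup>2) \<le> (u x)\<^sup>2"
          using that(1) by (simp add: Om_def v_def field_simps)
        then have "s n \<le> sqrt ((u x)\<^sup>2)" unfolding s_def by (rule real_sqrt_le_mono)
        then show ?thesis using uw[OF that(2)] by simp
      qed
      have "16 * pi ^ 4 * (a * s i + b * s j)\<^sup>2
         \<le> a\<^sup>2 * avg_bound (t i) + 2 * a * b * avg_bound (t i) + b\<^sup>2 * avg_bound (t j) + 16 * pi\<^sup>2 / del * (a + b)\<^sup>2"
        by (rule two_level_test[OF nrg del Om[of i] Om[of j]])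
           (use i ab s Vt(1) in \<open>auto simp: V_def[symmetric] s_def\<close>)
      moreover have "16 * pi ^ 4 * (a * s i + b * s j)\<^sup>2 = pi\<^sup>2 / 2 * (a * sqrt i + b * sqrt j)\<^sup>2"
      proof -
        have "s n = sqrt n / sqrt (32 * pi\<^sup>2)" for n by (simp add: s_def real_sqrt_divide)
        then have "a * s i + b * s j = (a * sqrt i + b * sqrt j) / sqrt (32 * pi\<^sup>2)"
          by (simp only: times_divide_eq_right add_divide_distrib)
        then have "(a * s i + b * s j)\<^sup>2 = (a * sqrt i + b * sqrt j)\<^sup>2 / (32 * pi\<^sup>2)"
          by (simp add: power_divide del: real_sqrt_mult)
        then show ?thesis by (simp only:) (simp add: power2_eq_square power4_eq_xxxx)
      qed
      moreover have "a\<^sup>2 * avg_bound (t i) + 2 * a * b * avg_bound (t i) + b\<^sup>2 * avg_bound (t j) + 16 * pi\<^sup>2 / del * (a + b)\<^sup>2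
         = pi\<^sup>2 / 2 * (a\<^sup>2 * (T i + C) + 2 * a * b * (T i + C) + b\<^sup>2 * (T j + C))"
      proof -
        define c where "c = 174 * pi\<^sup>2 + 4 * pi ^ 4 / 3"
        define e where "e = 16 * pi\<^sup>2 / del"
        have "C = 2 / pi\<^sup>2 * (c + e)" by (simp add: C_def c_def e_def)
        then have "pi\<^sup>2 / 2 * C = c + e" by simp
        then have "pi\<^sup>2 / 2 * (T n + C) = avg_bound (t n) + e" for n
          by (simp only: distrib_left) (simp add: T_def avg_bound_def c_def)
        moreover have "k * (x * A + y * A + z * B) = x * (k * A) + y * (k * A) + z * (k * B)" for k x y z A B :: real
          by (simp add: algebra_simps)
        ultimately have "pi\<^sup>2 / 2 * (a\<^sup>2 * (T i + C) + 2 * a * b * (T i + C) + b\<^sup>2 * (T j + C))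
          = a\<^sup>2 * (avg_bound (t i) + e) + 2 * a * b * (avg_bound (t i) + e) + b\<^sup>2 * (avg_bound (t j) + e)"
          by metis
        then show ?thesis
          by (simp only: e_def[symmetric]) (simp add: power2_sum algebra_simps)
      qed
      ultimately have "pi\<^sup>2 / 2 * (a * sqrt i + b * sqrt j)\<^sup>2 \<le> pi\<^sup>2 / 2 * (a\<^sup>2 * (T i + C) + 2 * a * b * (T i + C) + b\<^sup>2 * (T j + C))"
        by linarith
      then show ?thesis by (rule mult_left_le_imp_le) simp
    qed
  qed
  moreover have "exp (real n) * t n \<le> max 1 (32 * pi\<^sup>2 / del) * exp (real n - T n)" if n: "n \<in> S" for n
  proof -
    have n1: "1 \<le> n" "0 < t n" using n by (auto simp: S_def)
    have "t n \<le> max 1 (32 * pi\<^sup>2 / del) * exp (- T n)"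
    proof (cases "t n \<le> 1")
      case True
      then have "exp (- T n) = t n" using n1 by (simp add: T_def ln_pos_def ln_div max_def)
      then show ?thesis using n1 mult_right_mono[of 1 "max 1 (32 * pi\<^sup>2 / del)" "t n"] by simp
    next
      case False
      then have "T n = 0" using n1 by (simp add: T_def ln_pos_def ln_div)
      then show ?thesis using Vt(3)[OF n1(1)] by simp
    qed
    then have "exp (real n) * t n \<le> exp (real n) * (max 1 (32 * pi\<^sup>2 / del) * exp (- T n))"
      by (rule mult_left_mono) simp
    also have "\<dots> = max 1 (32 * pi\<^sup>2 / del) * exp (real n - T n)"
      by (simp add: exp_diff exp_minus divide_inverse)
    finally show ?thesis .
  qed
  then have "(\<Sum>n\<in>S. exp (real n) * t n) \<le> max 1 (32 * pi\<^sup>2 / del) * (\<Sum>n\<in>S. exp (real n - T n))"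
    unfolding sum_distrib_left by (rule sum_mono)
  ultimately have "(\<Sum>n\<in>S. exp (real n) * t n) \<le> max 1 (32 * pi\<^sup>2 / del) * (exp C * moser_const)"
    by (meson max.cobounded1 mult_left_mono order_trans zero_le_one)
  moreover have "(\<Sum>n\<in>S. exp (real n) * t n) = (\<Sum>n\<in>{1..N}. exp (real n) * t n)"
    using Vt(2) by (intro sum.mono_neutral_left) (auto simp: S_def less_le)
  ultimately have sum_le: "(\<Sum>n\<in>{1..N}. exp (real n + 1) * t n) \<le> exp 1 * max 1 (32 * pi\<^sup>2 / del) * (exp C * moser_const)"
    by (simp add: exp_add sum_distrib_left[symmetric] mult_ac)

  have "(\<integral>\<^sup>+x. ennreal (exp (v x) - 1) * hdens x \<partial>lborel)
    \<le> (\<integral>\<^sup>+x. ennreal 2 * (ennreal (v x) * hdens x) + (\<Sum>n\<in>{1..N}. ennreal (exp (real n + 1)) * (hdens x * indicator (Om n) x)) \<partial>lborel)"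
  proof (intro nn_integral_mono)
    fix x
    have "ennreal (exp (v x) - 1) \<le> ennreal (2 * v x + (\<Sum>n\<in>{1..N}. exp (real n + 1) * (if real n < v x then 1 else 0)))"
      by (intro ennreal_leI exp_le_level_sum v0 N)
    also have "\<dots> = ennreal 2 * ennreal (v x) + (\<Sum>n\<in>{1..N}. ennreal (exp (real n + 1) * (if real n < v x then 1 else 0)))"
    proof -
      have "0 \<le> (\<Sum>n\<in>{1..N}. exp (real n + 1) * (if real n < v x then 1 else 0))"
        by (intro sum_nonneg) auto
      moreover have "(\<Sum>n\<in>{1..N}. ennreal (exp (real n + 1) * (if real n < v x then 1 else 0)))
        = ennreal (\<Sum>n\<in>{1..N}. exp (real n + 1) * (if real n < v x then 1 else 0))"
        by (rule sum_ennreal) simp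
      moreover have "ennreal (2 * v x) = ennreal 2 * ennreal (v x)"
        using v0 by (intro ennreal_mult) auto
      ultimately show ?thesis using ennreal_plus[of "2 * v x"] v0 by (simp only:) simp
    qed
    also have "\<dots> = ennreal 2 * ennreal (v x) + (\<Sum>n\<in>{1..N}. ennreal (exp (real n + 1)) * indicator (Om n) x)"
      by (intro arg_cong2[where f="(+)"] sum.cong refl) (auto simp: Om_def)
    finally have "ennreal (exp (v x) - 1) * hdens x \<le> (ennreal 2 * ennreal (v x) + (\<Sum>n\<in>{1..N}. ennreal (exp (real n + 1)) * indicator (Om n) x)) * hdens x"
      by (rule mult_right_mono) simp
    then show "ennreal (exp (v x) - 1) * hdens x
      \<le> ennreal 2 * (ennreal (v x) * hdens x) + (\<Sum>n\<in>{1..N}. ennreal (exp (real n + 1)) * (hdens x * indicator (Om n) x))"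
      by (simp only: distrib_right sum_distrib_right) (simp only: mult_ac)
  qed
  also have "\<dots> = ennreal 2 * (\<integral>\<^sup>+x. ennreal (v x) * hdens x \<partial>lborel) + (\<Sum>n\<in>{1..N}. ennreal (exp (real n + 1)) * V n)"
    unfolding V_def by (simp add: nn_integral_add nn_integral_cmult nn_integral_sum)
  also have "\<dots> = ennreal 2 * ennreal (32 * pi\<^sup>2 * Y) + (\<Sum>n\<in>{1..N}. ennreal (exp (real n + 1) * t n))"
    unfolding v_int using Vt(1,2) by (intro arg_cong2[where f="(+)"] sum.cong refl) (auto simp: ennreal_mult)
  also have "\<dots> = ennreal (64 * pi\<^sup>2 * Y + (\<Sum>n\<in>{1..N}. exp (real n + 1) * t n))"
  proof -
    have "0 \<le> (\<Sum>n\<in>{1..N}. exp (real n + 1) * t n)" using Vt(2) by (intro sum_nonneg) auto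
    moreover have "(\<Sum>n\<in>{1..N}. ennreal (exp (real n + 1) * t n)) = ennreal (\<Sum>n\<in>{1..N}. exp (real n + 1) * t n)"
      using Vt(2) by (intro sum_ennreal) auto
    moreover have "ennreal 2 * ennreal (32 * pi\<^sup>2 * Y) = ennreal (2 * (32 * pi\<^sup>2 * Y))"
      using Y0 by (intro ennreal_mult[symmetric]) auto
    moreover have "2 * (32 * pi\<^sup>2 * Y) = 64 * pi\<^sup>2 * Y" by simp
    ultimately show ?thesis using ennreal_plus[of "64 * pi\<^sup>2 * Y"] Y0 by (simp only:) simp
  qed
  also have "\<dots> \<le> ennreal (hardy_adams_const del)"
  proof (rule ennreal_leI)
    have "64 * pi\<^sup>2 * Y \<le> 64 * pi\<^sup>2 * (1 / del)" using Yle by (intro mult_left_mono) auto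
    then show "64 * pi\<^sup>2 * Y + (\<Sum>n\<in>{1..N}. exp (real n + 1) * t n) \<le> hardy_adams_const del"
      using sum_le unfolding hardy_adams_const_def C_def by simp
  qed
  finally show ?thesis by (simp add: v_def)
qed

end

lemma integral_hyperbolic_volume:
  assumes [measurable]: "G \<in> borel_measurable borel" 
  shows "(LINT x|hyperbolic_volume. G x) = 16 * (LINT x:B4|lborel. G x / (1 - (norm x)\<^sup>2) ^ 4)"
proof -
  have [measurable]: "G \<in> borel_measurable (restrict_space lborel B4)"
    by (rule measurable_restrict_space1) simp
  have m: "(\<lambda>x::real^4. (2 / (1 - (norm x)\<^sup>2)) ^ 4) \<in> borel_measurable (restrict_space lborel B4)"
    by (rule measurable_restrict_space1) measurable
  have "(LINT x|hyperbolic_volume. G x) = (LINT x|restrict_space lborel B4. (2 / (1 - (norm x)\<^sup>2)) ^ 4 *\<^sub>R G x)"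
    unfolding hyperbolic_volume_def by (rule integral_density[OF _ m]) auto
  also have "\<dots> = (LINT x|lborel. indicator B4 x *\<^sub>R ((2 / (1 - (norm x)\<^sup>2)) ^ 4 *\<^sub>R G x))"
    by (rule integral_restrict_space) auto
  also have "\<dots> = (LINT x|lborel. 16 * (indicator B4 x *\<^sub>R (G x / (1 - (norm x)\<^sup>2) ^ 4)))"
    by (rule Bochner_Integration.integral_cong) (auto simp: power_divide)
  also have "\<dots> = 16 * (LINT x:B4|lborel. G x / (1 - (norm x)\<^sup>2) ^ 4)"
    unfolding set_lebesgue_integral_def by (rule integral_mult_right_zero)
  finally show ?thesis .
qed

theorem theorem1p8:
  fixes lam :: real
  assumes "lam < 9"
  shows "\<exists>C::real. C > 0 \<and>
    (\<forall>u \<in> test_functions B4.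
      (LINT x:B4|lborel. (laplacian u x)\<^sup>2)
        - lam * (LINT x:B4|lborel. (u x)\<^sup>2 / (1 - (norm x)\<^sup>2) ^ 4) \<le> 1
      \<longrightarrow>
      (LINT x|hyperbolic_volume. exp (32 * pi\<^sup>2 * (u x)\<^sup>2) - 1)
        = 16 * (LINT x:B4|lborel. (exp (32 * pi\<^sup>2 * (u x)\<^sup>2) - 1) / (1 - (norm x)\<^sup>2) ^ 4)
      \<and>
      16 * (LINT x:B4|lborel. (exp (32 * pi\<^sup>2 * (u x)\<^sup>2) - 1) / (1 - (norm x)\<^sup>2) ^ 4) \<le> C)"
proof -
  define del where "del = min 1 ((9 - lam) / 20)"
  have del: "0 < del" using assms by (simp add: del_def)
  have "16 * (LINT x:B4|lborel. (exp (32 * pi\<^sup>2 * (u x)\<^sup>2) - 1) / (1 - (norm x)\<^sup>2) ^ 4) \<le> max 1 (hardy_adams_const del)"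
    and "u \<in> borel_measurable borel"
    if u: "u \<in> test_functions B4"
      and E: "(LINT x:B4|lborel. (laplacian u x)\<^sup>2)
        - lam * (LINT x:B4|lborel. (u x)\<^sup>2 / (1 - (norm x)\<^sup>2) ^ 4) \<le> 1" for u
  proof -
    obtain d d2 where C2: "ball_C2 (\<lambda>x. u x * (1 / iconf x)) d d2 (closure {x. u x \<noteq> 0})"
      and lapu: "\<And>x. laplacian u x = iconf x * ball_C2.lap d2 x - 2 * ball_C2.radial_deriv d x - 4 * (u x * (1 / iconf x))"
      using conformal_ball_C2[OF u] by blast
    interpret ball_C2 "\<lambda>x. u x * (1 / iconf x)" d d2 "closure {x. u x \<noteq> 0}" by (rule C2)
    have "C_k 0 u" using u by (simp add: test_functions_def del: C_k.simps)
    then have uc: "continuous_on UNIV u" by simp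
    show um[measurable]: "u \<in> borel_measurable borel"
      using uc by (rule borel_measurable_continuous_onI)
    have u0: "u x = 0" if "x \<notin> closure {x. u x \<noteq> 0}" for x
      using that closure_subset[of "{x. u x \<noteq> 0}"] by auto
    note nrg = energy_splitting[OF u assms E C2 refl lapu, folded del_def]
    let ?g = "\<lambda>x. (exp (32 * pi\<^sup>2 * (u x)\<^sup>2) - 1) / (1 - (norm x)\<^sup>2) ^ 4"
    have [measurable]: "(indicator B4 :: real^4 \<Rightarrow> real) \<in> borel_measurable borel"
      by (intro borel_measurable_indicator borel_open open_ball)
    have "16 * (LINT x:B4|lborel. ?g x) = (LINT x|lborel. 16 * (indicator B4 x *\<^sub>R ?g x))"
      unfolding set_lebesgue_integral_def by (rule integral_mult_right_zero[symmetric])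
    also have "\<dots> = enn2real (\<integral>\<^sup>+x. ennreal (16 * (indicator B4 x *\<^sub>R ?g x)) \<partial>lborel)"
      by (rule integral_eq_nn_integral) (auto intro!: AE_I2 mult_nonneg_nonneg divide_nonneg_nonneg)
    also have "(\<integral>\<^sup>+x. ennreal (16 * (indicator B4 x *\<^sub>R ?g x)) \<partial>lborel) = (\<integral>\<^sup>+x. ennreal (exp (32 * pi\<^sup>2 * (u x)\<^sup>2) - 1) * hdens x \<partial>lborel)"
    proof (intro nn_integral_cong)
      fix x :: "real^4"
      show "ennreal (16 * (indicator B4 x *\<^sub>R ?g x)) = ennreal (exp (32 * pi\<^sup>2 * (u x)\<^sup>2) - 1) * hdens x"
        by (cases "norm x < 1") (auto simp: hdens_def depth_def power_divide ennreal_mult[symmetric])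
    qed
    also have "enn2real \<dots> \<le> max 1 (hardy_adams_const del)"
      by (rule enn2real_leI, simp, rule order_trans[OF nn_hardy_adams[OF nrg del refl uc u0]]) (auto intro: ennreal_leI)
    finally show "16 * (LINT x:B4|lborel. ?g x) \<le> max 1 (hardy_adams_const del)" .
  qed
  then show ?thesis
    by (intro exI[of _ "max 1 (hardy_adams_const del)"] conjI ballI impI integral_hyperbolic_volume) auto
qed

end
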